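(* Let $K$ be an indecomposable weak Kac algebra. Then $K$ satisfies the $\lambda$-Markov condition for some $\lambda>0$, i.e. there is $\lambda>0$ with $E_s(p_\varepsilon)=E_t(p_\varepsilon)=\lambda 1$.
   Context: A weak Kac algebra is a finite-dimensional $C^*$-algebra $K$ with linear maps $\Delta:K\to K\otimes K$ (a not necessarily unital $*$-homomorphism), $\varepsilon:K\to\mathbb{C}$ (a positive, not necessarily multiplicative functional) and $S:K\to K$ (a $*$-preserving, anti-multiplicative and anti-comultiplicative map with $S^2=\mathrm{id}$) such that, with $\varepsilon_s(x)=(\mathrm{id}\otimes\varepsilon)((1\otimes x)\Delta(1))$ and $\varepsilon_t(x)=(\varepsilon\otimes\mathrm{id})(\Delta(1)(x\otimes1))$, for all $x,y\in K$: (1) $(\Delta\otimes\mathrm{id})\Delta=(\mathrm{id}\otimes\Delta)\Delta$ and $(\varepsilon\otimes\mathrm{id})\Delta=\mathrm{id}=(\mathrm{id}\otimes\varepsilon)\Delta$; (2) $\varepsilon_s(x)y=(\mathrm{id}\otimes\varepsilon)((1\otimes x)\Delta(y))$; (3) $(\varepsilon_s\otimes\mathrm{id})\Delta(x)=(1\otimes x)\Delta(1)$; (4) $m(S\otimes\mathrm{id})\Delta(x)=\varepsilon_s(x)$, where $m$ is multiplication. The Cartan subalgebras are $K_s=\varepsilon_s(K)$ and $K_t=\varepsilon_t(K)$. The Haar projection $p_\varepsilon\in K$ is the unique projection with $p_\varepsilon x=p_\varepsilon\varepsilon_s(x)$, $xp_\varepsilon=\varepsilon_t(x)p_\varepsilon$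 for all $x\in K$, and $\varepsilon_s(p_\varepsilon)=\varepsilon_t(p_\varepsilon)=1$. The normalized Haar trace $\tau$ is the unique faithful trace on $K$ with $(\tau\otimes\mathrm{id})\Delta=(\tau\otimes\varepsilon_s)\Delta$, $(\mathrm{id}\otimes\tau)\Delta=(\varepsilon_t\otimes\tau)\Delta$ and $\tau\circ\varepsilon_s=\tau\circ\varepsilon_t=\varepsilon$. Put $E_s=(\tau\otimes\mathrm{id})\Delta:K\to K_s$ and $E_t=(\mathrm{id}\otimes\tau)\Delta:K\to K_t$. $K$ is decomposable if it is isomorphic to the direct sum of two (nonzero) weak Kac algebras; otherwise it is indecomposable. *)

theory Defs
  imports Complex_Main "HOL-Algebra.Module" "HOL-Algebra.QuotRing" "HOL-Library.Nonpos_Ints"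
begin

section \<open>Finite-dimensional \<open>C\<^sup>*\<close>-algebras\<close>

definition complex_scalars :: "complex ring" where
  "complex_scalars = \<lparr>carrier = UNIV, mult = (*), one = 1, zero = 0, add = (+)\<rparr>"

record 'a star_alg = "(complex, 'a) module" +
  star :: "'a \<Rightarrow> 'a"

locale star_algebra = Module.module complex_scalars A + ring A
  for A :: "('a, 'm) star_alg_scheme" (structure) +
  assumes smult_mult_left:
      "\<lbrakk>x \<in> carrier A; y \<in> carrier A\<rbrakk> \<Longrightarrow> (c \<odot> x) \<otimes> y = c \<odot> (x \<otimes> y)"
    and smult_mult_right:
      "\<lbrakk>x \<in> carrier A; y \<in> carrier A\<rbrakk> \<Longrightarrow> x \<otimes> (c \<odot> y) = c \<odot> (x \<otimes> y)"
    and star_closed: "x \<in> carrier A \<Longrightarrow> star A x \<in> carrier A"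
    and star_add:
      "\<lbrakk>x \<in> carrier A; y \<in> carrier A\<rbrakk> \<Longrightarrow> star A (x \<oplus> y) = star A x \<oplus> star A y"
    and star_smult: "x \<in> carrier A \<Longrightarrow> star A (c \<odot> x) = cnj c \<odot> star A x"
    and star_mult:
      "\<lbrakk>x \<in> carrier A; y \<in> carrier A\<rbrakk> \<Longrightarrow> star A (x \<otimes> y) = star A y \<otimes> star A x"
    and star_star: "x \<in> carrier A \<Longrightarrow> star A (star A x) = x"

definition cstar_norm :: "('a, 'm) star_alg_scheme \<Rightarrow> ('a \<Rightarrow> real) \<Rightarrow> bool" where
  "cstar_norm A N \<longleftrightarrow>
     (\<forall>x\<in>carrier A. 0 \<le> N x \<and> (N x = 0 \<longleftrightarrow> x = \<zero>\<^bsub>A\<^esub>)) \<and>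
     (\<forall>x\<in>carrier A. \<forall>c. N (c \<odot>\<^bsub>A\<^esub> x) = cmod c * N x) \<and>
     (\<forall>x\<in>carrier A. \<forall>y\<in>carrier A. N (x \<oplus>\<^bsub>A\<^esub> y) \<le> N x + N y) \<and>
     (\<forall>x\<in>carrier A. \<forall>y\<in>carrier A. N (x \<otimes>\<^bsub>A\<^esub> y) \<le> N x * N y) \<and>
     (\<forall>x\<in>carrier A. N (star A x \<otimes>\<^bsub>A\<^esub> x) = (N x)\<^sup>2)"

text \<open>
  The norm of a \<open>C\<^sup>*\<close>-algebra is determined by its \<open>*\<close>-algebra structure, so it is not
  recorded as a separate operation. Completeness is automatic in finite dimension.
\<close>

locale fd_cstar_algebra = star_algebra +
  assumes finite_dimensional:
      "\<exists>B. finite B \<and> B \<subseteq> carrier A \<and> (\<forall>x\<in>carrier A. \<exists>c. x = (\<Oplus>b\<in>B. c b \<odot> b))"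
    and ex_cstar_norm: "\<exists>N. cstar_norm A N"

definition linear_map ::
  "(complex, 'a, 'm) module_scheme \<Rightarrow> (complex, 'b, 'n) module_scheme \<Rightarrow> ('a \<Rightarrow> 'b) \<Rightarrow> bool"
where
  "linear_map V W f \<longleftrightarrow> f \<in> carrier V \<rightarrow> carrier W \<and>
     (\<forall>x\<in>carrier V. \<forall>y\<in>carrier V. f (x \<oplus>\<^bsub>V\<^esub> y) = f x \<oplus>\<^bsub>W\<^esub> f y) \<and>
     (\<forall>x\<in>carrier V. \<forall>c. f (c \<odot>\<^bsub>V\<^esub> x) = c \<odot>\<^bsub>W\<^esub> f x)"

definition linear_form :: "(complex, 'a, 'm) module_scheme \<Rightarrow> ('a \<Rightarrow> complex) \<Rightarrow> bool" where
  "linear_form V f \<longleftrightarrow>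
     (\<forall>x\<in>carrier V. \<forall>y\<in>carrier V. f (x \<oplus>\<^bsub>V\<^esub> y) = f x + f y) \<and>
     (\<forall>x\<in>carrier V. \<forall>c. f (c \<odot>\<^bsub>V\<^esub> x) = c * f x)"

definition positive_form :: "('a, 'm) star_alg_scheme \<Rightarrow> ('a \<Rightarrow> complex) \<Rightarrow> bool" where
  "positive_form A f \<longleftrightarrow> linear_form A f \<and>
     (\<forall>x\<in>carrier A. f (star A x \<otimes>\<^bsub>A\<^esub> x) \<in> \<real>\<^sub>\<ge>\<^sub>0)"

definition projection :: "('a, 'm) star_alg_scheme \<Rightarrow> 'a \<Rightarrow> bool" where
  "projection A p \<longleftrightarrow> p \<in> carrier A \<and> star A p = p \<and> p \<otimes>\<^bsub>A\<^esub> p = p"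


section \<open>Tensor products\<close>

text \<open>
  For finite-dimensional \<open>V\<close>, \<open>W\<close> we use Halmos' model of \<open>V \<otimes> W\<close>: the dual of the space of
  bilinear forms on \<open>V \<times> W\<close>, where the elementary tensor of \<open>a\<close> and \<open>b\<close> is evaluation of a
  form at \<open>(a, b)\<close>. In this model a tensor \<open>t = \<Sum>i. a\<^sub>i \<otimes> b\<^sub>i\<close> satisfies
  \<open>t B = (\<Sum>i. B a\<^sub>i b\<^sub>i)\<close>, so \<open>t (\<lambda>a b. B a b)\<close> may be read in Sweedler notation.
  A map defined on elementary tensors is extended linearly by applying \<open>t\<close> to the form
  obtained by substitution.
\<close>

type_synonym ('a, 'b) tensor = "('a \<Rightarrow> 'b \<Rightarrow> complex) \<Rightarrow> complex"

definition bilinear_forms ::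
  "(complex, 'a, 'm) module_scheme \<Rightarrow> (complex, 'b, 'n) module_scheme \<Rightarrow> ('a \<Rightarrow> 'b \<Rightarrow> complex) set"
where
  "bilinear_forms V W =
     {B. (\<forall>a\<in>carrier V. linear_form W (\<lambda>b. B a b)) \<and>
         (\<forall>b\<in>carrier W. linear_form V (\<lambda>a. B a b))}"

text \<open>
  HOL functions are total, so forms agreeing on the carriers must be identified, and a
  functional gets the dummy value 0 outside the space of bilinear forms. Thus two tensors
  are equal as functions iff they are equal as functionals on bilinear forms.
\<close>

definition on_forms ::
  "(complex, 'a, 'm) module_scheme \<Rightarrow> (complex, 'b, 'n) module_scheme \<Rightarrow>
   ('a, 'b) tensor \<Rightarrow> ('a, 'b) tensor"
where
  "on_forms V W F = (\<lambda>B. if B \<in> bilinear_forms V W then F B else 0)"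

definition tensors ::
  "(complex, 'a, 'm) module_scheme \<Rightarrow> (complex, 'b, 'n) module_scheme \<Rightarrow> ('a, 'b) tensor set"
where
  "tensors V W =
     {t. (\<forall>B. B \<notin> bilinear_forms V W \<longrightarrow> t B = 0) \<and>
         (\<forall>B\<in>bilinear_forms V W. \<forall>B'\<in>bilinear_forms V W.
            (\<forall>a\<in>carrier V. \<forall>b\<in>carrier W. B a b = B' a b) \<longrightarrow> t B = t B') \<and>
         (\<forall>B\<in>bilinear_forms V W. \<forall>B'\<in>bilinear_forms V W.
            t (\<lambda>a b. B a b + B' a b) = t B + t B') \<and>
         (\<forall>B\<in>bilinear_forms V W. \<forall>c. t (\<lambda>a b. c * B a b) = c * t B)}"

definition pure_tensor ::
  "(complex, 'a, 'm) module_scheme \<Rightarrow> (complex, 'b, 'n) module_scheme \<Rightarrow>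
   'a \<Rightarrow> 'b \<Rightarrow> ('a, 'b) tensor"
where
  "pure_tensor V W a b = on_forms V W (\<lambda>B. B a b)"

text \<open>
  Multiplication and involution are the (anti)linear extensions of
  \<open>(a \<otimes> b)(c \<otimes> d) = ac \<otimes> bd\<close> and \<open>(a \<otimes> b)\<^sup>* = a\<^sup>* \<otimes> b\<^sup>*\<close>.
\<close>

definition tensor_product ::
  "('a, 'm) star_alg_scheme \<Rightarrow> ('b, 'n) star_alg_scheme \<Rightarrow> ('a, 'b) tensor star_alg"
where
  "tensor_product V W =
     \<lparr>carrier = tensors V W,
      mult = (\<lambda>t u. on_forms V W
        (\<lambda>B. t (\<lambda>a b. u (\<lambda>c d. B (a \<otimes>\<^bsub>V\<^esub> c) (b \<otimes>\<^bsub>W\<^esub> d))))),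
      one = pure_tensor V W \<one>\<^bsub>V\<^esub> \<one>\<^bsub>W\<^esub>,
      zero = (\<lambda>B. 0),
      add = (\<lambda>t u B. t B + u B),
      smult = (\<lambda>c t B. c * t B),
      star = (\<lambda>t. on_forms V W (\<lambda>B. cnj (t (\<lambda>a b. cnj (B (star V a) (star W b))))))\<rparr>"

text \<open>\<open>f \<otimes> g\<close>, for linear maps \<open>f\<close>, \<open>g\<close> with codomains \<open>V\<close>, \<open>W\<close>.\<close>

definition tensor_map ::
  "(complex, 'c, 'm) module_scheme \<Rightarrow> (complex, 'd, 'n) module_scheme \<Rightarrow>
   ('a \<Rightarrow> 'c) \<Rightarrow> ('b \<Rightarrow> 'd) \<Rightarrow> ('a, 'b) tensor \<Rightarrow> ('c, 'd) tensor"
where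
  "tensor_map V W f g t = on_forms V W (\<lambda>B. t (\<lambda>a b. B (f a) (g b)))"

text \<open>The flip \<open>b \<otimes> a \<mapsto> a \<otimes> b\<close> into \<open>V \<otimes> W\<close>.\<close>

definition tensor_flip ::
  "(complex, 'a, 'm) module_scheme \<Rightarrow> (complex, 'b, 'n) module_scheme \<Rightarrow>
   ('b, 'a) tensor \<Rightarrow> ('a, 'b) tensor"
where
  "tensor_flip V W t = on_forms V W (\<lambda>B. t (\<lambda>b a. B a b))"

text \<open>The canonical identification \<open>(U \<otimes> V) \<otimes> W \<rightarrow> U \<otimes> (V \<otimes> W)\<close>.\<close>

definition tensor_assoc ::
  "('a, 'm) star_alg_scheme \<Rightarrow> ('b, 'n) star_alg_scheme \<Rightarrow> ('c, 'k) star_alg_scheme \<Rightarrow>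
   (('a, 'b) tensor, 'c) tensor \<Rightarrow> ('a, ('b, 'c) tensor) tensor"
where
  "tensor_assoc U V W t = on_forms U (tensor_product V W)
     (\<lambda>B. t (\<lambda>s c. s (\<lambda>a b. B a (pure_tensor V W b c))))"

text \<open>
  The linear map into \<open>V\<close> induced by a \<open>V\<close>-valued bilinear map \<open>f\<close>, i.e. the extension of
  \<open>a \<otimes> b \<mapsto> f a b\<close>. The value is characterised through the linear forms on \<open>V\<close>, which
  separate the points of a finite-dimensional \<open>V\<close>.
  Multiplication \<open>m\<close> and the slice maps (using \<open>V \<otimes> \<complex> = V = \<complex> \<otimes> V\<close>) are instances.
\<close>

definition tensor_lift ::
  "(complex, 'c, 'm) module_scheme \<Rightarrow> ('a \<Rightarrow> 'b \<Rightarrow> 'c) \<Rightarrow> ('a, 'b) tensor \<Rightarrow> 'c"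
where
  "tensor_lift V f t =
     (THE v. v \<in> carrier V \<and> (\<forall>\<phi>. linear_form V \<phi> \<longrightarrow> \<phi> v = t (\<lambda>a b. \<phi> (f a b))))"


section \<open>Weak Kac algebras\<close>

record 'a weak_kac = "'a star_alg" +
  comult :: "'a \<Rightarrow> ('a, 'a) tensor"
  counit :: "'a \<Rightarrow> complex"
  antipode :: "'a \<Rightarrow> 'a"

definition eps_s :: "('a, 'm) weak_kac_scheme \<Rightarrow> 'a \<Rightarrow> 'a" where
  "eps_s K x = tensor_lift K (\<lambda>a b. counit K b \<odot>\<^bsub>K\<^esub> a)
     (pure_tensor K K \<one>\<^bsub>K\<^esub> x \<otimes>\<^bsub>tensor_product K K\<^esub> comult K \<one>\<^bsub>K\<^esub>)"

definition eps_t :: "('a, 'm) weak_kac_scheme \<Rightarrow> 'a \<Rightarrow> 'a" where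
  "eps_t K x = tensor_lift K (\<lambda>a b. counit K a \<odot>\<^bsub>K\<^esub> b)
     (comult K \<one>\<^bsub>K\<^esub> \<otimes>\<^bsub>tensor_product K K\<^esub> pure_tensor K K x \<one>\<^bsub>K\<^esub>)"

locale weak_kac_algebra = fd_cstar_algebra K
  for K :: "('a, 'm) weak_kac_scheme" (structure) +
  assumes comult_linear: "linear_map K (tensor_product K K) (comult K)"
    and comult_mult: "\<lbrakk>x \<in> carrier K; y \<in> carrier K\<rbrakk> \<Longrightarrow>
      comult K (x \<otimes> y) = comult K x \<otimes>\<^bsub>tensor_product K K\<^esub> comult K y"
    and comult_star: "x \<in> carrier K \<Longrightarrow>
      comult K (star K x) = star (tensor_product K K) (comult K x)"
    and counit_positive: "positive_form K (counit K)"
    and antipode_linear: "linear_map K K (antipode K)"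
    and antipode_star: "x \<in> carrier K \<Longrightarrow> antipode K (star K x) = star K (antipode K x)"
    and antipode_mult: "\<lbrakk>x \<in> carrier K; y \<in> carrier K\<rbrakk> \<Longrightarrow>
      antipode K (x \<otimes> y) = antipode K y \<otimes> antipode K x"
    and antipode_comult: "x \<in> carrier K \<Longrightarrow>
      comult K (antipode K x) =
        tensor_flip K K (tensor_map K K (antipode K) (antipode K) (comult K x))"
    and antipode_antipode: "x \<in> carrier K \<Longrightarrow> antipode K (antipode K x) = x"
    and coassoc: "x \<in> carrier K \<Longrightarrow>
      tensor_assoc K K K (tensor_map (tensor_product K K) K (comult K) (\<lambda>b. b) (comult K x)) =
        tensor_map K (tensor_product K K) (\<lambda>a. a) (comult K) (comult K x)"
    and counit_left: "x \<in> carrier K \<Longrightarrow>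
      tensor_lift K (\<lambda>a b. counit K a \<odot> b) (comult K x) = x"
    and counit_right: "x \<in> carrier K \<Longrightarrow>
      tensor_lift K (\<lambda>a b. counit K b \<odot> a) (comult K x) = x"
    and eps_s_mult: "\<lbrakk>x \<in> carrier K; y \<in> carrier K\<rbrakk> \<Longrightarrow>
      eps_s K x \<otimes> y = tensor_lift K (\<lambda>a b. counit K b \<odot> a)
        (pure_tensor K K \<one> x \<otimes>\<^bsub>tensor_product K K\<^esub> comult K y)"
    and eps_s_comult: "x \<in> carrier K \<Longrightarrow>
      tensor_map K K (eps_s K) (\<lambda>b. b) (comult K x) =
        pure_tensor K K \<one> x \<otimes>\<^bsub>tensor_product K K\<^esub> comult K \<one>"
    and antipode_eps_s: "x \<in> carrier K \<Longrightarrow>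
      tensor_lift K (\<lambda>a b. a \<otimes> b) (tensor_map K K (antipode K) (\<lambda>b. b) (comult K x)) =
        eps_s K x"

text \<open>
  The properties in the following two predicates determine \<open>p\<close> and \<open>\<tau>\<close> uniquely.
\<close>

definition haar_projection :: "('a, 'm) weak_kac_scheme \<Rightarrow> 'a \<Rightarrow> bool" where
  "haar_projection K p \<longleftrightarrow> projection K p \<and>
     (\<forall>x\<in>carrier K. p \<otimes>\<^bsub>K\<^esub> x = p \<otimes>\<^bsub>K\<^esub> eps_s K x \<and> x \<otimes>\<^bsub>K\<^esub> p = eps_t K x \<otimes>\<^bsub>K\<^esub> p) \<and>
     eps_s K p = \<one>\<^bsub>K\<^esub> \<and> eps_t K p = \<one>\<^bsub>K\<^esub>"

definition faithful_trace :: "('a, 'm) star_alg_scheme \<Rightarrow> ('a \<Rightarrow> complex) \<Rightarrow> bool" where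
  "faithful_trace A \<tau> \<longleftrightarrow> positive_form A \<tau> \<and>
     (\<forall>x\<in>carrier A. \<forall>y\<in>carrier A. \<tau> (x \<otimes>\<^bsub>A\<^esub> y) = \<tau> (y \<otimes>\<^bsub>A\<^esub> x)) \<and>
     (\<forall>x\<in>carrier A. \<tau> (star A x \<otimes>\<^bsub>A\<^esub> x) = 0 \<longrightarrow> x = \<zero>\<^bsub>A\<^esub>)"

definition haar_trace :: "('a, 'm) weak_kac_scheme \<Rightarrow> ('a \<Rightarrow> complex) \<Rightarrow> bool" where
  "haar_trace K \<tau> \<longleftrightarrow> faithful_trace K \<tau> \<and>
     (\<forall>x\<in>carrier K.
        tensor_lift K (\<lambda>a b. \<tau> a \<odot>\<^bsub>K\<^esub> b) (comult K x) =
          tensor_lift K (\<lambda>a b. \<tau> a \<odot>\<^bsub>K\<^esub> eps_s K b) (comult K x) \<and>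
        tensor_lift K (\<lambda>a b. \<tau> b \<odot>\<^bsub>K\<^esub> a) (comult K x) =
          tensor_lift K (\<lambda>a b. \<tau> b \<odot>\<^bsub>K\<^esub> eps_t K a) (comult K x) \<and>
        \<tau> (eps_s K x) = counit K x \<and> \<tau> (eps_t K x) = counit K x)"

definition E_s :: "('a, 'm) weak_kac_scheme \<Rightarrow> ('a \<Rightarrow> complex) \<Rightarrow> 'a \<Rightarrow> 'a" where
  "E_s K \<tau> x = tensor_lift K (\<lambda>a b. \<tau> a \<odot>\<^bsub>K\<^esub> b) (comult K x)"

definition E_t :: "('a, 'm) weak_kac_scheme \<Rightarrow> ('a \<Rightarrow> complex) \<Rightarrow> 'a \<Rightarrow> 'a" where
  "E_t K \<tau> x = tensor_lift K (\<lambda>a b. \<tau> b \<odot>\<^bsub>K\<^esub> a) (comult K x)"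

definition markov_condition ::
  "('a, 'm) weak_kac_scheme \<Rightarrow> 'a \<Rightarrow> ('a \<Rightarrow> complex) \<Rightarrow> real \<Rightarrow> bool"
where
  "markov_condition K p \<tau> r \<longleftrightarrow>
     E_s K \<tau> p = complex_of_real r \<odot>\<^bsub>K\<^esub> \<one>\<^bsub>K\<^esub> \<and>
     E_t K \<tau> p = complex_of_real r \<odot>\<^bsub>K\<^esub> \<one>\<^bsub>K\<^esub>"


section \<open>Direct sums and decomposability\<close>

definition direct_sum_alg ::
  "('a, 'm) star_alg_scheme \<Rightarrow> ('b, 'n) star_alg_scheme \<Rightarrow> ('a \<times> 'b) star_alg"
where
  "direct_sum_alg K L =
     \<lparr>carrier = carrier K \<times> carrier L,
      mult = (\<lambda>(x, y) (x', y'). (x \<otimes>\<^bsub>K\<^esub> x', y \<otimes>\<^bsub>L\<^esub> y')),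
      one = (\<one>\<^bsub>K\<^esub>, \<one>\<^bsub>L\<^esub>),
      zero = (\<zero>\<^bsub>K\<^esub>, \<zero>\<^bsub>L\<^esub>),
      add = (\<lambda>(x, y) (x', y'). (x \<oplus>\<^bsub>K\<^esub> x', y \<oplus>\<^bsub>L\<^esub> y')),
      smult = (\<lambda>c (x, y). (c \<odot>\<^bsub>K\<^esub> x, c \<odot>\<^bsub>L\<^esub> y)),
      star = (\<lambda>(x, y). (star K x, star L y))\<rparr>"

text \<open>
  \<open>\<Delta>(x, y)\<close> is the sum of the images of \<open>\<Delta>(x)\<close> and \<open>\<Delta>(y)\<close> under the inclusions of
  \<open>K \<otimes> K\<close> and \<open>L \<otimes> L\<close> into \<open>(K \<oplus> L) \<otimes> (K \<oplus> L)\<close>.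
\<close>

definition direct_sum ::
  "('a, 'm) weak_kac_scheme \<Rightarrow> ('b, 'n) weak_kac_scheme \<Rightarrow> ('a \<times> 'b) weak_kac"
where
  "direct_sum K L =
     (let A = direct_sum_alg K L in
      star_alg.extend A
       \<lparr>comult = (\<lambda>(x, y).
          tensor_map A A (\<lambda>a. (a, \<zero>\<^bsub>L\<^esub>)) (\<lambda>a. (a, \<zero>\<^bsub>L\<^esub>)) (comult K x)
          \<oplus>\<^bsub>tensor_product A A\<^esub>
          tensor_map A A (\<lambda>b. (\<zero>\<^bsub>K\<^esub>, b)) (\<lambda>b. (\<zero>\<^bsub>K\<^esub>, b)) (comult L y)),
        counit = (\<lambda>(x, y). counit K x + counit L y),
        antipode = (\<lambda>(x, y). (antipode K x, antipode L y))\<rparr>)"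

definition weak_kac_iso ::
  "('a, 'm) weak_kac_scheme \<Rightarrow> ('b, 'n) weak_kac_scheme \<Rightarrow> ('a \<Rightarrow> 'b) \<Rightarrow> bool"
where
  "weak_kac_iso K L h \<longleftrightarrow> h \<in> ring_iso K L \<and>
     (\<forall>x\<in>carrier K.
        (\<forall>c. h (c \<odot>\<^bsub>K\<^esub> x) = c \<odot>\<^bsub>L\<^esub> h x) \<and>
        h (star K x) = star L (h x) \<and>
        comult L (h x) = tensor_map L L h h (comult K x) \<and>
        counit L (h x) = counit K x \<and>
        h (antipode K x) = antipode L (h x))"

text \<open>
  Searching for the summands on the element type of \<open>K\<close> is no restriction: if \<open>K\<close> is
  isomorphic to a direct sum, each summand is in bijection with a subset of
  \<open>carrier K\<close>, and its structure can be transported there.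
\<close>

definition decomposable :: "'a weak_kac \<Rightarrow> bool" where
  "decomposable K \<longleftrightarrow>
     (\<exists>(K1 :: 'a weak_kac) (K2 :: 'a weak_kac) h.
        weak_kac_algebra K1 \<and> carrier K1 \<noteq> {\<zero>\<^bsub>K1\<^esub>} \<and>
        weak_kac_algebra K2 \<and> carrier K2 \<noteq> {\<zero>\<^bsub>K2\<^esub>} \<and>
        weak_kac_iso K (direct_sum K1 K2) h)"

end

theory Submission
  imports Defs "HOL-Computational_Algebra.Fundamental_Theorem_Algebra"
begin

text \<open>
  The Haar projection satisfies \<open>p\<^sub>1 \<otimes> x p\<^sub>2 = S x p\<^sub>1 \<otimes> p\<^sub>2\<close> and \<open>p\<^sub>1 x \<otimes> p\<^sub>2 = p\<^sub>1 \<otimes> p\<^sub>2 S x\<close>, so that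
  \<open>E\<^sub>s p\<close> and \<open>E\<^sub>t p\<close> are central because \<open>\<tau>\<close> is a trace. The tensors \<open>p\<^sub>1 \<otimes> S p\<^sub>2\<close> and
  \<open>S p\<^sub>1 \<otimes> p\<^sub>2\<close> are multiples of the same Casimir element, by \<open>S (E\<^sub>s p)\<close> and \<open>S (E\<^sub>t p)\<close>
  respectively, and are both sent to \<open>1\<close> by the multiplication; hence \<open>E\<^sub>s p = E\<^sub>t p\<close>. This
  self-adjoint element lies in \<open>K\<^sub>s \<inter> K\<^sub>t\<close> and in the center. A projection \<open>e\<close> with these properties
  splits \<open>K\<close> into the weak Kac algebras \<open>e K\<close> and \<open>(1 - e) K\<close>, so if \<open>K\<close> is indecomposable,
  \<open>E\<^sub>s p\<close> has no nontrivial spectral projection and equals \<open>\<lambda> 1\<close>. Finally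
  \<open>\<lambda> \<tau> 1 = \<tau> (E\<^sub>s p) = \<tau> p > 0\<close>.
\<close>

section \<open>Linear forms and tensors\<close>

text \<open>A tensor is evaluated on scalar bilinear forms and returns a dummy value elsewhere.
  Hence Sweedler identities are proved after an arbitrary linear form has been applied,
  \<open>separation\<close> removes the form at the end, and rewriting under a tensor requires both
  integrands to be bilinear. The axioms on counital maps speak of \<open>\<epsilon>\<^sub>s\<close>;
  the antipode, which swaps the legs of a coproduct and reverses products, supplies the half about
  \<open>\<epsilon>\<^sub>t\<close>. Why a splitting projection e must lie in both Cartan
  subalgebras: an element of the target one can be moved out of the first leg of a coproduct, an
  element of the source one out of the second leg. With f = 1 - e, multiplying the coproduct of x by
  e in the first leg and by f in the second therefore gives the coproduct of f e x = 0, so the mixed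
  components vanish and the coproduct splits. The spectral projection is taken as a polynomial in
  the element, because the central elements in both Cartan subalgebras are stable under the
  operations that build a polynomial.\<close>

lemma complex_scalars_simps [simp]:
  "carrier complex_scalars = UNIV" "a \<otimes>\<^bsub>complex_scalars\<^esub> b = a * b" "\<one>\<^bsub>complex_scalars\<^esub> = 1"
  "\<zero>\<^bsub>complex_scalars\<^esub> = 0" "a \<oplus>\<^bsub>complex_scalars\<^esub> b = a + b"
  by (simp_all add: complex_scalars_def)

lemma cring_complex_scalars: "cring complex_scalars"
proof (rule cringI)
  show "abelian_group complex_scalars"
    by (rule abelian_groupI) (auto simp: algebra_simps intro: exI[of _ "- _"] add.left_inverse)
  show "Group.comm_monoid complex_scalars"
    by (rule comm_monoidI) auto
qed (auto simp: algebra_simps)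

section \<open>Closure rules for linear and bilinear forms\<close>

lemma linear_form_add: "linear_form V f \<Longrightarrow> linear_form V g \<Longrightarrow> linear_form V (\<lambda>x. f x + g x)"
  by (auto simp: linear_form_def algebra_simps)

lemma linear_form_scale [simp]: "linear_form V f \<Longrightarrow> linear_form V (\<lambda>x. c * f x)"
  by (auto simp: linear_form_def algebra_simps)

lemma linear_form_scale_right [simp]: "linear_form V f \<Longrightarrow> linear_form V (\<lambda>x. f x * c)"
  by (auto simp: linear_form_def algebra_simps)

lemma linear_form_zero [simp]: "linear_form V (\<lambda>x. 0)"
  by (auto simp: linear_form_def)

lemma linear_form_sum:
  assumes "\<And>i. i \<in> I \<Longrightarrow> linear_form V (f i)" shows "linear_form V (\<lambda>x. \<Sum>i\<in>I. f i x)"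
  using assms by (auto simp: linear_form_def sum.distrib sum_distrib_left)

lemma linear_form_comp: "linear_form W f \<Longrightarrow> linear_map V W g \<Longrightarrow> linear_form V (\<lambda>x. f (g x))"
  by (auto simp: linear_form_def linear_map_def Pi_def)

lemma linear_form_cong:
  assumes "\<And>x. x \<in> carrier V \<Longrightarrow> f x = g x" and "linear_form V g"
    and "\<And>x y. x \<in> carrier V \<Longrightarrow> y \<in> carrier V \<Longrightarrow> x \<oplus>\<^bsub>V\<^esub> y \<in> carrier V"
    and "\<And>c x. x \<in> carrier V \<Longrightarrow> c \<odot>\<^bsub>V\<^esub> x \<in> carrier V"
  shows "linear_form V f"
  using assms by (simp add: linear_form_def)

lemma linear_map_id [simp]: "linear_map V V (\<lambda>x. x)"
  by (simp add: linear_map_def)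

lemma linear_map_comp: "linear_map V W f \<Longrightarrow> linear_map U V g \<Longrightarrow> linear_map U W (\<lambda>x. f (g x))"
  by (auto simp: linear_map_def Pi_def)

lemma linear_map_closed: "linear_map V W f \<Longrightarrow> x \<in> carrier V \<Longrightarrow> f x \<in> carrier W"
  by (auto simp: linear_map_def)

lemma bilinear_formsI:
  assumes "\<And>a. a \<in> carrier V \<Longrightarrow> linear_form W (\<lambda>b. B a b)"
    and "\<And>b. b \<in> carrier W \<Longrightarrow> linear_form V (\<lambda>a. B a b)"
  shows "B \<in> bilinear_forms V W"
  using assms by (auto simp: bilinear_forms_def)

lemma bilinear_formsD1: "B \<in> bilinear_forms V W \<Longrightarrow> b \<in> carrier W \<Longrightarrow> linear_form V (\<lambda>a. B a b)"
  and bilinear_formsD2: "B \<in> bilinear_forms V W \<Longrightarrow> a \<in> carrier V \<Longrightarrow> linear_form W (\<lambda>b. B a b)"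
  and bilinear_formsD3: "B \<in> bilinear_forms V W \<Longrightarrow> a \<in> carrier V \<Longrightarrow> linear_form W (B a)"
  by (auto simp: bilinear_forms_def)

lemma bilinear_form_scale [simp]:
  "B \<in> bilinear_forms V W \<Longrightarrow> (\<lambda>a b. c * B a b) \<in> bilinear_forms V W"
  by (auto simp: bilinear_forms_def)

lemma bilinear_form_sum:
  assumes "\<And>i. i \<in> I \<Longrightarrow> B i \<in> bilinear_forms V W"
  shows "(\<lambda>a b. \<Sum>i\<in>I. B i a b) \<in> bilinear_forms V W"
  using assms by (auto simp: bilinear_forms_def intro!: linear_form_sum)

lemma bilinear_form_comp:
  assumes "B \<in> bilinear_forms V W" "linear_map V' V f" "linear_map W' W g"
  shows "(\<lambda>a b. B (f a) (g b)) \<in> bilinear_forms V' W'"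
proof (rule bilinear_formsI)
  show "linear_form W' (\<lambda>b. B (f a) (g b))" if "a \<in> carrier V'" for a
    using bilinear_formsD2[OF assms(1) linear_map_closed[OF assms(2) that]] assms(3)
    by (rule linear_form_comp)
  show "linear_form V' (\<lambda>a. B (f a) (g b))" if "b \<in> carrier W'" for b
    using bilinear_formsD1[OF assms(1) linear_map_closed[OF assms(3) that]] assms(2)
    by (rule linear_form_comp)
qed

lemma bilinear_form_mult [simp]:
  "linear_form V f \<Longrightarrow> linear_form W g \<Longrightarrow> (\<lambda>a b. f a * g b) \<in> bilinear_forms V W"
  "linear_form V f \<Longrightarrow> linear_form W g \<Longrightarrow> (\<lambda>a b. g b * f a) \<in> bilinear_forms V W"
  by (auto intro!: bilinear_formsI)

section \<open>Evaluation of tensors on bilinear forms\<close>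

lemma on_forms_apply [simp]: "B \<in> bilinear_forms V W \<Longrightarrow> on_forms V W F B = F B"
  by (simp add: on_forms_def)

lemma pure_tensor_apply [simp]: "B \<in> bilinear_forms V W \<Longrightarrow> pure_tensor V W a b B = B a b"
  by (simp add: pure_tensor_def)

lemma tensor_map_apply [simp]:
  "B \<in> bilinear_forms V W \<Longrightarrow> tensor_map V W f g t B = t (\<lambda>a b. B (f a) (g b))"
  by (simp add: tensor_map_def)

lemma tensor_flip_apply [simp]:
  "B \<in> bilinear_forms V W \<Longrightarrow> tensor_flip V W t B = t (\<lambda>b a. B a b)"
  by (simp add: tensor_flip_def)

lemma tensor_product_simps [simp]:
  "carrier (tensor_product V W) = tensors V W"
  "t \<oplus>\<^bsub>tensor_product V W\<^esub> u = (\<lambda>B. t B + u B)"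
  "c \<odot>\<^bsub>tensor_product V W\<^esub> t = (\<lambda>B. c * t B)"
  "\<zero>\<^bsub>tensor_product V W\<^esub> = (\<lambda>B. 0)"
  by (simp_all add: tensor_product_def)

lemma tensor_mult_apply:
  "B \<in> bilinear_forms V W \<Longrightarrow> (t \<otimes>\<^bsub>tensor_product V W\<^esub> u) B =
    t (\<lambda>a b. u (\<lambda>c d. B (a \<otimes>\<^bsub>V\<^esub> c) (b \<otimes>\<^bsub>W\<^esub> d)))"
  by (simp add: tensor_product_def)

lemma tensor_star_apply:
  "B \<in> bilinear_forms V W \<Longrightarrow> star (tensor_product V W) t B =
    cnj (t (\<lambda>a b. cnj (B (star V a) (star W b))))"
  by (simp add: tensor_product_def)

lemma tensor_eqI:
  assumes "\<And>B. B \<notin> bilinear_forms V W \<Longrightarrow> t B = 0" "\<And>B. B \<notin> bilinear_forms V W \<Longrightarrow> u B = 0"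
    "\<And>B. B \<in> bilinear_forms V W \<Longrightarrow> t B = u B"
  shows "t = u"
proof
  fix B show "t B = u B" using assms by (cases "B \<in> bilinear_forms V W") auto
qed

text \<open>The rule for rewriting inside a Sweedler sum. Values off the carriers do not matter, but
  both integrands have to be bilinear because of the dummy value; this is the source of the
  multilinearity obligations in the later calculations.\<close>

lemma tensor_cong:
  assumes "t \<in> tensors V W" "B \<in> bilinear_forms V W" "B' \<in> bilinear_forms V W"
    "\<And>a b. a \<in> carrier V \<Longrightarrow> b \<in> carrier W \<Longrightarrow> B a b = B' a b"
  shows "t B = t B'"
  using assms unfolding tensors_def by blast

lemma tensor_add:
  "t \<in> tensors V W \<Longrightarrow> B \<in> bilinear_forms V W \<Longrightarrow> B' \<in> bilinear_forms V W \<Longrightarrow>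
    t (\<lambda>a b. B a b + B' a b) = t B + t B'"
  unfolding tensors_def by blast

lemma tensor_scale:
  "t \<in> tensors V W \<Longrightarrow> B \<in> bilinear_forms V W \<Longrightarrow> t (\<lambda>a b. c * B a b) = c * t B"
  unfolding tensors_def by blast

lemma tensor_sum:
  assumes "t \<in> tensors V W" "\<And>i. i \<in> I \<Longrightarrow> B i \<in> bilinear_forms V W"
  shows "t (\<lambda>a b. \<Sum>i\<in>I. B i a b) = (\<Sum>i\<in>I. t (B i))"
proof -
  \<comment> \<open>Serves the empty sum and also infinite \<open>I\<close>, where both sums are 0
    by convention.\<close>
  have z: "t (\<lambda>a b. 0) = 0"
    using tensor_scale[OF assms(1), of "\<lambda>_ _. 0" 0] by (simp add: bilinear_forms_def)
  show ?thesis
  proof (cases "finite I")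
    case True
    then show ?thesis using assms(2)
    proof (induction I rule: finite_induct)
      case (insert i I)
      then show ?case
        using tensor_add[OF assms(1), of "B i" "\<lambda>a b. \<Sum>i\<in>I. B i a b"]
        by (simp add: bilinear_form_sum)
    qed (simp add: z)
  qed (simp add: z)
qed

lemma tensorsI:
  assumes "\<And>B. B \<notin> bilinear_forms V W \<Longrightarrow> t B = 0"
    "\<And>B B'. B \<in> bilinear_forms V W \<Longrightarrow> B' \<in> bilinear_forms V W \<Longrightarrow>
      (\<And>a b. a \<in> carrier V \<Longrightarrow> b \<in> carrier W \<Longrightarrow> B a b = B' a b) \<Longrightarrow> t B = t B'"
    "\<And>B B'. B \<in> bilinear_forms V W \<Longrightarrow> B' \<in> bilinear_forms V W \<Longrightarrow>
      t (\<lambda>a b. B a b + B' a b) = t B + t B'"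
    "\<And>B c. B \<in> bilinear_forms V W \<Longrightarrow> t (\<lambda>a b. c * B a b) = c * t B"
  shows "t \<in> tensors V W"
  unfolding tensors_def mem_Collect_eq
  by (intro conjI allI ballI impI) (use assms in \<open>blast+\<close>)

lemma tensor_outside: "t \<in> tensors V W \<Longrightarrow> B \<notin> bilinear_forms V W \<Longrightarrow> t B = 0"
  unfolding tensors_def by blast

lemma bilinear_form_add [simp]:
  "B \<in> bilinear_forms V W \<Longrightarrow> B' \<in> bilinear_forms V W \<Longrightarrow>
    (\<lambda>a b. B a b + B' a b) \<in> bilinear_forms V W"
  by (auto simp: bilinear_forms_def linear_form_add)

lemma tensors_sum_closed:
  assumes t: "\<And>i. i \<in> I \<Longrightarrow> t i \<in> tensors V W"
  shows "(\<lambda>B. \<Sum>i\<in>I. k i * t i B) \<in> tensors V W"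
proof (rule tensorsI)
  fix B B' assume B: "B \<in> bilinear_forms V W" "B' \<in> bilinear_forms V W"
  show "(\<Sum>i\<in>I. k i * t i B) = (\<Sum>i\<in>I. k i * t i B')"
    if "\<And>a b. a \<in> carrier V \<Longrightarrow> b \<in> carrier W \<Longrightarrow> B a b = B' a b"
    using tensor_cong[OF t B that] by (intro sum.cong) auto
  show "(\<Sum>i\<in>I. k i * t i (\<lambda>a b. B a b + B' a b)) =
      (\<Sum>i\<in>I. k i * t i B) + (\<Sum>i\<in>I. k i * t i B')"
    by (simp add: tensor_add[OF t B] distrib_left sum.distrib)
  show "(\<Sum>i\<in>I. k i * t i (\<lambda>a b. c * B a b)) = c * (\<Sum>i\<in>I. k i * t i B)" for c
    by (simp add: tensor_scale[OF t B(1)] sum_distrib_left mult.left_commute)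
qed (simp add: tensor_outside[OF t])

lemma pure_tensor_closed:
  assumes "a \<in> carrier V" "b \<in> carrier W" shows "pure_tensor V W a b \<in> tensors V W"
  using assms by (intro tensorsI) (simp_all add: pure_tensor_def on_forms_def)

lemma tensor_map_closed:
  assumes "t \<in> tensors V' W'" "linear_map V' V f" "linear_map W' W g"
  shows "tensor_map V W f g t \<in> tensors V W"
proof (rule tensorsI)
  fix B B' assume B: "B \<in> bilinear_forms V W" "B' \<in> bilinear_forms V W"
  note bc = bilinear_form_comp[OF _ assms(2,3)]
  show "tensor_map V W f g t B = tensor_map V W f g t B'"
    if "\<And>a b. a \<in> carrier V \<Longrightarrow> b \<in> carrier W \<Longrightarrow> B a b = B' a b"
    using that B by (auto intro!: tensor_cong[OF assms(1)] bc linear_map_closed[OF assms(2)]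
        linear_map_closed[OF assms(3)])
  show "tensor_map V W f g t (\<lambda>a b. B a b + B' a b) =
      tensor_map V W f g t B + tensor_map V W f g t B'"
    using B by (simp add: tensor_add[OF assms(1)] bc)
  show "tensor_map V W f g t (\<lambda>a b. c * B a b) = c * tensor_map V W f g t B" for c
    using B by (simp add: tensor_scale[OF assms(1)] bc)
qed (simp add: tensor_map_def on_forms_def)

lemma tensor_lift_eq:
  assumes "\<And>x y. x \<in> carrier V \<Longrightarrow> y \<in> carrier V \<Longrightarrow>
      (\<And>\<phi>. linear_form V \<phi> \<Longrightarrow> \<phi> x = \<phi> y) \<Longrightarrow> x = y"
    and "v \<in> carrier V" "\<And>\<phi>. linear_form V \<phi> \<Longrightarrow> \<phi> v = t (\<lambda>a b. \<phi> (f a b))"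
  shows "tensor_lift V f t = v"
  unfolding tensor_lift_def
proof (rule the_equality)
  fix u assume "u \<in> carrier V \<and> (\<forall>\<phi>. linear_form V \<phi> \<longrightarrow> \<phi> u = t (\<lambda>a b. \<phi> (f a b)))"
  with assms show "u = v" by (intro assms(1)) auto
qed (use assms in auto)

text \<open>Gaussian elimination, one equation \<open>b0\<close> at a time: if some unknown
  \<open>j\<close> occurs in it, solve for \<open>j\<close> and substitute into the others; if none
  does, the equation is void. It supplies the relation between the powers of an element in
  \<open>annihilating_poly\<close>.\<close>

lemma exists_linear_dependence:
  fixes f :: "'i \<Rightarrow> 'b \<Rightarrow> complex"
  assumes "finite B" "finite I" "card B < card I"
  shows "\<exists>a. (\<exists>i\<in>I. a i \<noteq> 0) \<and> (\<forall>b\<in>B. (\<Sum>i\<in>I. a i * f i b) = 0)"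
  using assms
proof (induction B arbitrary: I f rule: finite_induct)
  case empty
  then obtain i where "i \<in> I" by fastforce
  then show ?case by (intro exI[of _ "\<lambda>_. 1"]) auto
next
  case (insert b0 B)
  show ?case
  proof (cases "\<forall>i\<in>I. f i b0 = 0")
    case True
    have "card B < card I" using insert by simp
    from insert.IH[OF insert.prems(1) this] obtain a
      where "\<exists>i\<in>I. a i \<noteq> 0" "\<forall>b\<in>B. (\<Sum>i\<in>I. a i * f i b) = 0" by blast
    with True show ?thesis by (intro exI[of _ a]) auto
  next
    case False
    then obtain j where j: "j \<in> I" "f j b0 \<noteq> 0" by auto
    \<comment> \<open>Each row is reduced by the multiple of row \<open>j\<close> that clears its
      entry at \<open>b0\<close>.\<close>
    define g where "g = (\<lambda>i b. f i b - f i b0 / f j b0 * f j b)"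
    have "card B < card (I - {j})" using insert j by simp
    from insert.IH[OF _ this, of g] insert.prems obtain a
      where a: "\<exists>i\<in>I-{j}. a i \<noteq> 0" "\<And>b. b \<in> B \<Longrightarrow> (\<Sum>i\<in>I-{j}. a i * g i b) = 0" by auto
    \<comment> \<open>Equation \<open>b0\<close> forces the value \<open>- s\<close> on the unknown
      \<open>j\<close>.\<close>
    define s where "s = (\<Sum>i\<in>I-{j}. a i * f i b0) / f j b0"
    define a' where "a' = a(j := - s)"
    have sum: "(\<Sum>i\<in>I. a' i * f i b) = (\<Sum>i\<in>I-{j}. a i * g i b)" for b
    proof -
      have "(\<Sum>i\<in>I. a' i * f i b) = - s * f j b + (\<Sum>i\<in>I-{j}. a i * f i b)"
        using j insert.prems(1) by (subst sum.remove[of _ j]) (auto simp: a'_def)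
      also have "\<dots> = (\<Sum>i\<in>I-{j}. a i * g i b)"
        by (simp add: g_def s_def right_diff_distrib sum_subtractf sum_divide_distrib
            sum_distrib_right mult.assoc)
      finally show ?thesis .
    qed
    have "(\<Sum>i\<in>I-{j}. a i * g i b0) = 0" using j by (simp add: g_def)
    with a sum have "\<forall>b\<in>insert b0 B. (\<Sum>i\<in>I. a' i * f i b) = 0" by auto
    moreover have "\<exists>i\<in>I. a' i \<noteq> 0" using a(1) by (auto simp: a'_def)
    ultimately show ?thesis by blast
  qed
qed

section \<open>Arithmetic of star-algebras and products of tensors over them\<close>

context star_algebra
begin

lemma smult_closed' [simp, intro]: "x \<in> carrier A \<Longrightarrow> c \<odot> x \<in> carrier A"
  by (simp add: smult_closed)

lemma smult_add_left: "x \<in> carrier A \<Longrightarrow> (c + d) \<odot> x = c \<odot> x \<oplus> d \<odot> x"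
  using smult_l_distr[of c d x] by simp

lemma smult_add_right: "x \<in> carrier A \<Longrightarrow> y \<in> carrier A \<Longrightarrow> c \<odot> (x \<oplus> y) = c \<odot> x \<oplus> c \<odot> y"
  using smult_r_distr[of c x y] by simp

lemma smult_smult: "x \<in> carrier A \<Longrightarrow> c \<odot> (d \<odot> x) = (c * d) \<odot> x"
  using smult_assoc1[of c d x] by simp

lemma smult_one_left [simp]: "x \<in> carrier A \<Longrightarrow> 1 \<odot> x = x"
  using smult_one[of x] by simp

lemma smult_zero_left [simp]: "x \<in> carrier A \<Longrightarrow> 0 \<odot> x = \<zero>"
  using smult_l_null[of x] by simp

lemma smult_zero_right [simp]: "c \<odot> \<zero> = \<zero>"
  using smult_r_null[of c] by simp

lemma add_neg_smult: "x \<in> carrier A \<Longrightarrow> x \<oplus> (-1) \<odot> x = \<zero>"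
  using smult_add_left[of x 1 "-1"] by simp

lemma smult_eq_zero: "x \<in> carrier A \<Longrightarrow> c \<odot> x = \<zero> \<Longrightarrow> c \<noteq> 0 \<Longrightarrow> x = \<zero>"
  using smult_smult[of x "inverse c" c] by simp

lemma star_closed' [simp]: "x \<in> carrier A \<Longrightarrow> star A x \<in> carrier A"
  by (rule star_closed)

lemma star_star' [simp]: "x \<in> carrier A \<Longrightarrow> star A (star A x) = x"
  by (rule star_star)

lemma star_zero [simp]: "star A \<zero> = \<zero>"
  using star_smult[of \<one> 0] star_closed[of \<one>] by simp

lemma star_one [simp]: "star A \<one> = \<one>"
  by (metis one_closed r_one star_closed star_mult star_star l_one)

lemma linear_form_lin:
  assumes "linear_form A f"
  shows "x \<in> carrier A \<Longrightarrow> y \<in> carrier A \<Longrightarrow> f (x \<oplus> y) = f x + f y"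
    "x \<in> carrier A \<Longrightarrow> f (c \<odot> x) = c * f x"
    "f \<zero> = 0"
proof -
  show "x \<in> carrier A \<Longrightarrow> y \<in> carrier A \<Longrightarrow> f (x \<oplus> y) = f x + f y"
    and *: "x \<in> carrier A \<Longrightarrow> f (c \<odot> x) = c * f x" for x y c
    using assms by (auto simp: linear_form_def)
  show "f \<zero> = 0" using *[of \<zero> 0] by simp
qed

lemma linear_form_finsum:
  assumes "linear_form A f" "finite I" "g \<in> I \<rightarrow> carrier A"
  shows "f (\<Oplus>i\<in>I. g i) = (\<Sum>i\<in>I. f (g i))"
  using assms(2,3)
proof (induction I rule: finite_induct)
  case (insert i I)
  then have "f (finsum A g (insert i I)) = f (g i \<oplus> finsum A g I)"
    by (subst M.finsum_insert) auto
  also have "\<dots> = f (g i) + f (finsum A g I)"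
    using insert by (intro linear_form_lin(1)[OF assms(1)] M.finsum_closed) auto
  finally show ?case using insert by auto
qed (simp add: linear_form_lin[OF assms(1)])

lemma linear_form_expand:
  assumes "finite B" "B \<subseteq> carrier A" "x = (\<Oplus>b\<in>B. c b \<odot> b)" "linear_form A f"
  shows "f x = (\<Sum>b\<in>B. c b * f b)"
  using assms by (simp add: linear_form_finsum subset_iff linear_form_lin)

lemma linear_map_mult [simp]:
  "linear_map A A f \<Longrightarrow> c \<in> carrier A \<Longrightarrow> linear_map A A (\<lambda>x. f x \<otimes> c)"
  "linear_map A A f \<Longrightarrow> c \<in> carrier A \<Longrightarrow> linear_map A A (\<lambda>x. c \<otimes> f x)"
  by (auto simp: linear_map_def Pi_def l_distr r_distr smult_mult_left smult_mult_right)

lemma linear_map_mult_left [simp]: "c \<in> carrier A \<Longrightarrow> linear_map A A (\<lambda>x. c \<otimes> x)"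
  using linear_map_mult(2)[of "\<lambda>x. x" c] by simp

lemma linear_form_star: "linear_form A f \<Longrightarrow> linear_form A (\<lambda>x. cnj (f (star A x)))"
  by (auto simp: linear_form_def star_add star_smult)

lemma bilinear_form_star:
  "B \<in> bilinear_forms A A \<Longrightarrow> (\<lambda>a b. cnj (B (star A a) (star A b))) \<in> bilinear_forms A A"
  unfolding bilinear_forms_def by (auto simp: linear_form_def star_add star_smult)

text \<open>Polarisation against the unit. The value of \<open>f\<close> at
  \<open>star A y \<otimes> y\<close> with \<open>y = \<one> \<oplus> c \<odot> x\<close> is real;
  for \<open>cmod c = 1\<close> the outer terms of its expansion are real, hence so are the two
  mixed ones together. It is applied to the counit and to the trace.\<close>

lemma positive_form_star:
  assumes f: "positive_form A f" and x: "x \<in> carrier A" shows "f (star A x) = cnj (f x)"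
proof -
  have Im0: "Im (f (star A z \<otimes> z)) = 0" if "z \<in> carrier A" for z
    using f that by (auto simp: positive_form_def complex_nonneg_Reals_iff)
  have lin: "f (u \<oplus> v) = f u + f v" "f (c \<odot> u) = c * f u"
    if "u \<in> carrier A" "v \<in> carrier A" for u v c
    using that linear_form_lin[of f] f by (auto simp: positive_form_def)
  have 1: "star A (\<one> \<oplus> c \<odot> x) \<otimes> (\<one> \<oplus> c \<odot> x) =
      \<one> \<oplus> cnj c \<odot> star A x \<oplus> (c \<odot> x \<oplus> (c * cnj c) \<odot> (star A x \<otimes> x))" for c
    using x by (simp add: star_add star_smult l_distr r_distr smult_mult_left smult_mult_right
      smult_smult smult_add_right mult.commute)
  have "Im (c * f x + cnj c * f (star A x)) = 0" if "cmod c = 1" for c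
  proof -
    have cc: "c * cnj c = 1"
      using that by (simp add: complex_norm_square[symmetric])
    have "Im (f (star A (\<one> \<oplus> c \<odot> x) \<otimes> (\<one> \<oplus> c \<odot> x))) = 0"
      by (rule Im0) (use x in simp)
    then have "Im (f \<one>) + Im (c * f x + cnj c * f (star A x)) + Im (f (star A x \<otimes> x)) = 0"
      unfolding 1 cc using x by (simp add: lin algebra_simps)
    then show ?thesis using Im0[of \<one>] Im0[OF x] by simp
  qed
  \<comment> \<open>The value 1 compares the imaginary parts of \<open>f x\<close> and
    \<open>f (star A x)\<close>, the value \<open>\<i>\<close> their real parts.\<close>
  from this[of 1] this[of \<i>] show ?thesis by (simp add: complex_eq_iff)
qed

text \<open>This legitimises nested Sweedler sums: the inner sum is linear in every parameter in
  which its integrand is, so it can be the integrand of an outer one.\<close>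

lemma linear_form_tensor:
  assumes "t \<in> tensors A A" "\<And>x. x \<in> carrier A \<Longrightarrow> B x \<in> bilinear_forms A A"
    "\<And>a b. a \<in> carrier A \<Longrightarrow> b \<in> carrier A \<Longrightarrow> linear_form A (\<lambda>x. B x a b)"
  shows "linear_form A (\<lambda>x. t (\<lambda>a b. B x a b))"
  unfolding linear_form_def
proof (intro conjI ballI allI)
  fix x y assume xy: "x \<in> carrier A" "y \<in> carrier A"
  then have "t (B (x \<oplus> y)) = t (\<lambda>a b. B x a b + B y a b)"
    using assms(2) linear_form_lin(1)[OF assms(3)] by (intro tensor_cong[OF assms(1)]) auto
  then show "t (\<lambda>a b. B (x \<oplus> y) a b) = t (\<lambda>a b. B x a b) + t (\<lambda>a b. B y a b)"
    using xy assms(2) by (simp add: tensor_add[OF assms(1)])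
next
  fix x c assume x: "x \<in> carrier A"
  then have "t (B (c \<odot> x)) = t (\<lambda>a b. c * B x a b)"
    using assms(2) linear_form_lin(2)[OF assms(3)] by (intro tensor_cong[OF assms(1)]) auto
  then show "t (\<lambda>a b. B (c \<odot> x) a b) = c * t (\<lambda>a b. B x a b)"
    using x assms(2) by (simp add: tensor_scale[OF assms(1)])
qed

text \<open>Without this the inner evaluation in the product of two tensors could fall on the dummy
  value of the outer tensor.\<close>

lemma mult_form_bilinear:
  assumes "B \<in> bilinear_forms A A" "t \<in> tensors A A"
  shows "(\<lambda>a b. t (\<lambda>c d. B (a \<otimes> c) (b \<otimes> d))) \<in> bilinear_forms A A"
proof -
  have b: "(\<lambda>c d. B (a \<otimes> c) (b \<otimes> d)) \<in> bilinear_forms A A"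
    if "a \<in> carrier A" "b \<in> carrier A" for a b
    using that by (intro bilinear_form_comp[OF assms(1)]) auto
  have l: "linear_form A (\<lambda>x. B (x \<otimes> c) d)" "linear_form A (\<lambda>x. B d (x \<otimes> c))"
    if "c \<in> carrier A" "d \<in> carrier A" for c d
    using that linear_form_comp[OF bilinear_formsD1[OF assms(1)], of d A "\<lambda>x. x \<otimes> c"]
      linear_form_comp[OF bilinear_formsD2[OF assms(1)], of d A "\<lambda>x. x \<otimes> c"] by simp_all
  show ?thesis
    by (rule bilinear_formsI) (rule linear_form_tensor[OF assms(2)]; simp add: b l)+
qed

lemma pure_tensor_mult_apply:
  assumes "B \<in> bilinear_forms A A" "t \<in> tensors A A"
  shows "(pure_tensor A A x y \<otimes>\<^bsub>tensor_product A A\<^esub> t) B = t (\<lambda>c d. B (x \<otimes> c) (y \<otimes> d))"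
  using assms by (simp add: tensor_mult_apply mult_form_bilinear)

lemma mult_pure_tensor_apply:
  assumes "B \<in> bilinear_forms A A" "t \<in> tensors A A" "x \<in> carrier A" "y \<in> carrier A"
  shows "(t \<otimes>\<^bsub>tensor_product A A\<^esub> pure_tensor A A x y) B = t (\<lambda>c d. B (c \<otimes> x) (d \<otimes> y))"
proof -
  have "(\<lambda>c d. B (a \<otimes> c) (b \<otimes> d)) \<in> bilinear_forms A A" if "a \<in> carrier A" "b \<in> carrier A" for a b
    using that by (intro bilinear_form_comp[OF assms(1)]) auto
  moreover have "(\<lambda>c d. B (c \<otimes> x) (d \<otimes> y)) \<in> bilinear_forms A A"
    using assms by (intro bilinear_form_comp[OF assms(1)]) auto
  moreover have "pure_tensor A A x y \<in> tensors A A"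
    using assms by (intro pure_tensor_closed)
  ultimately show ?thesis using assms
    by (auto simp: tensor_mult_apply intro!: tensor_cong[OF assms(2)] mult_form_bilinear)
qed

lemma tensor_mult_closed:
  assumes t: "t \<in> tensors A A" and u: "u \<in> tensors A A"
  shows "t \<otimes>\<^bsub>tensor_product A A\<^esub> u \<in> tensors A A"
proof (rule tensorsI)
  fix B B' assume B: "B \<in> bilinear_forms A A" "B' \<in> bilinear_forms A A"
  have bc: "(\<lambda>c d. C (a \<otimes> c) (b \<otimes> d)) \<in> bilinear_forms A A"
    if "C \<in> bilinear_forms A A" "a \<in> carrier A" "b \<in> carrier A" for a b C
    using that by (intro bilinear_form_comp[OF that(1)]) auto
  show "(t \<otimes>\<^bsub>tensor_product A A\<^esub> u) B = (t \<otimes>\<^bsub>tensor_product A A\<^esub> u) B'"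
    if "\<And>a b. a \<in> carrier A \<Longrightarrow> b \<in> carrier A \<Longrightarrow> B a b = B' a b"
    using B that u by (auto simp: tensor_mult_apply bc mult_form_bilinear
        intro!: tensor_cong[OF t] tensor_cong[OF u])
  have "(t \<otimes>\<^bsub>tensor_product A A\<^esub> u) (\<lambda>a b. B a b + B' a b) =
    t (\<lambda>a b. u (\<lambda>c d. B (a \<otimes> c) (b \<otimes> d)) + u (\<lambda>c d. B' (a \<otimes> c) (b \<otimes> d)))"
    unfolding tensor_mult_apply[OF bilinear_form_add[OF B]]
    using B by (intro tensor_cong[OF t] mult_form_bilinear bilinear_form_add u)
      (simp_all add: tensor_add[OF u] bc)
  then show "(t \<otimes>\<^bsub>tensor_product A A\<^esub> u) (\<lambda>a b. B a b + B' a b) =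
      (t \<otimes>\<^bsub>tensor_product A A\<^esub> u) B + (t \<otimes>\<^bsub>tensor_product A A\<^esub> u) B'"
    using B by (simp add: tensor_mult_apply tensor_add[OF t] mult_form_bilinear[OF _ u])
  fix c
  have "(t \<otimes>\<^bsub>tensor_product A A\<^esub> u) (\<lambda>a b. c * B a b) =
    t (\<lambda>a b. c * u (\<lambda>c d. B (a \<otimes> c) (b \<otimes> d)))"
    unfolding tensor_mult_apply[OF bilinear_form_scale[OF B(1)]]
    using B by (intro tensor_cong[OF t] mult_form_bilinear bilinear_form_scale u)
      (simp_all add: tensor_scale[OF u] bc)
  then show "(t \<otimes>\<^bsub>tensor_product A A\<^esub> u) (\<lambda>a b. c * B a b) = c * (t \<otimes>\<^bsub>tensor_product A A\<^esub> u) B"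
    using B by (simp add: tensor_mult_apply tensor_scale[OF t] mult_form_bilinear[OF _ u])
qed (simp add: tensor_product_def on_forms_def)

end

section \<open>Bases, separation by linear forms, and expansion of tensors\<close>

context fd_cstar_algebra
begin

text \<open>A spanning set of minimal size is a basis, and its coordinate functions are linear.\<close>

lemma basis:
  obtains B \<phi> where "finite B" "B \<subseteq> carrier A" "\<And>b. b \<in> B \<Longrightarrow> linear_form A (\<phi> b)"
    "\<And>x. x \<in> carrier A \<Longrightarrow> x = (\<Oplus>b\<in>B. \<phi> b x \<odot> b)"
proof -
  define spans where "spans B \<longleftrightarrow> finite B \<and> B \<subseteq> carrier A \<and>
    (\<forall>x\<in>carrier A. \<exists>c. x = (\<Oplus>b\<in>B. c b \<odot> b))" for B
  define B where "B = arg_min card spans"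
  have "\<exists>B. spans B" using finite_dimensional by (simp add: spans_def)
  then have B: "spans B" and min: "\<And>B'. spans B' \<Longrightarrow> card B \<le> card B'"
    unfolding B_def using arg_min_natI[of spans] arg_min_nat_le[of spans] by blast+
  have fin: "finite B" and sub: "B \<subseteq> carrier A" using B by (auto simp: spans_def)
  have cl: "(\<lambda>b. c b \<odot> b) \<in> B \<rightarrow> carrier A" for c using sub by auto
  have add: "(\<Oplus>b\<in>B. c b \<odot> b) \<oplus> (\<Oplus>b\<in>B. d b \<odot> b) = (\<Oplus>b\<in>B. (c b + d b) \<odot> b)" for c d
  proof -
    have "(\<Oplus>b\<in>B. (c b + d b) \<odot> b) = (\<Oplus>b\<in>B. c b \<odot> b \<oplus> d b \<odot> b)"
      using sub by (intro M.finsum_cong') (auto simp: smult_add_left)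
    then show ?thesis using cl by (simp add: M.finsum_addf)
  qed
  have scale: "k \<odot> (\<Oplus>b\<in>B. c b \<odot> b) = (\<Oplus>b\<in>B. (k * c b) \<odot> b)" for k c
  proof -
    have "k \<odot> (\<Oplus>b\<in>B. c b \<odot> b) = (\<Oplus>b\<in>B. k \<odot> (c b \<odot> b))"
      using finsum_smult_ldistr[OF fin, of k "\<lambda>b. c b \<odot> b"] cl by simp
    also have "\<dots> = (\<Oplus>b\<in>B. (k * c b) \<odot> b)"
      using sub by (intro M.finsum_cong') (auto simp: smult_smult)
    finally show ?thesis .
  qed
  have indep: "d b0 = 0" if d: "(\<Oplus>b\<in>B. d b \<odot> b) = \<zero>" and b0: "b0 \<in> B" for d b0
  proof (rule ccontr)
    assume nz: "d b0 \<noteq> 0"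
    have "spans (B - {b0})"
      unfolding spans_def
    proof (intro conjI ballI)
      fix x assume "x \<in> carrier A"
      with B obtain c where c: "x = (\<Oplus>b\<in>B. c b \<odot> b)" by (auto simp: spans_def)
      define c' where "c' b = c b + (- c b0 / d b0) * d b" for b
      have "x = x \<oplus> (- c b0 / d b0) \<odot> (\<Oplus>b\<in>B. d b \<odot> b)"
        unfolding d using \<open>x \<in> carrier A\<close> by simp
      also have "\<dots> = (\<Oplus>b\<in>B. c' b \<odot> b)"
        unfolding scale c add c'_def ..
      also have "\<dots> = (\<Oplus>b\<in>insert b0 (B - {b0}). c' b \<odot> b)" using b0 by (simp add: insert_absorb)
      also have "\<dots> = c' b0 \<odot> b0 \<oplus> (\<Oplus>b\<in>B - {b0}. c' b \<odot> b)"
        using fin sub b0 by (subst M.finsum_insert) auto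
      also have "\<dots> = (\<Oplus>b\<in>B - {b0}. c' b \<odot> b)"
        using nz sub b0 by (subst M.l_zero[symmetric])
          (auto simp: c'_def intro!: M.finsum_closed)
      finally show "\<exists>c. x = (\<Oplus>b\<in>B - {b0}. c b \<odot> b)" by blast
    qed (use fin sub in auto)
    from min[OF this] fin b0 show False by (simp add: card_Diff_singleton card_gt_0_iff)
       (metis Suc_pred card_gt_0_iff empty_iff not_less_eq_eq order_refl)
  qed
  have uniq: "c b = d b" if "(\<Oplus>b\<in>B. c b \<odot> b) = (\<Oplus>b\<in>B. d b \<odot> b)" "b \<in> B" for c d b
  proof -
    have "(\<Oplus>b\<in>B. (c b + (-1) * d b) \<odot> b) = (\<Oplus>b\<in>B. c b \<odot> b) \<oplus> (-1) \<odot> (\<Oplus>b\<in>B. d b \<odot> b)"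
      by (simp only: scale add)
    also have "\<dots> = \<zero>"
      unfolding that(1) by (rule add_neg_smult[OF M.finsum_closed[OF cl]])
    finally show ?thesis using indep[of "\<lambda>b. c b + (-1) * d b" b] that(2) by simp
  qed
  \<comment> \<open>The choice is made for all coordinates of \<open>x\<close> at once;
    \<open>uniq\<close> then forces them to depend linearly on \<open>x\<close>.\<close>
  define \<phi> where "\<phi> b x = (SOME c. x = (\<Oplus>b\<in>B. c b \<odot> b)) b" for b x
  have \<phi>: "x = (\<Oplus>b\<in>B. \<phi> b x \<odot> b)" if "x \<in> carrier A" for x
    unfolding \<phi>_def using someI_ex[of "\<lambda>c. x = (\<Oplus>b\<in>B. c b \<odot> b)"] B that
    unfolding spans_def by blast
  have "linear_form A (\<phi> b)" if "b \<in> B" for b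
    unfolding linear_form_def
  proof (intro conjI ballI allI)
    fix x y assume xy: "x \<in> carrier A" "y \<in> carrier A"
    have "(\<Oplus>b\<in>B. \<phi> b (x \<oplus> y) \<odot> b) = x \<oplus> y" by (rule \<phi>[symmetric]) (use xy in simp)
    also have "\<dots> = (\<Oplus>b\<in>B. \<phi> b x \<odot> b) \<oplus> (\<Oplus>b\<in>B. \<phi> b y \<odot> b)"
      by (rule arg_cong2[OF \<phi>[OF xy(1)] \<phi>[OF xy(2)]])
    also have "\<dots> = (\<Oplus>b\<in>B. (\<phi> b x + \<phi> b y) \<odot> b)" by (rule add)
    finally show "\<phi> b (x \<oplus> y) = \<phi> b x + \<phi> b y" by (rule uniq[OF _ that])
  next
    fix x c assume x: "x \<in> carrier A"
    have "(\<Oplus>b\<in>B. \<phi> b (c \<odot> x) \<odot> b) = c \<odot> x" by (rule \<phi>[symmetric]) (use x in simp)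
    also have "\<dots> = c \<odot> (\<Oplus>b\<in>B. \<phi> b x \<odot> b)" by (rule arg_cong[OF \<phi>[OF x]])
    also have "\<dots> = (\<Oplus>b\<in>B. (c * \<phi> b x) \<odot> b)" by (rule scale)
    finally show "\<phi> b (c \<odot> x) = c * \<phi> b x" by (rule uniq[OF _ that])
  qed
  with \<phi> fin sub that show thesis by blast
qed

text \<open>The coordinate forms of a basis already separate points. This reduces identities in the
  algebra to scalar ones, on which tensors can be evaluated.\<close>

lemma separation:
  assumes "x \<in> carrier A" "y \<in> carrier A" "\<And>\<phi>. linear_form A \<phi> \<Longrightarrow> \<phi> x = \<phi> y"
  shows "x = y"
proof -
  obtain B \<phi> where B: "finite B" "B \<subseteq> carrier A" "\<And>b. b \<in> B \<Longrightarrow> linear_form A (\<phi> b)"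
    "\<And>x. x \<in> carrier A \<Longrightarrow> x = (\<Oplus>b\<in>B. \<phi> b x \<odot> b)" by (rule basis) blast
  have "(\<Oplus>b\<in>B. \<phi> b x \<odot> b) = (\<Oplus>b\<in>B. \<phi> b y \<odot> b)"
    using B(2) assms(3)[OF B(3)] by (intro M.finsum_cong') auto
  with B(4) assms show ?thesis by metis
qed

text \<open>The description in \<open>tensor_lift\<close> is proper: applying \<open>t\<close> to
  the coordinates of \<open>f\<close> gives the coordinates of a suitable vector, and
  \<open>separation\<close> makes it unique.\<close>

lemma tensor_lift_spec:
  assumes t: "t \<in> tensors A A"
    and f: "\<And>\<phi>. linear_form A \<phi> \<Longrightarrow> (\<lambda>a b. \<phi> (f a b)) \<in> bilinear_forms A A"
    and cl: "\<And>a b. a \<in> carrier A \<Longrightarrow> b \<in> carrier A \<Longrightarrow> f a b \<in> carrier A"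
  shows tensor_lift_closed: "tensor_lift A f t \<in> carrier A"
    and tensor_lift_apply: "linear_form A \<psi> \<Longrightarrow> \<psi> (tensor_lift A f t) = t (\<lambda>a b. \<psi> (f a b))"
proof -
  obtain B \<phi> where B: "finite B" "B \<subseteq> carrier A" "\<And>b. b \<in> B \<Longrightarrow> linear_form A (\<phi> b)"
    "\<And>x. x \<in> carrier A \<Longrightarrow> x = (\<Oplus>b\<in>B. \<phi> b x \<odot> b)" by (rule basis) blast
  define v where "v = (\<Oplus>b\<in>B. t (\<lambda>x y. \<phi> b (f x y)) \<odot> b)"
  have v: "v \<in> carrier A" unfolding v_def using B(2) by (intro M.finsum_closed) auto
  have *: "\<psi> v = t (\<lambda>a b. \<psi> (f a b))" if "linear_form A \<psi>" for \<psi>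
  proof -
    have "\<psi> v = (\<Sum>b\<in>B. \<psi> b * t (\<lambda>x y. \<phi> b (f x y)))"
      using linear_form_expand[OF B(1,2) v_def that] by (simp add: mult.commute)
    also have "\<dots> = t (\<lambda>x y. \<Sum>b\<in>B. \<psi> b * \<phi> b (f x y))"
      using f[OF B(3)] by (simp add: tensor_sum[OF t] tensor_scale[OF t])
    also have "\<dots> = t (\<lambda>a b. \<psi> (f a b))"
      using f[OF B(3)] f[OF that] linear_form_expand[OF B(1,2) B(4)[OF cl] that]
      by (intro tensor_cong[OF t]) (auto intro!: bilinear_form_sum simp: mult.commute)
    finally show ?thesis .
  qed
  have eq: "tensor_lift A f t = v" by (rule tensor_lift_eq) (use separation v * in auto)
  show "tensor_lift A f t \<in> carrier A" using eq v by simp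
  show "\<psi> (tensor_lift A f t) = t (\<lambda>a b. \<psi> (f a b))" if "linear_form A \<psi>"
    using eq *[OF that] by simp
qed

text \<open>A bilinear form is determined by its values on pairs of basis vectors. Expanding it in
  both arguments shows that \<open>t\<close> is a finite combination of elementary tensors, with
  coefficients the values of \<open>t\<close> on products of coordinate forms.\<close>

lemma tensor_expand:
  assumes t: "t \<in> tensors A A"
  obtains I :: "('a \<times> 'a) set" and k where "finite I" "I \<subseteq> carrier A \<times> carrier A"
    "\<And>B. B \<in> bilinear_forms A A \<Longrightarrow> t B = (\<Sum>(u, v)\<in>I. k (u, v) * B u v)"
proof -
  obtain B \<phi> where B: "finite B" "B \<subseteq> carrier A" "\<And>b. b \<in> B \<Longrightarrow> linear_form A (\<phi> b)"
    "\<And>x. x \<in> carrier A \<Longrightarrow> x = (\<Oplus>b\<in>B. \<phi> b x \<odot> b)" by (rule basis) blast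
  have exp: "f x = (\<Sum>b\<in>B. \<phi> b x * f b)" if "linear_form A f" "x \<in> carrier A" for f x
    using linear_form_expand[OF B(1,2) B(4)[OF that(2)] that(1)] .
  have *: "t F = (\<Sum>(u, v)\<in>B \<times> B. t (\<lambda>x y. \<phi> u x * \<phi> v y) * F u v)"
    if F: "F \<in> bilinear_forms A A" for F
  proof -
    have "F x y = (\<Sum>(u, v)\<in>B \<times> B. F u v * (\<phi> u x * \<phi> v y))"
      if "x \<in> carrier A" "y \<in> carrier A" for x y
    proof -
      have "F x y = (\<Sum>u\<in>B. \<phi> u x * F u y)"
        by (rule exp[OF bilinear_formsD1[OF F] that(1)]) (rule that(2))
      also have "\<dots> = (\<Sum>u\<in>B. \<phi> u x * (\<Sum>v\<in>B. \<phi> v y * F u v))"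
        using B(2) exp[OF bilinear_formsD2[OF F] that(2)] by (intro sum.cong) auto
      finally show ?thesis
        by (simp add: sum_distrib_left sum.cartesian_product mult_ac)
    qed
    then have "t F = t (\<lambda>x y. \<Sum>p\<in>B \<times> B. F (fst p) (snd p) * (\<phi> (fst p) x * \<phi> (snd p) y))"
      using B(3) F by (intro tensor_cong[OF t] bilinear_form_sum)
        (auto simp: case_prod_beta intro!: bilinear_form_scale bilinear_form_mult)
    also have "\<dots> = (\<Sum>p\<in>B \<times> B. F (fst p) (snd p) * t (\<lambda>x y. \<phi> (fst p) x * \<phi> (snd p) y))"
      using B(3) by (subst tensor_sum[OF t])
         (auto intro!: bilinear_form_scale sum.cong tensor_scale[OF t])
    finally show ?thesis by (simp add: case_prod_beta mult_ac)
  qed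
  show thesis
    by (rule that[of "B \<times> B" "\<lambda>(u, v). t (\<lambda>x y. \<phi> u x * \<phi> v y)"]) (use B(1,2) * in auto)
qed

text \<open>Fubini for Sweedler sums: \<open>t\<close> becomes a finite sum, which passes through
  the linear functional \<open>u\<close>. It is what allows a double sum over two coproducts to be
  read in either order.\<close>

lemma tensor_swap:
  assumes t: "t \<in> tensors A A" and u: "u \<in> tensors A A"
    and b1: "\<And>c d. c \<in> carrier A \<Longrightarrow> d \<in> carrier A \<Longrightarrow> (\<lambda>a b. F a b c d) \<in> bilinear_forms A A"
    and b2: "\<And>a b. a \<in> carrier A \<Longrightarrow> b \<in> carrier A \<Longrightarrow> (\<lambda>c d. F a b c d) \<in> bilinear_forms A A"
  shows "t (\<lambda>a b. u (\<lambda>c d. F a b c d)) = u (\<lambda>c d. t (\<lambda>a b. F a b c d))"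
proof -
  obtain I k where I: "finite I" "I \<subseteq> carrier A \<times> carrier A"
    "\<And>B. B \<in> bilinear_forms A A \<Longrightarrow> t B = (\<Sum>(u, v)\<in>I. k (u, v) * B u v)"
    by (rule tensor_expand[OF t]) blast
  have "(\<lambda>a b. u (\<lambda>c d. F a b c d)) \<in> bilinear_forms A A"
    by (intro bilinear_formsI linear_form_tensor[OF u] b2 bilinear_formsD2[OF b1]
      bilinear_formsD1[OF b1]) auto
  then have "t (\<lambda>a b. u (\<lambda>c d. F a b c d)) = (\<Sum>(a, b)\<in>I. k (a, b) * u (\<lambda>c d. F a b c d))"
    by (rule I(3))
  also have "\<dots> = (\<Sum>p\<in>I. u (\<lambda>c d. k p * F (fst p) (snd p) c d))"
    using I(2) by (auto intro!: sum.cong tensor_scale[OF u, symmetric] b2)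
  also have "\<dots> = u (\<lambda>c d. \<Sum>p\<in>I. k p * F (fst p) (snd p) c d)"
    using I(2) by (subst tensor_sum[OF u]) (auto intro!: bilinear_form_scale b2)
  also have "\<dots> = u (\<lambda>c d. t (\<lambda>a b. F a b c d))"
  proof (rule tensor_cong[OF u])
    show "(\<lambda>c d. \<Sum>p\<in>I. k p * F (fst p) (snd p) c d) \<in> bilinear_forms A A"
      using I(2) by (intro bilinear_form_sum bilinear_form_scale b2) auto
    show "(\<lambda>c d. t (\<lambda>a b. F a b c d)) \<in> bilinear_forms A A"
      by (intro bilinear_formsI linear_form_tensor[OF t] b1 bilinear_formsD2[OF b2]
        bilinear_formsD1[OF b2]) auto
  qed (auto simp: I(3)[OF b1] case_prod_beta)
  finally show ?thesis .
qed

lemma pure_tensor_form_bilinear: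
  assumes \<psi>: "linear_form (tensor_product A A) \<psi>"
  shows "(\<lambda>b c. \<psi> (pure_tensor A A b c)) \<in> bilinear_forms A A"
proof -
  have lin: "\<And>t u. t \<in> tensors A A \<Longrightarrow> u \<in> tensors A A \<Longrightarrow> \<psi> (\<lambda>B. t B + u B) = \<psi> t + \<psi> u"
    "\<And>t c. t \<in> tensors A A \<Longrightarrow> \<psi> (\<lambda>B. c * t B) = c * \<psi> t"
    using \<psi> by (auto simp: linear_form_def)
  have "pure_tensor A A (a \<oplus> a') b = (\<lambda>B. pure_tensor A A a b B + pure_tensor A A a' b B)"
    "pure_tensor A A b (a \<oplus> a') = (\<lambda>B. pure_tensor A A b a B + pure_tensor A A b a' B)"
    "pure_tensor A A (c \<odot> a) b = (\<lambda>B. c * pure_tensor A A a b B)"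
    "pure_tensor A A b (c \<odot> a) = (\<lambda>B. c * pure_tensor A A b a B)"
    if "a \<in> carrier A" "b \<in> carrier A" "a' \<in> carrier A" for a a' b c
    using that by (auto simp: pure_tensor_def on_forms_def fun_eq_iff
      linear_form_lin[OF bilinear_formsD1] linear_form_lin[OF bilinear_formsD2])
  then show ?thesis
    by (auto simp: bilinear_forms_def linear_form_def lin pure_tensor_closed)
qed

text \<open>Elementary tensors span, so they determine the form. It is needed where the argument of
  a form is itself a coproduct, in the coassociativity of a corner.\<close>

lemma tensor_form_pure:
  assumes t: "t \<in> tensors A A" and \<psi>: "linear_form (tensor_product A A) \<psi>"
  shows "\<psi> t = t (\<lambda>b c. \<psi> (pure_tensor A A b c))"
proof -
  let ?T = "tensor_product A A"
  obtain I k where I: "finite I" "I \<subseteq> carrier A \<times> carrier A"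
    "\<And>B. B \<in> bilinear_forms A A \<Longrightarrow> t B = (\<Sum>(u, v)\<in>I. k (u, v) * B u v)"
    by (rule tensor_expand[OF t]) blast
  define P where "P p = pure_tensor A A (fst p) (snd p)" for p
  have P: "P p \<in> tensors A A" if "p \<in> I" for p
    unfolding P_def using that I(2) by (intro pure_tensor_closed) auto
  have lin: "\<And>t u. t \<in> tensors A A \<Longrightarrow> u \<in> tensors A A \<Longrightarrow> \<psi> (\<lambda>B. t B + u B) = \<psi> t + \<psi> u"
    "\<And>t c. t \<in> tensors A A \<Longrightarrow> \<psi> (\<lambda>B. c * t B) = c * \<psi> t"
    using \<psi> by (auto simp: linear_form_def)
  have cl: "(\<lambda>B. \<Sum>p\<in>J. k p * P p B) \<in> tensors A A" if "J \<subseteq> I" for J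
    using that P by (intro tensors_sum_closed) auto
  have sum: "\<psi> (\<lambda>B. \<Sum>p\<in>J. k p * P p B) = (\<Sum>p\<in>J. k p * \<psi> (P p))" if "J \<subseteq> I" for J
    using finite_subset[OF that I(1)] that
  proof (induction J rule: finite_induct)
    case empty
    have "(\<lambda>B. 0) \<in> tensors A A" by (intro tensorsI) auto
    then show ?case using lin(2)[of "\<lambda>B. 0" 0] by simp
  next
    case (insert p J)
    have kP: "(\<lambda>B. k p * P p B) \<in> tensors A A"
      using cl[of "{p}"] insert by simp
    show ?case
      using insert lin(1)[OF kP cl[of J]] lin(2)[OF P, of p "k p"] by simp
  qed
  have "t = (\<lambda>B. \<Sum>p\<in>I. k p * P p B)"
    by (rule tensor_eqI[OF tensor_outside[OF t] tensor_outside[OF cl]]) (auto simp: I(3) P_def case_prod_beta)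
  then have "\<psi> t = (\<Sum>p\<in>I. k p * \<psi> (P p))" using sum[of I] by simp
  moreover note pure_tensor_form_bilinear[OF \<psi>]
  ultimately show ?thesis by (simp add: I(3) P_def case_prod_beta)
qed

end

context star_algebra
begin

text \<open>Declared as a simp rule for weak Kac algebras: it splits a bilinearity obligation into
  linearity in each variable. Proofs about an opaque form delete it again, to keep its bilinearity
  usable as one fact.\<close>

lemma bilinear_form_iff:
  "B \<in> bilinear_forms A A \<longleftrightarrow> (\<forall>a\<in>carrier A. linear_form A (\<lambda>b. B a b)) \<and>
    (\<forall>b\<in>carrier A. linear_form A (\<lambda>a. B a b))"
  by (auto simp: bilinear_forms_def)

lemma bilinear_form_cong:
  assumes "\<And>a b. a \<in> carrier A \<Longrightarrow> b \<in> carrier A \<Longrightarrow> F a b = G a b" "G \<in> bilinear_forms A A"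
  shows "F \<in> bilinear_forms A A"
  using assms(2) unfolding bilinear_form_iff
  by (auto intro!: linear_form_cong[of A "F _" "G _"] linear_form_cong[of A "\<lambda>a. F a _" "\<lambda>a. G a _"]
      simp: assms(1))

end

context fd_cstar_algebra
begin

text \<open>The extra map \<open>h\<close> lets one lemma cover the plain slices of the counit axiom
  and the slices in the definition of the Haar trace, where a leg carries a counital map.\<close>

lemma slice_left:
  assumes t: "t \<in> tensors A A" and g: "linear_form A g" and h: "linear_map A A h"
  shows slice_left_closed: "tensor_lift A (\<lambda>a b. g a \<odot> h b) t \<in> carrier A"
    and slice_left_apply: "linear_form A \<phi> \<Longrightarrow>
      \<phi> (tensor_lift A (\<lambda>a b. g a \<odot> h b) t) = t (\<lambda>a b. g a * \<phi> (h b))"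
proof -
  note hc = linear_map_closed[OF h]
  have eq: "\<phi> (g a \<odot> h b) = g a * \<phi> (h b)"
    if "linear_form A \<phi>" "a \<in> carrier A" "b \<in> carrier A" for \<phi> a b
    using that hc by (simp add: linear_form_lin)
  have b: "(\<lambda>a b. g a * \<phi> (h b)) \<in> bilinear_forms A A" if "linear_form A \<phi>" for \<phi>
    using g linear_form_comp[OF that h] by simp
  have b': "(\<lambda>a b. \<phi> (g a \<odot> h b)) \<in> bilinear_forms A A" if "linear_form A \<phi>" for \<phi>
    by (rule bilinear_form_cong[OF eq[OF that] b[OF that]]) (use that in auto)
  show "tensor_lift A (\<lambda>a b. g a \<odot> h b) t \<in> carrier A"
    by (rule tensor_lift_closed[OF t b']) (use hc in auto)
  show "\<phi> (tensor_lift A (\<lambda>a b. g a \<odot> h b) t) = t (\<lambda>a b. g a * \<phi> (h b))"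
    if \<phi>: "linear_form A \<phi>"
  proof -
    have "\<phi> (tensor_lift A (\<lambda>a b. g a \<odot> h b) t) = t (\<lambda>a b. \<phi> (g a \<odot> h b))"
      by (rule tensor_lift_apply[OF t b' _ \<phi>]) (use hc in auto)
    also have "\<dots> = t (\<lambda>a b. g a * \<phi> (h b))"
      by (rule tensor_cong[OF t b'[OF \<phi>] b[OF \<phi>] eq[OF \<phi>]])
    finally show ?thesis .
  qed
qed

lemma slice_right:
  assumes t: "t \<in> tensors A A" and g: "linear_form A g" and h: "linear_map A A h"
  shows slice_right_closed: "tensor_lift A (\<lambda>a b. g b \<odot> h a) t \<in> carrier A"
    and slice_right_apply: "linear_form A \<phi> \<Longrightarrow>
      \<phi> (tensor_lift A (\<lambda>a b. g b \<odot> h a) t) = t (\<lambda>a b. g b * \<phi> (h a))"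
proof -
  note hc = linear_map_closed[OF h]
  have eq: "\<phi> (g b \<odot> h a) = g b * \<phi> (h a)"
    if "linear_form A \<phi>" "a \<in> carrier A" "b \<in> carrier A" for \<phi> a b
    using that hc by (simp add: linear_form_lin)
  have b: "(\<lambda>a b. g b * \<phi> (h a)) \<in> bilinear_forms A A" if "linear_form A \<phi>" for \<phi>
    using g linear_form_comp[OF that h] by simp
  have b': "(\<lambda>a b. \<phi> (g b \<odot> h a)) \<in> bilinear_forms A A" if "linear_form A \<phi>" for \<phi>
    by (rule bilinear_form_cong[OF eq[OF that] b[OF that]]) (use that in auto)
  show "tensor_lift A (\<lambda>a b. g b \<odot> h a) t \<in> carrier A"
    by (rule tensor_lift_closed[OF t b']) (use hc in auto)
  show "\<phi> (tensor_lift A (\<lambda>a b. g b \<odot> h a) t) = t (\<lambda>a b. g b * \<phi> (h a))"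
    if \<phi>: "linear_form A \<phi>"
  proof -
    have "\<phi> (tensor_lift A (\<lambda>a b. g b \<odot> h a) t) = t (\<lambda>a b. \<phi> (g b \<odot> h a))"
      by (rule tensor_lift_apply[OF t b' _ \<phi>]) (use hc in auto)
    also have "\<dots> = t (\<lambda>a b. g b * \<phi> (h a))"
      by (rule tensor_cong[OF t b'[OF \<phi>] b[OF \<phi>] eq[OF \<phi>]])
    finally show ?thesis .
  qed
qed

lemma lift_mult_apply:
  assumes t: "t \<in> tensors A A" and \<phi>: "linear_form A \<phi>"
  shows "\<phi> (tensor_lift A (\<lambda>a b. a \<otimes> b) t) = t (\<lambda>a b. \<phi> (a \<otimes> b))"
proof (rule tensor_lift_apply[OF t _ _ \<phi>])
  show "(\<lambda>a b. \<phi> (a \<otimes> b)) \<in> bilinear_forms A A" if "linear_form A \<phi>" for \<phi>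
    by (intro bilinear_formsI linear_form_comp[OF that]) simp_all
qed simp

end

section \<open>Spectral projections\<close>

context star_algebra
begin

text \<open>Horner evaluation at \<open>w\<close>. With this recursion a set that contains zero and
  is closed under a single Horner step contains every polynomial in \<open>w\<close>, which is how
  hypercentrality is inherited later.\<close>

definition poly_calc :: "'a \<Rightarrow> complex poly \<Rightarrow> 'a" where
  "poly_calc w P = fold_coeffs (\<lambda>a y. a \<odot> \<one> \<oplus> w \<otimes> y) P \<zero>"

lemma poly_calc_0 [simp]: "poly_calc w 0 = \<zero>"
  by (simp add: poly_calc_def)

lemma poly_calc_pCons:
  assumes "w \<in> carrier A" shows "poly_calc w (pCons a P) = a \<odot> \<one> \<oplus> w \<otimes> poly_calc w P"
proof (cases "P = 0 \<and> a = 0")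
  case False
  then show ?thesis
    by (auto simp: poly_calc_def fold_coeffs_pCons_coeff_not_0_eq fold_coeffs_pCons_not_0_0_eq)
qed (use assms in auto)

lemma poly_calc_induct:
  assumes "w \<in> carrier A" "\<zero> \<in> H" "\<And>a y. y \<in> H \<Longrightarrow> a \<odot> \<one> \<oplus> w \<otimes> y \<in> H"
  shows "poly_calc w P \<in> H"
  by (induction P) (use assms in \<open>auto simp: poly_calc_pCons\<close>)

lemma poly_calc_closed [simp]: "w \<in> carrier A \<Longrightarrow> poly_calc w P \<in> carrier A"
  by (rule poly_calc_induct) auto

lemma poly_calc_add:
  assumes [simp]: "w \<in> carrier A"
  shows "poly_calc w (P + Q) = poly_calc w P \<oplus> poly_calc w Q"
  by (induction P Q rule: poly_induct2)
    (simp_all add: poly_calc_pCons smult_add_left r_distr M.a_ac)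

lemma poly_calc_smult:
  assumes [simp]: "w \<in> carrier A" shows "poly_calc w (smult c P) = c \<odot> poly_calc w P"
  by (induction P) (simp_all add: poly_calc_pCons smult_add_right smult_smult smult_mult_right)

lemma poly_calc_commute:
  assumes [simp]: "w \<in> carrier A" shows "w \<otimes> poly_calc w P = poly_calc w P \<otimes> w"
proof (induction P)
  case (pCons a P)
  then show ?case
    by (simp add: poly_calc_pCons l_distr r_distr smult_mult_left smult_mult_right m_assoc
      pCons.IH[symmetric])
qed simp

lemma poly_calc_eigen:
  assumes [simp]: "w \<in> carrier A" "v \<in> carrier A" and "w \<otimes> v = \<mu> \<odot> v"
  shows "poly_calc w P \<otimes> v = poly P \<mu> \<odot> v"
  by (induction P) (simp_all add: poly_calc_pCons l_distr smult_mult_left smult_mult_right m_assoc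
      assms(3) smult_smult smult_add_left mult.commute)

end

context fd_cstar_algebra
begin

text \<open>The \<open>C\<^sup>*\<close>-identity for the norm. In
  \<open>spectral_projection\<close> it keeps \<open>u \<otimes> star A u\<close> from
  vanishing.\<close>

lemma star_mult_eq_zero:
  assumes x: "x \<in> carrier A" and "star A x \<otimes> x = \<zero>" shows "x = \<zero>"
proof -
  obtain N where "cstar_norm A N" using ex_cstar_norm by blast
  then have "N (star A x \<otimes> x) = (N x)\<^sup>2" "N \<zero> = 0" "N x = 0 \<Longrightarrow> x = \<zero>"
    using x unfolding cstar_norm_def by auto
  with assms show ?thesis by simp
qed

text \<open>With n = \<open>card B\<close>, the powers of \<open>w\<close> with exponents 0 to n are
  n + 1 vectors having n coordinates each, so they are linearly dependent.\<close>

lemma annihilating_poly: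
  assumes w: "w \<in> carrier A" obtains P where "P \<noteq> 0" "poly_calc w P = \<zero>"
proof -
  obtain B \<phi> where B: "finite B" "B \<subseteq> carrier A" "\<And>b. b \<in> B \<Longrightarrow> linear_form A (\<phi> b)"
    "\<And>x. x \<in> carrier A \<Longrightarrow> x = (\<Oplus>b\<in>B. \<phi> b x \<odot> b)" by (rule basis) blast
  obtain a where a: "\<exists>i\<le>card B. a i \<noteq> 0"
    "\<And>b. b \<in> B \<Longrightarrow> (\<Sum>i\<le>card B. a i * \<phi> b (poly_calc w (monom 1 i))) = 0"
    using exists_linear_dependence[OF B(1), of "{..card B}" "\<lambda>i b. \<phi> b (poly_calc w (monom 1 i))"]
    by auto
  define P where "P = (\<Sum>i\<le>card B. smult (a i) (monom 1 i))"
  have \<phi>: "\<phi> b (poly_calc w P) = 0" if b: "b \<in> B" for b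
  proof -
    note lin = linear_form_lin[OF B(3)[OF b]]
    have "\<phi> b (poly_calc w (\<Sum>i\<in>I. smult (a i) (monom 1 i))) =
        (\<Sum>i\<in>I. a i * \<phi> b (poly_calc w (monom 1 i)))" if "finite I" for I
      using that by (induction I rule: finite_induct)
        (simp_all add: lin w poly_calc_add poly_calc_smult)
    then show ?thesis using a(2)[OF b] by (simp add: P_def)
  qed
  have "coeff P i = a i" if "i \<le> card B" for i
    using that by (simp add: P_def coeff_sum if_distrib cong: if_cong)
  then have "P \<noteq> 0" using a(1) by (metis coeff_0)
  moreover have "poly_calc w P = \<zero>"
  proof (rule separation)
    fix \<psi> assume \<psi>: "linear_form A \<psi>"
    have "\<psi> (poly_calc w P) = (\<Sum>b\<in>B. \<phi> b (poly_calc w P) * \<psi> b)"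
      by (rule linear_form_expand[OF B(1,2) B(4) \<psi>]) (use w in simp)
    then show "\<psi> (poly_calc w P) = \<psi> \<zero>" by (simp add: \<phi> linear_form_lin[OF \<psi>])
  qed (use w in auto)
  ultimately show thesis by (rule that)
qed

text \<open>If \<open>P = (X - \<mu>) Q\<close> is the minimal polynomial of \<open>w\<close>, then \<open>Q(w)\<close> spans the eigenspace of
  \<open>\<mu>\<close> in the algebra generated by \<open>w\<close>.\<close>

lemma spectral_projection:
  assumes w: "w \<in> carrier A" "star A w = w" and nonscalar: "\<And>c. w \<noteq> c \<odot> \<one>"
  obtains P where "projection A (poly_calc w P)" "poly_calc w P \<noteq> \<zero>" "poly_calc w P \<noteq> \<one>"
proof -
  note [simp] = w(1)
  define min where "min = arg_min degree (\<lambda>P. P \<noteq> 0 \<and> poly_calc w P = \<zero>)"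
  have min: "min \<noteq> 0" "poly_calc w min = \<zero>"
    and least: "\<And>Q. Q \<noteq> 0 \<Longrightarrow> poly_calc w Q = \<zero> \<Longrightarrow> degree min \<le> degree Q"
  proof -
    obtain P where P: "P \<noteq> 0 \<and> poly_calc w P = \<zero>" using annihilating_poly[OF w(1)] by blast
    show "min \<noteq> 0" "poly_calc w min = \<zero>" unfolding min_def
      using arg_min_natI[of "\<lambda>P. P \<noteq> 0 \<and> poly_calc w P = \<zero>", OF P, of degree] by auto
    show "degree min \<le> degree Q" if "Q \<noteq> 0" "poly_calc w Q = \<zero>" for Q unfolding min_def
      using arg_min_nat_le[of "\<lambda>P. P \<noteq> 0 \<and> poly_calc w P = \<zero>" Q degree] that by auto
  qed
  have one: "\<one> \<noteq> \<zero>"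
  proof
    assume "\<one> = \<zero>"
    then have "w = 0 \<odot> \<one>" using l_one[of w] by simp
    with nonscalar show False by blast
  qed
  \<comment> \<open>The shape that \<open>fundamental_theorem_of_algebra_alt\<close> asks for:
    \<open>min\<close> is not a nonzero constant, since such a constant would annihilate
    \<open>\<one>\<close>.\<close>
  have "\<not> (\<exists>a l. a \<noteq> 0 \<and> l = 0 \<and> min = pCons a l)"
  proof clarify
    fix a :: complex assume a: "a \<noteq> 0" "min = pCons a 0"
    with min(2) have "a \<odot> \<one> = \<zero>" by (simp add: poly_calc_pCons)
    with a one show False using smult_eq_zero[of \<one> a] by simp
  qed
  then obtain \<mu> where "poly min \<mu> = 0" using fundamental_theorem_of_algebra_alt by blast
  then obtain Q where Q: "min = [:-\<mu>, 1:] * Q" unfolding poly_eq_0_iff_dvd by (auto elim: dvdE)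
  define u where "u = poly_calc w Q"
  have u [simp]: "u \<in> carrier A" by (simp add: u_def)
  have "Q \<noteq> 0" using Q min(1) by auto
  \<comment> \<open>\<open>Q\<close> has one degree less than \<open>min\<close>, so by minimality
    it cannot annihilate \<open>w\<close>.\<close>
  have u0: "u \<noteq> \<zero>"
  proof
    assume "u = \<zero>"
    then have "degree min \<le> degree Q" using least[OF \<open>Q \<noteq> 0\<close>] by (simp add: u_def)
    moreover have "degree min = Suc (degree Q)"
      unfolding Q using \<open>Q \<noteq> 0\<close> by (subst degree_mult_eq) auto
    ultimately show False by simp
  qed
  have "min = smult (-\<mu>) Q + pCons 0 Q" by (simp add: Q)
  then have "poly_calc w min = (-\<mu>) \<odot> u \<oplus> (0 \<odot> \<one> \<oplus> w \<otimes> u)"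
    unfolding u_def by (simp only: poly_calc_add[OF w(1)] poly_calc_smult[OF w(1)]
      poly_calc_pCons[OF w(1)])
  then have "\<zero> = (-\<mu>) \<odot> u \<oplus> w \<otimes> u" using min(2) by simp
  then have "\<mu> \<odot> u = \<mu> \<odot> u \<oplus> ((-\<mu>) \<odot> u \<oplus> w \<otimes> u)" by (metis M.r_zero u smult_closed')
  also have "\<dots> = w \<otimes> u"
    using smult_add_left[of u \<mu> "-\<mu>"] by (simp add: M.a_assoc[symmetric])
  finally have wu: "w \<otimes> u = \<mu> \<odot> u" by simp
  have uw: "u \<otimes> w = w \<otimes> u" by (simp add: u_def poly_calc_commute)
  have wu': "w \<otimes> star A u = cnj \<mu> \<odot> star A u"
    using arg_cong[OF wu, of "star A"] arg_cong[OF uw, of "star A"]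
    by (simp add: star_mult star_smult w(2))
  have uu: "u \<otimes> star A u \<noteq> \<zero>"
    using star_mult_eq_zero[of "star A u"] u0 by (metis star_closed star_star u star_zero)
  \<comment> \<open>The usual argument that eigenvalues of a self-adjoint element are real:
    \<open>w\<close> acts on \<open>u \<otimes> star A u\<close> by \<open>\<mu>\<close> through
    \<open>u\<close> and, after commuting past \<open>u\<close>, by \<open>cnj \<mu>\<close> through
    \<open>star A u\<close>.\<close>
  have "\<mu> \<odot> (u \<otimes> star A u) = w \<otimes> u \<otimes> star A u" by (simp add: wu smult_mult_left)
  also have "\<dots> = cnj \<mu> \<odot> (u \<otimes> star A u)"
    by (simp add: uw[symmetric] m_assoc wu' smult_mult_right)
  finally have "(\<mu> - cnj \<mu>) \<odot> (u \<otimes> star A u) = \<zero>"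
    using smult_add_left[of "u \<otimes> star A u" \<mu> "- cnj \<mu>"]
      smult_add_left[of "u \<otimes> star A u" "cnj \<mu>" "- cnj \<mu>"] by simp
  then have real: "cnj \<mu> = \<mu>" using smult_eq_zero[of "u \<otimes> star A u"] uu by fastforce
  \<comment> \<open>Left multiplication by \<open>u\<close>, which is \<open>Q\<close> evaluated at
    \<open>w\<close>, acts as the scalar \<open>poly Q \<mu>\<close> on every eigenvector for
    \<open>\<mu>\<close>, among them \<open>u\<close> and \<open>star A u\<close>. Hence
    \<open>u\<close> divided by \<open>k\<close> is idempotent.\<close>
  define k where "k = poly Q \<mu>"
  have uu': "u \<otimes> star A u = k \<odot> star A u"
    unfolding u_def[symmetric] k_def using poly_calc_eigen[of w "star A u" \<mu> Q] wu' real
    by (simp add: u_def)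
  have k: "k \<noteq> 0" using uu uu' by auto
  have uu'': "u \<otimes> u = k \<odot> u" using poly_calc_eigen[OF _ u wu, of Q] by (simp add: u_def k_def)
  \<comment> \<open>Compares \<open>u \<otimes> star A u\<close>, which is self-adjoint, with its
    own adjoint; this makes \<open>e\<close> self-adjoint.\<close>
  have star: "k \<odot> star A u = cnj k \<odot> u"
  proof -
    have "k \<odot> star A u = u \<otimes> star A u" by (rule uu'[symmetric])
    also have "\<dots> = star A (u \<otimes> star A u)" by (simp add: star_mult)
    also have "\<dots> = cnj k \<odot> u" unfolding uu' by (simp add: star_smult)
    finally show ?thesis .
  qed
  define e where "e = poly_calc w (smult (inverse k) Q)"
  have e: "e = inverse k \<odot> u" by (simp add: e_def u_def poly_calc_smult)
  have "star A u = inverse k \<odot> (k \<odot> star A u)" using k by (simp add: smult_smult)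
  also have "\<dots> = (inverse k * cnj k) \<odot> u" by (simp add: star smult_smult)
  finally have "star A e = (inverse (cnj k) * (inverse k * cnj k)) \<odot> u"
    by (simp add: e star_smult smult_smult)
  also have "inverse (cnj k) * (inverse k * cnj k) = inverse k" using k by simp
  finally have "star A e = e" by (simp add: e)
  moreover have "e \<otimes> e = e"
    using k by (simp add: e smult_mult_left smult_mult_right uu'' smult_smult)
  moreover have "e \<noteq> \<zero>" using smult_eq_zero[of u "inverse k"] u0 k by (auto simp: e)
  \<comment> \<open>\<open>w\<close> acts on \<open>e\<close> as \<open>\<mu>\<close>, so
    \<open>e = \<one>\<close> would make \<open>w\<close> a scalar.\<close>
  moreover have "e \<noteq> \<one>"
  proof
    assume "e = \<one>"
    then have "w = w \<otimes> e" by simp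
    also have "\<dots> = \<mu> \<odot> e" by (simp add: e smult_mult_right wu smult_smult mult.commute)
    finally show False using nonscalar \<open>e = \<one>\<close> by simp
  qed
  ultimately show thesis
    using that[of "smult (inverse k) Q"] by (simp add: projection_def e_def)
qed

end

section \<open>Weak Kac algebras in Sweedler notation\<close>

context weak_kac_algebra
begin

abbreviation comultiplication ("\<Delta>") where "\<Delta> \<equiv> comult K"
abbreviation counit_form ("\<epsilon>") where "\<epsilon> \<equiv> counit K"
abbreviation antipode_map ("S") where "S \<equiv> antipode K"
abbreviation source_counit ("\<epsilon>\<^sub>s") where "\<epsilon>\<^sub>s \<equiv> eps_s K"
abbreviation target_counit ("\<epsilon>\<^sub>t") where "\<epsilon>\<^sub>t \<equiv> eps_t K"

declare bilinear_form_iff [simp]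

lemma comult_closed [simp]: "x \<in> carrier K \<Longrightarrow> \<Delta> x \<in> tensors K K"
  using comult_linear by (auto simp: linear_map_def)

lemma comult_cong:
  assumes "\<And>a b. a \<in> carrier K \<Longrightarrow> b \<in> carrier K \<Longrightarrow> F a b = G a b" "x \<in> carrier K"
    "F \<in> bilinear_forms K K" "G \<in> bilinear_forms K K"
  shows "\<Delta> x F = \<Delta> x G"
  using assms by (intro tensor_cong[of "\<Delta> x" K K]) auto

lemmas comult_scale = tensor_scale[OF comult_closed]
lemmas comult_swap = tensor_swap[OF comult_closed comult_closed]

lemma linear_form_comult [simp]:
  assumes "B \<in> bilinear_forms K K" "linear_map K K f"
  shows "linear_form K (\<lambda>x. \<Delta> (f x) B)"
proof -
  have "linear_form K (\<lambda>x. \<Delta> x B)"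
    using comult_linear by (auto simp: linear_map_def linear_form_def)
  then show ?thesis by (rule linear_form_comp) (rule assms)
qed

lemma linear_form_comult_param [simp]:
  assumes "y \<in> carrier K" "\<And>x. x \<in> carrier K \<Longrightarrow> B x \<in> bilinear_forms K K"
    "\<And>a b. a \<in> carrier K \<Longrightarrow> b \<in> carrier K \<Longrightarrow> linear_form K (\<lambda>x. B x a b)"
  shows "linear_form K (\<lambda>x. \<Delta> y (\<lambda>a b. B x a b))"
  by (rule linear_form_tensor) (use assms in auto)

lemma linear_form_counit [simp]: "linear_form K \<epsilon>" "linear_map K K f \<Longrightarrow> linear_form K (\<lambda>x. \<epsilon> (f x))"
  using counit_positive linear_form_comp[of K \<epsilon> K f] by (auto simp: positive_form_def)

lemma linear_map_antipode [simp]: "linear_map K K S"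
  "linear_map K K f \<Longrightarrow> linear_map K K (\<lambda>x. S (f x))"
  using antipode_linear linear_map_comp[OF antipode_linear] by auto

lemma antipode_closed [simp]: "x \<in> carrier K \<Longrightarrow> S x \<in> carrier K"
  by (rule linear_map_closed[OF antipode_linear])

lemma antipode_antipode' [simp]: "x \<in> carrier K \<Longrightarrow> S (S x) = x"
  by (rule antipode_antipode)

text \<open>\<open>S \<one>\<close> is a unit for the image of \<open>S\<close>, and the image is
  everything because \<open>S\<close> is an involution.\<close>

lemma antipode_one [simp]: "S \<one> = \<one>"
  by (metis antipode_antipode antipode_closed antipode_mult l_one one_closed r_one)

text \<open>Side conditions of (multi)linearity are discharged by \<open>simp\<close> once the following rules
  are instantiated with the forms at hand.\<close>

lemma form_simps:
  assumes "linear_form K \<phi>"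
  shows "linear_form K \<phi>" "linear_map K K f \<Longrightarrow> linear_form K (\<lambda>x. \<phi> (f x))"
  using assms linear_form_comp by auto

lemma bilinear_simps:
  assumes "B \<in> bilinear_forms K K"
  shows "b \<in> carrier K \<Longrightarrow> linear_form K (B b)"
    and "b \<in> carrier K \<Longrightarrow> linear_map K K f \<Longrightarrow> linear_form K (\<lambda>x. B (f x) b)"
    and "b \<in> carrier K \<Longrightarrow> linear_map K K f \<Longrightarrow> linear_form K (\<lambda>x. B b (f x))"
  using linear_form_comp[OF bilinear_formsD1[OF assms]] linear_form_comp[OF bilinear_formsD2[OF assms]]
     bilinear_formsD3[OF assms] by auto

lemma comult_mult_apply:
  assumes "x \<in> carrier K" "y \<in> carrier K" "B \<in> bilinear_forms K K"
  shows "\<Delta> (x \<otimes> y) B = \<Delta> x (\<lambda>a b. \<Delta> y (\<lambda>c d. B (a \<otimes> c) (b \<otimes> d)))"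
  using assms(3) by (simp add: comult_mult assms(1,2) tensor_mult_apply del: bilinear_form_iff)

lemma comult_star_apply:
  assumes "x \<in> carrier K" "B \<in> bilinear_forms K K"
  shows "\<Delta> (star K x) B = cnj (\<Delta> x (\<lambda>a b. cnj (B (star K a) (star K b))))"
  using assms(2) by (simp add: comult_star assms(1) tensor_star_apply del: bilinear_form_iff)

lemma comult_antipode_apply:
  assumes "x \<in> carrier K" "B \<in> bilinear_forms K K"
  shows "\<Delta> (S x) B = \<Delta> x (\<lambda>a b. B (S b) (S a))"
proof -
  note [simp] = bilinear_simps[OF assms(2)]
  have "(\<lambda>b a. B a b) \<in> bilinear_forms K K" by simp
  with assms(2) show ?thesis by (simp add: antipode_comult assms(1) del: bilinear_form_iff)
qed

text \<open>The form in which coassociativity is usable: an arbitrary trilinear integrand may be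
  read with either bracketing of the threefold coproduct.\<close>

lemma coassoc_apply:
  assumes x: "x \<in> carrier K"
    and T: "\<And>b c. b \<in> carrier K \<Longrightarrow> c \<in> carrier K \<Longrightarrow> linear_form K (\<lambda>a. T a b c)"
      "\<And>a c. a \<in> carrier K \<Longrightarrow> c \<in> carrier K \<Longrightarrow> linear_form K (\<lambda>b. T a b c)"
      "\<And>a b. a \<in> carrier K \<Longrightarrow> b \<in> carrier K \<Longrightarrow> linear_form K (\<lambda>c. T a b c)"
  shows "\<Delta> x (\<lambda>s c. \<Delta> s (\<lambda>a b. T a b c)) = \<Delta> x (\<lambda>a s. \<Delta> s (\<lambda>b c. T a b c))"
proof -
  note [simp] = T
  let ?KK = "tensor_product K K"
  have Ta: "(\<lambda>b c. T a b c) \<in> bilinear_forms K K" if "a \<in> carrier K" for a using that by simp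
  have Tc: "(\<lambda>a b. T a b c) \<in> bilinear_forms K K" if "c \<in> carrier K" for c using that by simp
  \<comment> \<open>The axiom is an equation of functionals on forms over \<open>K\<close> and its
    tensor square. This \<open>B\<close> is the form there that returns \<open>T\<close> on
    elementary tensors.\<close>
  define B where "B a s = s (\<lambda>b c. T a b c)" for a and s :: "('a, 'a) tensor"
  have B: "B \<in> bilinear_forms K ?KK"
  proof (rule bilinear_formsI)
    show "linear_form K (\<lambda>a. B a s)" if "s \<in> carrier ?KK" for s
      unfolding B_def by (rule linear_form_tensor[where B = T]) (use that Ta in auto)
  qed (simp add: B_def linear_form_def[of ?KK])
  have pure: "B a (pure_tensor K K b c) = T a b c"
    if "a \<in> carrier K" "b \<in> carrier K" "c \<in> carrier K" for a b c
    using Ta[OF that(1)] by (simp add: B_def del: bilinear_form_iff)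
  have Bc: "(\<lambda>a b. B a (pure_tensor K K b c)) \<in> bilinear_forms K K" if "c \<in> carrier K" for c
    by (rule bilinear_form_cong[OF pure Tc]) (use that in auto)
  have lin: "linear_form K (\<lambda>c. B a (pure_tensor K K b c))"
    if "a \<in> carrier K" "b \<in> carrier K" for a b
    by (rule linear_form_cong[of K _ "\<lambda>c. T a b c"]) (use that pure in auto)
  have Bs: "(\<lambda>s c. s (\<lambda>a b. B a (pure_tensor K K b c))) \<in> bilinear_forms ?KK K"
  proof (rule bilinear_formsI)
    show "linear_form K (\<lambda>c. s (\<lambda>a b. B a (pure_tensor K K b c)))" if "s \<in> carrier ?KK" for s
      by (rule linear_form_tensor[where B = "\<lambda>c a b. B a (pure_tensor K K b c)", OF _ Bc lin])
        (use that in \<open>simp_all del: bilinear_form_iff\<close>)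
  qed (simp add: linear_form_def)
  have "\<Delta> x (\<lambda>s c. \<Delta> s (\<lambda>a b. B a (pure_tensor K K b c))) = \<Delta> x (\<lambda>a s. B a (\<Delta> s))"
    using fun_cong[OF coassoc[OF x], of B] B Bs
    by (simp add: tensor_assoc_def del: bilinear_form_iff)
  moreover have "\<Delta> x (\<lambda>s c. \<Delta> s (\<lambda>a b. B a (pure_tensor K K b c))) =
      \<Delta> x (\<lambda>s c. \<Delta> s (\<lambda>a b. T a b c))"
  proof (rule comult_cong[OF _ x])
    show eq: "\<Delta> s (\<lambda>a b. B a (pure_tensor K K b c)) = \<Delta> s (\<lambda>a b. T a b c)"
      if "s \<in> carrier K" "c \<in> carrier K" for s c
      by (rule comult_cong[OF pure that(1) Bc Tc]) (use that in auto)
    show b: "(\<lambda>s c. \<Delta> s (\<lambda>a b. T a b c)) \<in> bilinear_forms K K" by simp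
    show "(\<lambda>s c. \<Delta> s (\<lambda>a b. B a (pure_tensor K K b c))) \<in> bilinear_forms K K"
      by (rule bilinear_form_cong[OF eq b])
  qed
  ultimately show ?thesis by (simp add: B_def)
qed

lemma counit_left_apply:
  assumes "x \<in> carrier K" "linear_form K \<phi>"
  shows "\<Delta> x (\<lambda>a b. \<epsilon> a * \<phi> b) = \<phi> x"
  using slice_left_apply[of "\<Delta> x" \<epsilon> "\<lambda>b. b" \<phi>] assms by (simp add: counit_left)

lemma counit_right_apply:
  assumes "x \<in> carrier K" "linear_form K \<phi>"
  shows "\<Delta> x (\<lambda>a b. \<epsilon> b * \<phi> a) = \<phi> x"
  using slice_right_apply[of "\<Delta> x" \<epsilon> "\<lambda>b. b" \<phi>] assms by (simp add: counit_right)

text \<open>The left counit property evaluates the sum of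
  \<open>\<epsilon> a * \<epsilon> (S b)\<close> over the coproduct of any element y as
  \<open>\<epsilon> (S y)\<close>. By anti-comultiplicativity the sums for y = x and y =
  \<open>S x\<close> agree, which gives the two sides.\<close>

lemma counit_antipode [simp]:
  assumes "x \<in> carrier K" shows "\<epsilon> (S x) = \<epsilon> x"
proof -
  have "\<epsilon> x = \<Delta> (S x) (\<lambda>a b. \<epsilon> a * \<epsilon> (S b))"
    using assms by (subst counit_left_apply) auto
  also have "\<dots> = \<Delta> x (\<lambda>a b. \<epsilon> (S b) * \<epsilon> (S (S a)))"
    using assms by (subst comult_antipode_apply) auto
  also have "\<dots> = \<Delta> x (\<lambda>a b. \<epsilon> a * \<epsilon> (S b))"
    using assms by (intro comult_cong) auto
  also have "\<dots> = \<epsilon> (S x)"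
    using assms by (subst counit_left_apply) auto
  finally show ?thesis ..
qed

lemma eps_s_spec:
  assumes x: "x \<in> carrier K"
  shows eps_s_closed [simp]: "\<epsilon>\<^sub>s x \<in> carrier K"
    and eps_s_apply: "linear_form K \<phi> \<Longrightarrow> \<phi> (\<epsilon>\<^sub>s x) = \<Delta> \<one> (\<lambda>a b. \<epsilon> (x \<otimes> b) * \<phi> a)"
proof -
  have t: "pure_tensor K K \<one> x \<otimes>\<^bsub>tensor_product K K\<^esub> \<Delta> \<one> \<in> tensors K K"
    by (intro tensor_mult_closed pure_tensor_closed) (use x in auto)
  show "\<epsilon>\<^sub>s x \<in> carrier K"
    unfolding eps_s_def using slice_right_closed[OF t, of \<epsilon> "\<lambda>b. b"] by simp
  assume \<phi>: "linear_form K \<phi>"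
  note [simp] = form_simps[OF \<phi>]
  have "\<phi> (\<epsilon>\<^sub>s x) = \<Delta> \<one> (\<lambda>a b. \<epsilon> (x \<otimes> b) * \<phi> (\<one> \<otimes> a))"
    unfolding eps_s_def slice_right_apply[OF t linear_form_counit(1) linear_map_id \<phi>]
    by (rule pure_tensor_mult_apply) auto
  also have "\<dots> = \<Delta> \<one> (\<lambda>a b. \<epsilon> (x \<otimes> b) * \<phi> a)"
    using x by (intro comult_cong) auto
  finally show "\<phi> (\<epsilon>\<^sub>s x) = \<Delta> \<one> (\<lambda>a b. \<epsilon> (x \<otimes> b) * \<phi> a)" .
qed

lemma eps_t_spec:
  assumes x: "x \<in> carrier K"
  shows eps_t_closed [simp]: "\<epsilon>\<^sub>t x \<in> carrier K"
    and eps_t_apply: "linear_form K \<phi> \<Longrightarrow> \<phi> (\<epsilon>\<^sub>t x) = \<Delta> \<one> (\<lambda>a b. \<epsilon> (a \<otimes> x) * \<phi> b)"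
proof -
  have t: "\<Delta> \<one> \<otimes>\<^bsub>tensor_product K K\<^esub> pure_tensor K K x \<one> \<in> tensors K K"
    by (intro tensor_mult_closed pure_tensor_closed) (use x in auto)
  show "\<epsilon>\<^sub>t x \<in> carrier K"
    unfolding eps_t_def using slice_left_closed[OF t, of \<epsilon> "\<lambda>b. b"] by simp
  assume \<phi>: "linear_form K \<phi>"
  note [simp] = form_simps[OF \<phi>]
  have "\<phi> (\<epsilon>\<^sub>t x) = \<Delta> \<one> (\<lambda>a b. \<epsilon> (a \<otimes> x) * \<phi> (b \<otimes> \<one>))"
    unfolding eps_t_def slice_left_apply[OF t linear_form_counit(1) linear_map_id \<phi>]
    by (rule mult_pure_tensor_apply) (use x in auto)
  also have "\<dots> = \<Delta> \<one> (\<lambda>a b. \<epsilon> (a \<otimes> x) * \<phi> b)"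
    using x by (intro comult_cong) auto
  finally show "\<phi> (\<epsilon>\<^sub>t x) = \<Delta> \<one> (\<lambda>a b. \<epsilon> (a \<otimes> x) * \<phi> b)" .
qed

text \<open>Forms separate points, so linearity may be tested after each form. This suits
  \<open>\<epsilon>\<^sub>s\<close> and \<open>\<epsilon>\<^sub>t\<close>, which are known through
  their values under forms.\<close>

lemma linear_mapI:
  assumes "\<And>x. x \<in> carrier K \<Longrightarrow> f x \<in> carrier K"
    "\<And>\<phi>. linear_form K \<phi> \<Longrightarrow> linear_form K (\<lambda>x. \<phi> (f x))"
  shows "linear_map K K f"
  unfolding linear_map_def
proof (intro conjI ballI allI)
  fix x y c assume "x \<in> carrier K" "y \<in> carrier K"
  then show "f (x \<oplus> y) = f x \<oplus> f y"
    by (intro separation) (simp_all add: assms(1) linear_form_lin linear_form_lin[OF assms(2)])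
next
  fix x c assume "x \<in> carrier K"
  then show "f (c \<odot> x) = c \<odot> f x"
    by (intro separation) (simp_all add: assms(1) linear_form_lin linear_form_lin[OF assms(2)])
qed (use assms in auto)

lemma linear_map_eps_s: "linear_map K K \<epsilon>\<^sub>s"
proof (rule linear_mapI)
  fix \<phi> assume \<phi>: "linear_form K \<phi>"
  note [simp] = form_simps[OF \<phi>]
  show "linear_form K (\<lambda>x. \<phi> (\<epsilon>\<^sub>s x))"
    by (rule linear_form_cong[of K _ "\<lambda>x. \<Delta> \<one> (\<lambda>a b. \<epsilon> (x \<otimes> b) * \<phi> a)"])
      (simp_all add: eps_s_apply[OF _ \<phi>])
qed simp

lemma linear_map_eps_t: "linear_map K K \<epsilon>\<^sub>t"
proof (rule linear_mapI)
  fix \<phi> assume \<phi>: "linear_form K \<phi>"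
  note [simp] = form_simps[OF \<phi>]
  show "linear_form K (\<lambda>x. \<phi> (\<epsilon>\<^sub>t x))"
    by (rule linear_form_cong[of K _ "\<lambda>x. \<Delta> \<one> (\<lambda>a b. \<epsilon> (a \<otimes> x) * \<phi> b)"])
      (simp_all add: eps_t_apply[OF _ \<phi>])
qed simp

lemma linear_map_eps [simp]:
  "linear_map K K f \<Longrightarrow> linear_map K K (\<lambda>x. \<epsilon>\<^sub>s (f x))"
  "linear_map K K f \<Longrightarrow> linear_map K K (\<lambda>x. \<epsilon>\<^sub>t (f x))"
  "linear_map K K \<epsilon>\<^sub>s" "linear_map K K \<epsilon>\<^sub>t"
  using linear_map_comp linear_map_eps_s linear_map_eps_t by blast+

lemma eps_s_mult_apply:
  assumes x: "x \<in> carrier K" and y: "y \<in> carrier K" and \<phi>: "linear_form K \<phi>"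
  shows "\<phi> (\<epsilon>\<^sub>s x \<otimes> y) = \<Delta> y (\<lambda>a b. \<epsilon> (x \<otimes> b) * \<phi> a)"
proof -
  note [simp] = form_simps[OF \<phi>]
  have t: "pure_tensor K K \<one> x \<otimes>\<^bsub>tensor_product K K\<^esub> \<Delta> y \<in> tensors K K"
    by (intro tensor_mult_closed pure_tensor_closed) (use x y in auto)
  have "\<phi> (\<epsilon>\<^sub>s x \<otimes> y) = \<Delta> y (\<lambda>a b. \<epsilon> (x \<otimes> b) * \<phi> (\<one> \<otimes> a))"
    unfolding eps_s_mult[OF x y] slice_right_apply[OF t linear_form_counit(1) linear_map_id \<phi>]
    by (rule pure_tensor_mult_apply) (use y in auto)
  also have "\<dots> = \<Delta> y (\<lambda>a b. \<epsilon> (x \<otimes> b) * \<phi> a)"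
    using x y by (intro comult_cong) auto
  finally show ?thesis .
qed

lemma comult_eps_s_apply:
  assumes x: "x \<in> carrier K" and B: "B \<in> bilinear_forms K K"
  shows "\<Delta> x (\<lambda>a b. B (\<epsilon>\<^sub>s a) b) = \<Delta> \<one> (\<lambda>a b. B a (x \<otimes> b))"
proof -
  note [simp] = bilinear_simps[OF B]
  have "\<Delta> x (\<lambda>a b. B (\<epsilon>\<^sub>s a) b) = \<Delta> \<one> (\<lambda>a b. B (\<one> \<otimes> a) (x \<otimes> b))"
    using fun_cong[OF eps_s_comult[OF x], of B] B
    by (simp add: pure_tensor_mult_apply del: bilinear_form_iff)
  also have "\<dots> = \<Delta> \<one> (\<lambda>a b. B a (x \<otimes> b))"
    using x by (intro comult_cong) auto
  finally show ?thesis .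
qed

lemma antipode_eps_s_apply:
  assumes x: "x \<in> carrier K" and \<phi>: "linear_form K \<phi>"
  shows "\<Delta> x (\<lambda>a b. \<phi> (S a \<otimes> b)) = \<phi> (\<epsilon>\<^sub>s x)"
proof -
  note [simp] = form_simps[OF \<phi>]
  have t: "tensor_map K K S (\<lambda>b. b) (\<Delta> x) \<in> tensors K K"
    by (rule tensor_map_closed[OF comult_closed[OF x] linear_map_antipode(1) linear_map_id])
  show ?thesis
    using lift_mult_apply[OF t \<phi>] by (simp add: antipode_eps_s[OF x])
qed

end

section \<open>The Cartan subalgebras\<close>

context weak_kac_algebra
begin

text \<open>\<open>S\<close> fixes \<open>\<one>\<close>, flips its coproduct and preserves the
  counit, and so exchanges the two slices of the coproduct of \<open>\<one>\<close>.\<close>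

lemma antipode_eps_s_eq:
  assumes x: "x \<in> carrier K" shows "S (\<epsilon>\<^sub>s x) = \<epsilon>\<^sub>t (S x)"
proof (rule separation)
  fix \<phi> assume \<phi>: "linear_form K \<phi>"
  note [simp] = form_simps[OF \<phi>]
  have "\<phi> (\<epsilon>\<^sub>t (S x)) = \<Delta> (S \<one>) (\<lambda>a b. \<epsilon> (a \<otimes> S x) * \<phi> b)"
    using x by (simp add: eps_t_apply)
  also have "\<dots> = \<Delta> \<one> (\<lambda>a b. \<epsilon> (S b \<otimes> S x) * \<phi> (S a))"
    using x by (subst comult_antipode_apply) auto
  also have "\<dots> = \<Delta> \<one> (\<lambda>a b. \<epsilon> (x \<otimes> b) * \<phi> (S a))"
    using x by (intro comult_cong) (auto simp: antipode_mult[symmetric])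
  also have "\<dots> = \<phi> (S (\<epsilon>\<^sub>s x))"
    using x by (subst eps_s_apply[of x "\<lambda>y. \<phi> (S y)"]) auto
  finally show "\<phi> (S (\<epsilon>\<^sub>s x)) = \<phi> (\<epsilon>\<^sub>t (S x))" ..
qed (use x in auto)

lemma antipode_eps_t_eq:
  assumes x: "x \<in> carrier K" shows "S (\<epsilon>\<^sub>t x) = \<epsilon>\<^sub>s (S x)"
  using antipode_eps_s_eq[of "S x"] x by (metis antipode_antipode antipode_closed eps_s_closed)

text \<open>The antipode turns each identity for \<open>\<epsilon>\<^sub>s\<close> into one for \<open>\<epsilon>\<^sub>t\<close>.\<close>

lemma comult_eps_t_apply:
  assumes x: "x \<in> carrier K" and B: "B \<in> bilinear_forms K K"
  shows "\<Delta> x (\<lambda>a b. B a (\<epsilon>\<^sub>t b)) = \<Delta> \<one> (\<lambda>a b. B (a \<otimes> x) b)"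
proof -
  note [simp] = bilinear_simps[OF B]
  define y where "y = S x"
  have y: "y \<in> carrier K" "x = S y" using x by (auto simp: y_def)
  have "\<Delta> x (\<lambda>a b. B a (\<epsilon>\<^sub>t b)) = \<Delta> y (\<lambda>a b. B (S b) (\<epsilon>\<^sub>t (S a)))"
    using y by (simp add: comult_antipode_apply)
  also have "\<dots> = \<Delta> y (\<lambda>a b. B (S b) (S (\<epsilon>\<^sub>s a)))"
    using y by (intro comult_cong) (auto simp: antipode_eps_s_eq)
  also have "\<dots> = \<Delta> \<one> (\<lambda>a b. B (S (y \<otimes> b)) (S a))"
    using y by (intro comult_eps_s_apply[of y "\<lambda>a b. B (S b) (S a)"]) auto
  also have "\<dots> = \<Delta> \<one> (\<lambda>a b. B (S b \<otimes> x) (S a))"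
    using y by (intro comult_cong) (auto simp: antipode_mult)
  also have "\<dots> = \<Delta> (S \<one>) (\<lambda>a b. B (a \<otimes> x) b)"
    using x by (subst comult_antipode_apply) auto
  finally show ?thesis by simp
qed

lemma antipode_eps_t_apply:
  assumes x: "x \<in> carrier K" and \<phi>: "linear_form K \<phi>"
  shows "\<Delta> x (\<lambda>a b. \<phi> (a \<otimes> S b)) = \<phi> (\<epsilon>\<^sub>t x)"
proof -
  note [simp] = form_simps[OF \<phi>]
  define y where "y = S x"
  have y: "y \<in> carrier K" "x = S y" using x by (auto simp: y_def)
  have "\<Delta> x (\<lambda>a b. \<phi> (a \<otimes> S b)) = \<Delta> y (\<lambda>a b. \<phi> (S b \<otimes> S (S a)))"
    unfolding y(2) using y(1) by (subst comult_antipode_apply) auto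
  also have "\<dots> = \<Delta> y (\<lambda>a b. \<phi> (S (S a \<otimes> b)))"
    using y by (intro comult_cong) (auto simp: antipode_mult)
  also have "\<dots> = \<phi> (S (\<epsilon>\<^sub>s y))"
    using y by (intro antipode_eps_s_apply) auto
  finally show ?thesis using y by (simp add: antipode_eps_s_eq)
qed

lemma eps_s_one [simp]: "\<epsilon>\<^sub>s \<one> = \<one>"
proof (rule separation)
  fix \<phi> assume \<phi>: "linear_form K \<phi>"
  note [simp] = form_simps[OF \<phi>]
  have "\<phi> (\<epsilon>\<^sub>s \<one>) = \<Delta> \<one> (\<lambda>a b. \<epsilon> b * \<phi> a)"
    by (subst eps_s_apply) (auto intro!: comult_cong)
  then show "\<phi> (\<epsilon>\<^sub>s \<one>) = \<phi> \<one>" using counit_right_apply[OF _ \<phi>] by simp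
qed auto

lemma eps_t_one [simp]: "\<epsilon>\<^sub>t \<one> = \<one>"
  using antipode_eps_s_eq[of \<one>] by simp

text \<open>The case \<open>x = \<one>\<close> of \<open>comult_eps_t_apply\<close>: the second leg
  of the coproduct of \<open>\<one>\<close> lies in the target Cartan subalgebra.\<close>

lemma comult_one_eps_t:
  assumes "B \<in> bilinear_forms K K"
  shows "\<Delta> \<one> (\<lambda>a b. B a (\<epsilon>\<^sub>t b)) = \<Delta> \<one> B"
proof -
  note [simp] = bilinear_simps[OF assms]
  show ?thesis by (subst comult_eps_t_apply) (auto intro!: comult_cong)
qed

text \<open>\<open>\<epsilon>\<^sub>t x\<close> is a slice leaving the second leg of
  \<open>\<Delta> \<one>\<close>, which \<open>\<epsilon>\<^sub>t\<close> fixes.\<close>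

lemma eps_t_eps_t:
  assumes x: "x \<in> carrier K" shows "\<epsilon>\<^sub>t (\<epsilon>\<^sub>t x) = \<epsilon>\<^sub>t x"
proof (rule separation)
  fix \<phi> assume \<phi>: "linear_form K \<phi>"
  note [simp] = form_simps[OF \<phi>]
  have "\<phi> (\<epsilon>\<^sub>t (\<epsilon>\<^sub>t x)) = \<Delta> \<one> (\<lambda>a b. \<epsilon> (a \<otimes> x) * \<phi> (\<epsilon>\<^sub>t b))"
    using x by (subst eps_t_apply[of x "\<lambda>y. \<phi> (\<epsilon>\<^sub>t y)"]) auto
  also have "\<dots> = \<phi> (\<epsilon>\<^sub>t x)"
    using x by (subst comult_one_eps_t[of "\<lambda>a b. \<epsilon> (a \<otimes> x) * \<phi> b"]) (auto simp: eps_t_apply)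
  finally show "\<phi> (\<epsilon>\<^sub>t (\<epsilon>\<^sub>t x)) = \<phi> (\<epsilon>\<^sub>t x)" .
qed (use x in auto)

text \<open>By \<open>comult_eps_t_apply\<close> the right side is \<open>\<Delta> v\<close> with
  \<open>\<epsilon>\<^sub>t\<close> applied to its second leg, so that leg has to be shown fixed.
  Since \<open>v\<close> is a slice of \<open>\<Delta> \<one>\<close>, coassociativity identifies it
  with the second leg of \<open>\<Delta> \<one>\<close>.\<close>

lemma comult_target:
  assumes v: "v \<in> carrier K" "\<epsilon>\<^sub>t v = v" and B: "B \<in> bilinear_forms K K"
  shows "\<Delta> v B = \<Delta> \<one> (\<lambda>a b. B (a \<otimes> v) b)"
proof -
  note [simp] = bilinear_simps[OF B] v(1)
  have exp: "\<Delta> v G = \<Delta> \<one> (\<lambda>a s. \<Delta> s (\<lambda>c d. \<epsilon> (a \<otimes> v) * G c d))"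
    if G: "G \<in> bilinear_forms K K" for G
  proof -
    note [simp] = bilinear_simps[OF G]
    have "\<Delta> v G = \<Delta> (\<epsilon>\<^sub>t v) G" by (simp add: v(2))
    also have "\<dots> = \<Delta> \<one> (\<lambda>a b. \<epsilon> (a \<otimes> v) * \<Delta> b G)"
      by (subst eps_t_apply[of v "\<lambda>y. \<Delta> y G"]) auto
    also have "\<dots> = \<Delta> \<one> (\<lambda>a s. \<Delta> s (\<lambda>c d. \<epsilon> (a \<otimes> v) * G c d))"
      by (intro comult_cong) (auto simp: comult_scale)
    finally show ?thesis .
  qed
  have "\<Delta> \<one> (\<lambda>a b. B (a \<otimes> v) b) = \<Delta> v (\<lambda>a b. B a (\<epsilon>\<^sub>t b))"
    by (rule comult_eps_t_apply[symmetric]) auto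
  also have "\<dots> = \<Delta> \<one> (\<lambda>a s. \<Delta> s (\<lambda>c d. \<epsilon> (a \<otimes> v) * B c (\<epsilon>\<^sub>t d)))"
    by (rule exp) auto
  also have "\<dots> = \<Delta> \<one> (\<lambda>s d. \<Delta> s (\<lambda>a c. \<epsilon> (a \<otimes> v) * B c (\<epsilon>\<^sub>t d)))"
    by (rule coassoc_apply[symmetric]) auto
  also have "\<dots> = \<Delta> \<one> (\<lambda>s d. \<Delta> s (\<lambda>a c. \<epsilon> (a \<otimes> v) * B c d))"
    by (rule comult_one_eps_t[of "\<lambda>s d. \<Delta> s (\<lambda>a c. \<epsilon> (a \<otimes> v) * B c d)"]) auto
  also have "\<dots> = \<Delta> \<one> (\<lambda>a s. \<Delta> s (\<lambda>c d. \<epsilon> (a \<otimes> v) * B c d))"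
    by (rule coassoc_apply) auto
  also have "\<dots> = \<Delta> v B" by (rule exp[symmetric]) auto
  finally show ?thesis ..
qed

lemma counit_star: "x \<in> carrier K \<Longrightarrow> \<epsilon> (star K x) = cnj (\<epsilon> x)"
  by (rule positive_form_star[OF counit_positive])

lemma eps_t_star:
  assumes v: "v \<in> carrier K" "\<epsilon>\<^sub>t v = v" shows "\<epsilon>\<^sub>t (star K v) = star K v"
proof (rule separation)
  \<comment> \<open>The slice formula for \<open>\<epsilon>\<^sub>t v\<close> after taking adjoints;
    \<open>star K v\<close> now multiplies from the left. It still exhibits \<open>star K v\<close>
    as a slice onto the second leg of \<open>\<Delta> \<one>\<close>.\<close>
  have *: "\<phi> (star K v) = \<Delta> \<one> (\<lambda>a b. \<epsilon> (star K v \<otimes> a) * \<phi> b)" if \<phi>: "linear_form K \<phi>" for \<phi>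
  proof -
    note [simp] = form_simps[OF \<phi>] form_simps[OF linear_form_star[OF \<phi>]]
    let ?B = "\<lambda>a b. \<epsilon> (star K v \<otimes> a) * \<phi> b"
    have B: "?B \<in> bilinear_forms K K" using v by simp
    have "\<phi> (star K v) = \<phi> (star K (\<epsilon>\<^sub>t v))" by (simp add: v)
    also have "\<dots> = cnj (\<Delta> \<one> (\<lambda>a b. \<epsilon> (a \<otimes> v) * cnj (\<phi> (star K b))))"
      using eps_t_apply[OF v(1) linear_form_star[OF \<phi>]] by (metis complex_cnj_cnj)
    also have "\<Delta> \<one> (\<lambda>a b. \<epsilon> (a \<otimes> v) * cnj (\<phi> (star K b))) =
        \<Delta> \<one> (\<lambda>a b. cnj (?B (star K a) (star K b)))"
    proof (rule comult_cong)
      show "(\<lambda>a b. cnj (?B (star K a) (star K b))) \<in> bilinear_forms K K"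
        by (rule bilinear_form_star[OF B])
      show "\<epsilon> (a \<otimes> v) * cnj (\<phi> (star K b)) = cnj (?B (star K a) (star K b))"
        if "a \<in> carrier K" "b \<in> carrier K" for a b
        using that v by (simp add: counit_star[symmetric] star_mult)
    qed (use v in auto)
    also have "cnj \<dots> = \<Delta> (star K \<one>) ?B"
      by (rule comult_star_apply[symmetric]) (use B in auto)
    finally show ?thesis by simp
  qed
  fix \<phi> assume \<phi>: "linear_form K \<phi>"
  note [simp] = form_simps[OF \<phi>]
  have "\<phi> (\<epsilon>\<^sub>t (star K v)) = \<Delta> \<one> (\<lambda>a b. \<epsilon> (star K v \<otimes> a) * \<phi> (\<epsilon>\<^sub>t b))"
    by (rule *) simp
  also have "\<dots> = \<Delta> \<one> (\<lambda>a b. \<epsilon> (star K v \<otimes> a) * \<phi> b)"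
    by (rule comult_one_eps_t[of "\<lambda>a b. \<epsilon> (star K v \<otimes> a) * \<phi> b"]) (use v in auto)
  finally show "\<phi> (\<epsilon>\<^sub>t (star K v)) = \<phi> (star K v)" using *[OF \<phi>] by simp
qed (use v in auto)

text \<open>The adjoint of \<open>comult_target\<close> for \<open>star K v\<close>: the star
  reverses the product in the first leg, so \<open>v\<close> changes sides.\<close>

lemma comult_target':
  assumes v: "v \<in> carrier K" "\<epsilon>\<^sub>t v = v" and B: "B \<in> bilinear_forms K K"
  shows "\<Delta> v B = \<Delta> \<one> (\<lambda>a b. B (v \<otimes> a) b)"
proof -
  note [simp] = bilinear_simps[OF B] v(1)
  let ?B = "\<lambda>a b. cnj (B (star K a) (star K b))"
  let ?C = "\<lambda>a b. B (v \<otimes> a) b"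
  have B': "?B \<in> bilinear_forms K K" by (rule bilinear_form_star[OF B])
  note [simp] = bilinear_simps[OF B']
  have C: "?C \<in> bilinear_forms K K" by simp
  have "\<Delta> v B = \<Delta> (star K (star K v)) B" by simp
  also have "\<dots> = cnj (\<Delta> (star K v) ?B)"
    by (rule comult_star_apply) (use B in auto)
  also have "\<Delta> (star K v) ?B = \<Delta> \<one> (\<lambda>a b. ?B (a \<otimes> star K v) b)"
    by (rule comult_target[OF _ eps_t_star[OF v] B']) simp
  also have "\<dots> = \<Delta> \<one> (\<lambda>a b. cnj (?C (star K a) (star K b)))"
  proof (rule comult_cong)
    show "(\<lambda>a b. cnj (?C (star K a) (star K b))) \<in> bilinear_forms K K"
      by (rule bilinear_form_star[OF C])
    show "(\<lambda>a b. ?B (a \<otimes> star K v) b) \<in> bilinear_forms K K"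
      by (rule bilinear_form_comp[OF B']) auto
  qed (auto simp: star_mult)
  also have "cnj \<dots> = \<Delta> (star K \<one>) ?C"
    by (rule comult_star_apply[symmetric]) (use C in auto)
  finally show ?thesis by simp
qed

text \<open>Multiplicativity of the coproduct reduces this to \<open>\<Delta> v\<close>. These are
  the rules that move a target element into or out of the first leg.\<close>

lemma comult_target_mult:
  assumes v: "v \<in> carrier K" "\<epsilon>\<^sub>t v = v" and x: "x \<in> carrier K" and B: "B \<in> bilinear_forms K K"
  shows "\<Delta> (v \<otimes> x) B = \<Delta> x (\<lambda>a b. B (v \<otimes> a) b)"
    and "\<Delta> (x \<otimes> v) B = \<Delta> x (\<lambda>a b. B (a \<otimes> v) b)"
proof -
  note [simp] = bilinear_simps[OF B] v(1) x
  have "\<Delta> (v \<otimes> x) B = \<Delta> v (\<lambda>a b. \<Delta> x (\<lambda>c d. B (a \<otimes> c) (b \<otimes> d)))"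
    by (rule comult_mult_apply) (use B in auto)
  also have "\<dots> = \<Delta> \<one> (\<lambda>a b. \<Delta> x (\<lambda>c d. B (v \<otimes> a \<otimes> c) (b \<otimes> d)))"
    by (rule comult_target'[OF v]) simp
  also have "\<dots> = \<Delta> \<one> (\<lambda>a b. \<Delta> x (\<lambda>c d. B (v \<otimes> (a \<otimes> c)) (b \<otimes> d)))"
    by (intro comult_cong) (auto simp: m_assoc)
  also have "\<dots> = \<Delta> (\<one> \<otimes> x) (\<lambda>a b. B (v \<otimes> a) b)"
    by (rule comult_mult_apply[symmetric]) auto
  finally show "\<Delta> (v \<otimes> x) B = \<Delta> x (\<lambda>a b. B (v \<otimes> a) b)" by simp
  have "\<Delta> (x \<otimes> v) B = \<Delta> x (\<lambda>a b. \<Delta> v (\<lambda>c d. B (a \<otimes> c) (b \<otimes> d)))"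
    by (rule comult_mult_apply) (use B in auto)
  also have "\<dots> = \<Delta> x (\<lambda>a b. \<Delta> \<one> (\<lambda>c d. B (a \<otimes> (c \<otimes> v)) (b \<otimes> d)))"
    by (intro comult_cong comult_target[OF v]) auto
  also have "\<dots> = \<Delta> x (\<lambda>a b. \<Delta> \<one> (\<lambda>c d. B (a \<otimes> c \<otimes> v) (b \<otimes> d)))"
    by (intro comult_cong) (auto simp: m_assoc)
  also have "\<dots> = \<Delta> (x \<otimes> \<one>) (\<lambda>a b. B (a \<otimes> v) b)"
    by (rule comult_mult_apply[symmetric]) auto
  finally show "\<Delta> (x \<otimes> v) B = \<Delta> x (\<lambda>a b. B (a \<otimes> v) b)" by simp
qed

text \<open>The antipode carries a source element to a target element, swaps the legs and reverses
  products, so the sliding rules reappear in the second leg.\<close>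

lemma comult_source_mult:
  assumes v: "v \<in> carrier K" "\<epsilon>\<^sub>s v = v" and x: "x \<in> carrier K" and B: "B \<in> bilinear_forms K K"
  shows "\<Delta> (v \<otimes> x) B = \<Delta> x (\<lambda>a b. B a (v \<otimes> b))"
    and "\<Delta> (x \<otimes> v) B = \<Delta> x (\<lambda>a b. B a (b \<otimes> v))"
proof -
  note [simp] = bilinear_simps[OF B] v(1) x
  have Sv: "S v \<in> carrier K" "\<epsilon>\<^sub>t (S v) = S v"
    using v antipode_eps_s_eq[of v] by auto
  let ?B = "\<lambda>a b. B (S b) (S a)"
  have B': "?B \<in> bilinear_forms K K" by simp
  have S: "S (S y) = y" if "y \<in> carrier K" for y using that by simp
  have "\<Delta> (v \<otimes> x) B = \<Delta> (S (S x \<otimes> S v)) B" by (simp add: antipode_mult)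
  also have "\<dots> = \<Delta> (S x \<otimes> S v) ?B"
    by (rule comult_antipode_apply) (use B in auto)
  also have "\<dots> = \<Delta> (S x) (\<lambda>a b. B (S b) (S (a \<otimes> S v)))"
    by (rule comult_target_mult(2)[OF Sv _ B']) simp
  also have "\<dots> = \<Delta> x (\<lambda>a b. B (S (S a)) (S (S b \<otimes> S v)))"
    by (rule comult_antipode_apply) (use v in auto)
  also have "\<dots> = \<Delta> x (\<lambda>a b. B a (v \<otimes> b))"
    by (intro comult_cong) (auto simp: antipode_mult)
  finally show "\<Delta> (v \<otimes> x) B = \<Delta> x (\<lambda>a b. B a (v \<otimes> b))" .
  have "\<Delta> (x \<otimes> v) B = \<Delta> (S (S v \<otimes> S x)) B" by (simp add: antipode_mult)
  also have "\<dots> = \<Delta> (S v \<otimes> S x) ?B"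
    by (rule comult_antipode_apply) (use B in auto)
  also have "\<dots> = \<Delta> (S x) (\<lambda>a b. B (S b) (S (S v \<otimes> a)))"
    by (rule comult_target_mult(1)[OF Sv _ B']) simp
  also have "\<dots> = \<Delta> x (\<lambda>a b. B (S (S a)) (S (S v \<otimes> S b)))"
    by (rule comult_antipode_apply) (use v in auto)
  also have "\<dots> = \<Delta> x (\<lambda>a b. B a (b \<otimes> v))"
    by (intro comult_cong) (auto simp: antipode_mult)
  finally show "\<Delta> (x \<otimes> v) B = \<Delta> x (\<lambda>a b. B a (b \<otimes> v))" .
qed

lemma linear_map_zero:
  assumes "linear_map K K g" shows "g \<zero> = \<zero>"
proof -
  have "g (0 \<odot> \<zero>) = 0 \<odot> g \<zero>" using assms unfolding linear_map_def by blast
  then show ?thesis using linear_map_closed[OF assms] by simp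
qed

text \<open>Both factors slide out to the right in the first leg of \<open>\<Delta> \<one>\<close>;
  slicing with the counit then gives the formula for \<open>\<epsilon>\<^sub>t\<close>. Closure
  under products keeps polynomials in \<open>E_s K \<tau> p\<close> inside the subalgebra.\<close>

lemma eps_t_mult_fixed:
  assumes u: "u \<in> carrier K" "\<epsilon>\<^sub>t u = u" and v: "v \<in> carrier K" "\<epsilon>\<^sub>t v = v"
  shows "\<epsilon>\<^sub>t (u \<otimes> v) = u \<otimes> v"
proof (rule separation)
  note [simp] = u(1) v(1)
  fix \<phi> assume \<phi>: "linear_form K \<phi>"
  note [simp] = form_simps[OF \<phi>]
  have "\<phi> (u \<otimes> v) = \<Delta> (u \<otimes> v) (\<lambda>a b. \<epsilon> a * \<phi> b)"
    by (rule counit_left_apply[OF _ \<phi>, symmetric]) simp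
  also have "\<dots> = \<Delta> u (\<lambda>a b. \<epsilon> (a \<otimes> v) * \<phi> b)"
    by (rule comult_target_mult(2)[OF v]) auto
  also have "\<dots> = \<Delta> \<one> (\<lambda>a b. \<epsilon> (a \<otimes> u \<otimes> v) * \<phi> b)"
    by (rule comult_target[OF u]) auto
  also have "\<dots> = \<Delta> \<one> (\<lambda>a b. \<epsilon> (a \<otimes> (u \<otimes> v)) * \<phi> b)"
    by (intro comult_cong) (auto simp: m_assoc)
  also have "\<dots> = \<phi> (\<epsilon>\<^sub>t (u \<otimes> v))"
    by (rule eps_t_apply[symmetric]) auto
  finally show "\<phi> (\<epsilon>\<^sub>t (u \<otimes> v)) = \<phi> (u \<otimes> v)" ..
qed (use u v in auto)

lemma eps_s_mult_fixed:
  assumes u: "u \<in> carrier K" "\<epsilon>\<^sub>s u = u" and v: "v \<in> carrier K" "\<epsilon>\<^sub>s v = v"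
  shows "\<epsilon>\<^sub>s (u \<otimes> v) = u \<otimes> v"
proof -
  have "\<epsilon>\<^sub>t (S v \<otimes> S u) = S v \<otimes> S u"
    using u v antipode_eps_s_eq[of u] antipode_eps_s_eq[of v] by (intro eps_t_mult_fixed) simp_all
  then have "\<epsilon>\<^sub>t (S (u \<otimes> v)) = S (u \<otimes> v)" using u v by (simp add: antipode_mult)
  then have "S (\<epsilon>\<^sub>s (u \<otimes> v)) = S (u \<otimes> v)" using u v by (simp add: antipode_eps_s_eq)
  then show ?thesis using u v by (metis antipode_antipode eps_s_closed m_closed)
qed

text \<open>Replacing \<open>\<epsilon>\<^sub>t\<close> by the coproduct of \<open>\<one>\<close>
  lets \<open>S x\<close> be factored out on the left; what remains is
  \<open>\<epsilon>\<^sub>s \<one> = \<one>\<close>. It closes the calculation in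
  \<open>comult_integral_left\<close>.\<close>

lemma antipode_mult_eps_t:
  assumes x: "x \<in> carrier K" and \<phi>: "linear_form K \<phi>"
  shows "\<Delta> x (\<lambda>a b. \<phi> (S a \<otimes> \<epsilon>\<^sub>t b)) = \<phi> (S x)"
proof -
  note [simp] = form_simps[OF \<phi>]
  have "\<Delta> x (\<lambda>a b. \<phi> (S a \<otimes> \<epsilon>\<^sub>t b)) = \<Delta> \<one> (\<lambda>a b. \<phi> (S (a \<otimes> x) \<otimes> b))"
    by (rule comult_eps_t_apply[of x "\<lambda>a b. \<phi> (S a \<otimes> b)"]) (use x in auto)
  also have "\<dots> = \<Delta> \<one> (\<lambda>a b. \<phi> (S x \<otimes> (S a \<otimes> b)))"
    using x by (intro comult_cong) (auto simp: antipode_mult m_assoc)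
  also have "\<dots> = \<phi> (S x \<otimes> \<epsilon>\<^sub>s \<one>)"
    by (rule antipode_eps_s_apply[of \<one> "\<lambda>y. \<phi> (S x \<otimes> y)"]) (use x in auto)
  finally show ?thesis using x by simp
qed

end

section \<open>Corners at hypercentral projections\<close>

text \<open>Tensors over the corner are functionals on forms over the smaller carrier, so the
  coproduct has to be transported even though it is a restriction. Compressing both legs by
  \<open>e\<close> makes a form over the corner see only elements of the corner. The record is built
  in two stages because the new coproduct refers to the new carrier.\<close>

definition corner :: "('a, 'm) weak_kac_scheme \<Rightarrow> 'a \<Rightarrow> ('a, 'm) weak_kac_scheme" where
  "corner K e =
    (let L = K\<lparr>carrier := {x \<in> carrier K. e \<otimes>\<^bsub>K\<^esub> x = x}, one := e\<rparr> in
     L\<lparr>comult := \<lambda>x. tensor_map L L (\<lambda>a. e \<otimes>\<^bsub>K\<^esub> a) (\<lambda>a. e \<otimes>\<^bsub>K\<^esub> a) (comult K x)\<rparr>)"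

lemma corner_simps [simp]:
  "carrier (corner K e) = {x \<in> carrier K. e \<otimes>\<^bsub>K\<^esub> x = x}"
  "monoid.mult (corner K e) = monoid.mult K" "monoid.one (corner K e) = e" "ring.zero (corner K e) = ring.zero K"
  "ring.add (corner K e) = ring.add K" "module.smult (corner K e) = module.smult K" "star (corner K e) = star K"
  "counit (corner K e) = counit K" "antipode (corner K e) = antipode K"
  by (simp_all add: corner_def Let_def)

text \<open>The intermediate record in the definition and the finished corner have the same carrier
  and operations, hence the same bilinear forms.\<close>

lemma comult_corner: "comult (corner K e) x =
  tensor_map (corner K e) (corner K e) (\<lambda>a. e \<otimes>\<^bsub>K\<^esub> a) (\<lambda>a. e \<otimes>\<^bsub>K\<^esub> a) (comult K x)"
  by (simp add: corner_def Let_def tensor_map_def on_forms_def bilinear_forms_def linear_form_def)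

lemma tensor_outside_simps:
  assumes "B \<notin> bilinear_forms V W"
  shows "tensor_map V W f g t B = 0" "tensor_flip V W t' B = 0"
    "(t1 \<otimes>\<^bsub>tensor_product V W\<^esub> t2) B = 0" "star (tensor_product V W) t1 B = 0"
  using assms by (simp_all add: tensor_map_def tensor_flip_def tensor_product_def on_forms_def)

text \<open>The two Cartan conditions serve different legs: \<open>target\<close> lets
  \<open>e\<close> leave the first leg of a coproduct, \<open>source\<close> the second.\<close>

locale hypercentral_projection = weak_kac_algebra +
  fixes e
  assumes projection: "projection K e"
    and central: "x \<in> carrier K \<Longrightarrow> x \<otimes> e = e \<otimes> x"
    and source: "eps_s K e = e" and target: "eps_t K e = e"
begin

abbreviation L where "L \<equiv> corner K e"

lemma proj_closed [simp]: "e \<in> carrier K" and proj_star [simp]: "star K e = e"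
  and proj_idem [simp]: "e \<otimes> e = e"
  using projection by (auto simp: projection_def)

lemma proj_idem_left [simp]: "x \<in> carrier K \<Longrightarrow> e \<otimes> (e \<otimes> x) = e \<otimes> x"
  by (simp add: m_assoc[symmetric])

lemma proj_left_commute: "x \<in> carrier K \<Longrightarrow> y \<in> carrier K \<Longrightarrow> x \<otimes> (e \<otimes> y) = e \<otimes> (x \<otimes> y)"
  by (simp add: m_assoc[symmetric] central)

text \<open>Write \<open>e\<close> as \<open>\<epsilon>\<^sub>s e\<close> and expand it as
  \<open>S a \<otimes> b\<close> over \<open>\<Delta> e\<close>. As a target element
  \<open>e\<close> moves into the first leg of \<open>\<Delta> \<one>\<close> and leaves through the
  antipode as \<open>S e\<close>.\<close>

lemma antipode_proj [simp]: "S e = e"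
proof (rule separation)
  fix \<phi> assume \<phi>: "linear_form K \<phi>"
  note [simp] = form_simps[OF \<phi>]
  have "\<phi> e = \<Delta> e (\<lambda>a b. \<phi> (S a \<otimes> b))"
    using antipode_eps_s_apply[OF proj_closed \<phi>] by (simp add: source)
  also have "\<dots> = \<Delta> \<one> (\<lambda>a b. \<phi> (S (a \<otimes> e) \<otimes> b))"
    by (rule comult_target) (auto simp: target)
  also have "\<dots> = \<Delta> \<one> (\<lambda>a b. \<phi> (S e \<otimes> (S a \<otimes> b)))"
    by (intro comult_cong) (auto simp: antipode_mult m_assoc)
  also have "\<dots> = \<phi> (S e \<otimes> \<epsilon>\<^sub>s \<one>)"
    by (rule antipode_eps_s_apply[of \<one> "\<lambda>y. \<phi> (S e \<otimes> y)"]) auto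
  finally show "\<phi> (S e) = \<phi> e" by simp
qed auto

lemma comult_proj_left:
  assumes "x \<in> carrier K" "B \<in> bilinear_forms K K"
  shows "\<Delta> x (\<lambda>a b. B (e \<otimes> a) b) = \<Delta> (e \<otimes> x) B"
  using comult_target_mult(1)[OF proj_closed target assms] by simp

lemma comult_proj_right:
  assumes "x \<in> carrier K" "B \<in> bilinear_forms K K"
  shows "\<Delta> x (\<lambda>a b. B a (e \<otimes> b)) = \<Delta> (e \<otimes> x) B"
  using comult_source_mult(1)[OF proj_closed source assms] by simp

lemma linear_map_compress: "linear_map K L (\<lambda>x. e \<otimes> x)"
  by (auto simp: linear_map_def r_distr smult_mult_right)

lemma linear_form_compress: "linear_form L \<phi> \<Longrightarrow> linear_form K (\<lambda>x. \<phi> (e \<otimes> x))"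
  by (rule linear_form_comp[OF _ linear_map_compress])

lemma bilinear_form_compress:
  "B \<in> bilinear_forms L L \<Longrightarrow> (\<lambda>a b. B (e \<otimes> a) (e \<otimes> b)) \<in> bilinear_forms K K"
  by (rule bilinear_form_comp[OF _ linear_map_compress linear_map_compress])

lemma linear_form_corner: "linear_form K \<phi> \<Longrightarrow> linear_form L \<phi>"
  by (simp add: linear_form_def)

section \<open>The corner as a finite-dimensional \<open>C\<^sup>*\<close>-algebra\<close>

lemma abelian_group_corner: "abelian_group L"
proof (rule abelian_groupI)
  fix x assume "x \<in> carrier L"
  then show "\<exists>y\<in>carrier L. y \<oplus>\<^bsub>L\<^esub> x = \<zero>\<^bsub>L\<^esub>"
    using add_neg_smult[of x] by (intro bexI[of _ "(-1) \<odot> x"])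
      (auto simp: smult_mult_right M.a_comm)
qed (auto simp: r_distr M.a_ac)

lemma star_algebra_corner: "star_algebra L"
proof (intro star_algebra.intro star_algebra_axioms.intro)
  show "Module.module complex_scalars L"
    by (rule moduleI[OF cring_complex_scalars abelian_group_corner])
      (auto simp: smult_mult_right smult_add_left smult_add_right smult_smult)
  show "ring L"
  proof (rule ringI[OF abelian_group_corner])
    show "monoid L"
      by (rule monoidI) (auto simp: m_assoc[symmetric] central)
  qed (auto simp: l_distr r_distr)
  show "star L x \<in> carrier L" if "x \<in> carrier L" for x
    using that star_mult[of e x] central[of "star K x"] by auto
qed (auto simp: smult_mult_left smult_mult_right star_add star_smult star_mult)

lemma fd_cstar_algebra_corner: "fd_cstar_algebra L"
proof (intro fd_cstar_algebra.intro fd_cstar_algebra_axioms.intro)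
  interpret L: star_algebra L by (rule star_algebra_corner)
  show "star_algebra L" by (rule star_algebra_corner)
  obtain B \<phi> where B: "finite B" "B \<subseteq> carrier K" "\<And>b. b \<in> B \<Longrightarrow> linear_form K (\<phi> b)"
    "\<And>x. x \<in> carrier K \<Longrightarrow> x = (\<Oplus>b\<in>B. \<phi> b x \<odot> b)" by (rule basis) blast
  let ?B = "(\<lambda>b. e \<otimes> b) ` B"
  have sub: "?B \<subseteq> carrier L" using B(2) by auto
  \<comment> \<open>Compression may identify several basis vectors, so their coefficients are added
    over each fibre.\<close>
  have *: "x = (\<Oplus>\<^bsub>L\<^esub>v\<in>?B. (\<Sum>b\<in>{b \<in> B. e \<otimes> b = v}. \<phi> b x) \<odot>\<^bsub>L\<^esub> v)" (is "x = ?s")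
    if x: "x \<in> carrier L" for x
  proof (rule separation)
    have s: "?s \<in> carrier L" using B(2) by (intro L.M.finsum_closed) (auto simp: smult_mult_right)
    show "x \<in> carrier K" "?s \<in> carrier K" using x s by auto
    fix \<psi> assume \<psi>: "linear_form K \<psi>"
    note [simp] = form_simps[OF \<psi>]
    have "\<psi> x = \<psi> (e \<otimes> x)" using x by simp
    also have "\<dots> = (\<Sum>b\<in>B. \<phi> b x * \<psi> (e \<otimes> b))"
      by (rule linear_form_expand[OF B(1,2) B(4)]) (use x in auto)
    also have "\<dots> = (\<Sum>v\<in>?B. \<Sum>b\<in>{b \<in> B. e \<otimes> b = v}. \<phi> b x * \<psi> (e \<otimes> b))"
      by (rule sum.image_gen[OF B(1)])
    also have "\<dots> = (\<Sum>v\<in>?B. (\<Sum>b\<in>{b \<in> B. e \<otimes> b = v}. \<phi> b x) * \<psi> v)"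
      by (intro sum.cong) (auto simp: sum_distrib_right)
    also have "\<dots> = \<psi> ?s"
      by (rule L.linear_form_expand[symmetric, OF _ sub refl linear_form_corner[OF \<psi>]])
        (use B(1) in simp)
    finally show "\<psi> x = \<psi> ?s" .
  qed
  show "\<exists>B. finite B \<and> B \<subseteq> carrier L \<and> (\<forall>x\<in>carrier L. \<exists>c. x = (\<Oplus>\<^bsub>L\<^esub>b\<in>B. c b \<odot>\<^bsub>L\<^esub> b))"
    by (rule exI[of _ ?B], intro conjI ballI, use B(1) in simp, rule sub, rule exI, erule *)
  show "\<exists>N. cstar_norm L N"
  proof -
    obtain N where "cstar_norm K N" using ex_cstar_norm by blast
    then have "cstar_norm L N" by (simp add: cstar_norm_def)
    then show ?thesis by blast
  qed
qed

interpretation L: fd_cstar_algebra L by (rule fd_cstar_algebra_corner)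

section \<open>The weak Kac axioms in the corner\<close>

lemma comult_corner_apply:
  "B \<in> bilinear_forms L L \<Longrightarrow> comult L x B = \<Delta> x (\<lambda>a b. B (e \<otimes> a) (e \<otimes> b))"
  by (simp add: comult_corner)

lemma comult_corner_closed: "x \<in> carrier K \<Longrightarrow> comult L x \<in> tensors L L"
  unfolding comult_corner by (rule tensor_map_closed[OF _ linear_map_compress linear_map_compress]) simp

lemma linear_map_antipode_corner: "linear_map L L S"
proof -
  have "e \<otimes> S x = S x" if "x \<in> carrier K" "e \<otimes> x = x" for x
    using that antipode_mult[of x e] central[of x] by simp
  then show ?thesis using antipode_linear by (auto simp: linear_map_def)
qed

text \<open>Stated for general \<open>y\<close> to be used twice: \<open>y = e\<close> identifies
  \<open>eps_s L\<close>, and the general case is then the axiom on \<open>eps_s\<close> times an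
  element.\<close>

lemma corner_slice:
  assumes x: "x \<in> carrier L" and y: "y \<in> carrier L"
  shows "tensor_lift L (\<lambda>a b. \<epsilon> b \<odot> a)
    (pure_tensor L L e x \<otimes>\<^bsub>tensor_product L L\<^esub> comult L y) = \<epsilon>\<^sub>s x \<otimes> y"
proof (rule tensor_lift_eq[OF L.separation])
  have xy [simp]: "x \<in> carrier K" "y \<in> carrier K" "e \<otimes> x = x" "e \<otimes> y = y" using x y by auto
  show "\<epsilon>\<^sub>s x \<otimes> y \<in> carrier L" by (simp add: proj_left_commute[symmetric])
  fix \<phi> assume \<phi>: "linear_form L \<phi>"
  note [simp] = form_simps[OF linear_form_compress[OF \<phi>]]
  have scale: "\<phi> (k \<odot> a) = k * \<phi> a" if "a \<in> carrier L" for k a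
    using L.linear_form_lin(2)[OF \<phi> that, of k] by simp
  let ?G = "\<lambda>a b. \<phi> (\<epsilon> b \<odot> a)"
  have b: "?G \<in> bilinear_forms L L"
  proof (rule L.bilinear_form_cong)
    show "(\<lambda>a b. \<epsilon> b * \<phi> a) \<in> bilinear_forms L L"
      using \<phi> linear_form_corner[OF linear_form_counit(1)] by simp
  qed (simp add: scale)
  have lx: "linear_map L L (\<lambda>d. x \<otimes> d)" "linear_map L L (\<lambda>d. e \<otimes> d)"
    using L.linear_map_mult_left[of x] L.linear_map_mult_left[of e] x by simp_all
  have b': "(\<lambda>c d. ?G (e \<otimes> c) (x \<otimes> d)) \<in> bilinear_forms L L"
    by (rule bilinear_form_comp[OF b lx(2,1)])
  have "(pure_tensor L L e x \<otimes>\<^bsub>tensor_product L L\<^esub> comult L y) ?G =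
      comult L y (\<lambda>c d. ?G (e \<otimes> c) (x \<otimes> d))"
    using L.pure_tensor_mult_apply[OF b comult_corner_closed] by simp
  also have "\<dots> = \<Delta> y (\<lambda>c d. ?G (e \<otimes> (e \<otimes> c)) (x \<otimes> (e \<otimes> d)))"
    by (rule comult_corner_apply[OF b'])
  also have "\<dots> = \<Delta> y (\<lambda>c d. \<epsilon> (x \<otimes> (e \<otimes> d)) * \<phi> (e \<otimes> c))"
    using bilinear_form_compress[OF b'] by (intro comult_cong) (auto simp: scale)
  also have "\<dots> = \<Delta> (e \<otimes> y) (\<lambda>c d. \<epsilon> (x \<otimes> d) * \<phi> (e \<otimes> c))"
    by (rule comult_proj_right) auto
  also have "\<dots> = \<phi> (e \<otimes> (\<epsilon>\<^sub>s x \<otimes> (e \<otimes> y)))"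
    by (rule eps_s_mult_apply[symmetric]) auto
  also have "\<dots> = \<phi> (\<epsilon>\<^sub>s x \<otimes> y)" by (simp add: proj_left_commute[symmetric])
  finally show "\<phi> (\<epsilon>\<^sub>s x \<otimes> y) =
    (pure_tensor L L e x \<otimes>\<^bsub>tensor_product L L\<^esub> comult L y) ?G" ..
qed

lemma eps_s_corner: "x \<in> carrier L \<Longrightarrow> eps_s L x = \<epsilon>\<^sub>s x \<otimes> e"
  using corner_slice[of x e] by (simp add: eps_s_def[of L])

lemma linear_map_eps_s_corner: "linear_map L L (eps_s L)"
proof -
  have "linear_map K K (\<lambda>x. \<epsilon>\<^sub>s x \<otimes> e)" by simp
  then show ?thesis
    unfolding linear_map_def
    by (auto simp: eps_s_corner central r_distr smult_mult_right)
qed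

lemma comult_corner_linear: "linear_map L (tensor_product L L) (comult L)"
  unfolding linear_map_def
proof (intro conjI ballI allI)
  fix x y c assume xy: "x \<in> carrier L" "y \<in> carrier L"
  have lin: "\<Delta> (x \<oplus> y) B = \<Delta> x B + \<Delta> y B" if "B \<in> bilinear_forms K K" for B
    using xy linear_form_lin(1)[OF linear_form_comult[OF that linear_map_id]] by simp
  show "comult L (x \<oplus>\<^bsub>L\<^esub> y) = comult L x \<oplus>\<^bsub>tensor_product L L\<^esub> comult L y"
    by (auto simp: comult_corner tensor_map_def on_forms_def lin[OF bilinear_form_compress]
      simp del: bilinear_form_iff)
next
  fix x c assume x: "x \<in> carrier L"
  have lin: "\<Delta> (c \<odot> x) B = c * \<Delta> x B" if "B \<in> bilinear_forms K K" for B
    using x linear_form_lin(2)[OF linear_form_comult[OF that linear_map_id]] by simp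
  show "comult L (c \<odot>\<^bsub>L\<^esub> x) = c \<odot>\<^bsub>tensor_product L L\<^esub> comult L x"
    by (auto simp: comult_corner tensor_map_def on_forms_def lin[OF bilinear_form_compress]
      simp del: bilinear_form_iff)
qed (auto simp: comult_corner_closed)

lemma compress_mult:
  "a \<in> carrier K \<Longrightarrow> b \<in> carrier K \<Longrightarrow> (e \<otimes> a) \<otimes> (e \<otimes> b) = e \<otimes> (a \<otimes> b)"
  by (simp add: m_assoc proj_left_commute[of a b])

lemma comult_corner_mult:
  assumes xy: "x \<in> carrier L" "y \<in> carrier L"
  shows "comult L (x \<otimes>\<^bsub>L\<^esub> y) = comult L x \<otimes>\<^bsub>tensor_product L L\<^esub> comult L y"
proof (rule tensor_eqI)
  have [simp]: "x \<in> carrier K" "y \<in> carrier K" using xy by auto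
  fix B assume B: "B \<in> bilinear_forms L L"
  note B' = bilinear_form_compress[OF B]
  note [simp] = bilinear_simps[OF B']
  have c: "(\<lambda>c d. B (a \<otimes> c) (b \<otimes> d)) \<in> bilinear_forms L L" if "a \<in> carrier L" "b \<in> carrier L" for a b
    by (rule bilinear_form_comp[OF B]) (use L.linear_map_mult_left that in auto)
  have "comult L (x \<otimes>\<^bsub>L\<^esub> y) B = \<Delta> (x \<otimes> y) (\<lambda>a b. B (e \<otimes> a) (e \<otimes> b))"
    by (simp add: comult_corner_apply[OF B])
  also have "\<dots> = \<Delta> x (\<lambda>a b. \<Delta> y (\<lambda>c d. B (e \<otimes> (a \<otimes> c)) (e \<otimes> (b \<otimes> d))))"
    by (rule comult_mult_apply[OF _ _ B']) auto
  also have "\<dots> = \<Delta> x (\<lambda>a b. comult L y (\<lambda>c d. B (e \<otimes> a \<otimes> c) (e \<otimes> b \<otimes> d)))"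
  proof (rule comult_cong)
    show eq: "\<Delta> y (\<lambda>c d. B (e \<otimes> (a \<otimes> c)) (e \<otimes> (b \<otimes> d))) =
        comult L y (\<lambda>c d. B (e \<otimes> a \<otimes> c) (e \<otimes> b \<otimes> d))"
      if [simp]: "a \<in> carrier K" "b \<in> carrier K" for a b
    proof -
      have "comult L y (\<lambda>c d. B (e \<otimes> a \<otimes> c) (e \<otimes> b \<otimes> d)) =
          \<Delta> y (\<lambda>c d. B (e \<otimes> a \<otimes> (e \<otimes> c)) (e \<otimes> b \<otimes> (e \<otimes> d)))"
        by (rule comult_corner_apply, rule c) (auto simp: that)
      also have "\<dots> = \<Delta> y (\<lambda>c d. B (e \<otimes> (a \<otimes> c)) (e \<otimes> (b \<otimes> d)))"
        using bilinear_form_compress[OF c[of "e \<otimes> a" "e \<otimes> b"]]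
        by (intro comult_cong) (simp_all add: compress_mult)
      finally show ?thesis ..
    qed
    show b: "(\<lambda>a b. \<Delta> y (\<lambda>c d. B (e \<otimes> (a \<otimes> c)) (e \<otimes> (b \<otimes> d)))) \<in> bilinear_forms K K"
      by simp
    show "(\<lambda>a b. comult L y (\<lambda>c d. B (e \<otimes> a \<otimes> c) (e \<otimes> b \<otimes> d))) \<in> bilinear_forms K K"
      by (rule bilinear_form_cong[OF eq[symmetric] b])
  qed simp
  also have "\<dots> = comult L x (\<lambda>a b. comult L y (\<lambda>c d. B (a \<otimes> c) (b \<otimes> d)))"
    using L.mult_form_bilinear[OF B comult_corner_closed, of y]
    by (intro comult_corner_apply[symmetric]) (simp del: bilinear_form_iff)
  also have "\<dots> = (comult L x \<otimes>\<^bsub>tensor_product L L\<^esub> comult L y) B"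
    using B by (simp add: tensor_mult_apply del: bilinear_form_iff)
  finally show "comult L (x \<otimes>\<^bsub>L\<^esub> y) B = (comult L x \<otimes>\<^bsub>tensor_product L L\<^esub> comult L y) B" .
qed (simp_all add: comult_corner tensor_outside_simps del: bilinear_form_iff)

lemma comult_corner_star:
  assumes x: "x \<in> carrier L"
  shows "comult L (star L x) = star (tensor_product L L) (comult L x)"
proof (rule tensor_eqI)
  have [simp]: "x \<in> carrier K" using x by auto
  fix B assume B: "B \<in> bilinear_forms L L"
  note B' = bilinear_form_compress[OF B]
  have eq: "cnj (B (e \<otimes> star K a) (e \<otimes> star K b)) = cnj (B (star K (e \<otimes> a)) (star K (e \<otimes> b)))"
    if "a \<in> carrier K" "b \<in> carrier K" for a b
    using that by (simp add: star_mult central)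
  have "comult L (star L x) B = \<Delta> (star K x) (\<lambda>a b. B (e \<otimes> a) (e \<otimes> b))"
    by (simp add: comult_corner_apply[OF B])
  also have "\<dots> = cnj (\<Delta> x (\<lambda>a b. cnj (B (e \<otimes> star K a) (e \<otimes> star K b))))"
    by (rule comult_star_apply[OF _ B']) simp
  also have "\<Delta> x (\<lambda>a b. cnj (B (e \<otimes> star K a) (e \<otimes> star K b))) =
      \<Delta> x (\<lambda>a b. cnj (B (star K (e \<otimes> a)) (star K (e \<otimes> b))))"
    by (rule comult_cong[OF eq _ bilinear_form_star[OF B']
        bilinear_form_cong[OF eq[symmetric] bilinear_form_star[OF B']]]) auto
  also have "\<dots> = comult L x (\<lambda>a b. cnj (B (star L a) (star L b)))"
    using comult_corner_apply[OF L.bilinear_form_star[OF B], of x] by simp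
  also have "cnj \<dots> = star (tensor_product L L) (comult L x) B"
    by (rule tensor_star_apply[OF B, symmetric])
  finally show "comult L (star L x) B = star (tensor_product L L) (comult L x) B" .
qed (simp_all add: comult_corner tensor_outside_simps del: bilinear_form_iff)

lemma comult_corner_antipode:
  assumes x: "x \<in> carrier L"
  shows "comult L (antipode L x) =
    tensor_flip L L (tensor_map L L (antipode L) (antipode L) (comult L x))"
proof (rule tensor_eqI)
  have [simp]: "x \<in> carrier K" using x by auto
  fix B assume B: "B \<in> bilinear_forms L L"
  note B' = bilinear_form_compress[OF B]
  note [simp] = bilinear_simps[OF B']
  have F: "(\<lambda>b a. B a b) \<in> bilinear_forms L L"
    using B by (auto simp: bilinear_forms_def)
  have G: "(\<lambda>a b. B (S b) (S a)) \<in> bilinear_forms L L"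
    by (rule bilinear_form_comp[OF F linear_map_antipode_corner linear_map_antipode_corner])
  have eq: "B (e \<otimes> S b) (e \<otimes> S a) = B (S (e \<otimes> b)) (S (e \<otimes> a))"
    if "a \<in> carrier K" "b \<in> carrier K" for a b
    using that by (simp add: antipode_mult central)
  have "comult L (antipode L x) B = \<Delta> (S x) (\<lambda>a b. B (e \<otimes> a) (e \<otimes> b))"
    by (simp add: comult_corner_apply[OF B])
  also have "\<dots> = \<Delta> x (\<lambda>a b. B (e \<otimes> S b) (e \<otimes> S a))"
    by (rule comult_antipode_apply[OF _ B']) simp
  also have "\<dots> = \<Delta> x (\<lambda>a b. B (S (e \<otimes> b)) (S (e \<otimes> a)))"
    using bilinear_form_compress[OF G] by (intro comult_cong eq) auto
  also have "\<dots> = comult L x (\<lambda>a b. B (S b) (S a))"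
    by (rule comult_corner_apply[OF G, symmetric])
  also have "\<dots> = tensor_flip L L (tensor_map L L (antipode L) (antipode L) (comult L x)) B"
    using B F by (simp del: bilinear_form_iff)
  finally show "comult L (antipode L x) B = tensor_flip L L (tensor_map L L (antipode L) (antipode L) (comult L x)) B" .
qed (simp_all add: comult_corner tensor_outside_simps del: bilinear_form_iff)

lemma comult_corner_counit:
  assumes x: "x \<in> carrier L"
  shows "tensor_lift L (\<lambda>a b. \<epsilon> a \<odot> b) (comult L x) = x"
    and "tensor_lift L (\<lambda>a b. \<epsilon> b \<odot> a) (comult L x) = x"
proof -
  have [simp]: "x \<in> carrier K" "e \<otimes> x = x" using x by auto
  have "\<phi> x = comult L x (\<lambda>a b. \<phi> (\<epsilon> a \<odot> b)) \<and> \<phi> x = comult L x (\<lambda>a b. \<phi> (\<epsilon> b \<odot> a))"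
    if \<phi>: "linear_form L \<phi>" for \<phi>
  proof
    note \<phi>' = linear_form_compress[OF \<phi>]
    note [simp] = form_simps[OF \<phi>']
    have scale: "\<phi> (k \<odot> a) = k * \<phi> a" if "a \<in> carrier L" for k a
      using L.linear_form_lin(2)[OF \<phi> that, of k] by simp
    have b: "(\<lambda>a b. \<phi> (\<epsilon> a \<odot> b)) \<in> bilinear_forms L L" "(\<lambda>a b. \<phi> (\<epsilon> b \<odot> a)) \<in> bilinear_forms L L"
      using \<phi> linear_form_corner[OF linear_form_counit(1)]
      by (auto intro!: L.bilinear_form_cong[of "\<lambda>a b. \<phi> (\<epsilon> a \<odot> b)" "\<lambda>a b. \<epsilon> a * \<phi> b"]
         L.bilinear_form_cong[of "\<lambda>a b. \<phi> (\<epsilon> b \<odot> a)" "\<lambda>a b. \<epsilon> b * \<phi> a"] simp: scale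
         simp del: bilinear_form_iff)
    have "comult L x (\<lambda>a b. \<phi> (\<epsilon> a \<odot> b)) = \<Delta> x (\<lambda>a b. \<phi> (\<epsilon> (e \<otimes> a) \<odot> (e \<otimes> b)))"
      by (rule comult_corner_apply[OF b(1)])
    also have "\<dots> = \<Delta> x (\<lambda>a b. \<epsilon> (e \<otimes> a) * \<phi> (e \<otimes> b))"
      using bilinear_form_compress[OF b(1)] by (intro comult_cong) (auto simp: scale)
    also have "\<dots> = \<Delta> (e \<otimes> x) (\<lambda>a b. \<epsilon> a * \<phi> (e \<otimes> b))"
      by (rule comult_proj_left) auto
    also have "\<dots> = \<phi> x" using counit_left_apply[OF _ \<phi>', of x] by simp
    finally show "\<phi> x = comult L x (\<lambda>a b. \<phi> (\<epsilon> a \<odot> b))" ..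
    have "comult L x (\<lambda>a b. \<phi> (\<epsilon> b \<odot> a)) = \<Delta> x (\<lambda>a b. \<phi> (\<epsilon> (e \<otimes> b) \<odot> (e \<otimes> a)))"
      by (rule comult_corner_apply[OF b(2)])
    also have "\<dots> = \<Delta> x (\<lambda>a b. \<epsilon> (e \<otimes> b) * \<phi> (e \<otimes> a))"
      using bilinear_form_compress[OF b(2)] by (intro comult_cong) (auto simp: scale)
    also have "\<dots> = \<Delta> (e \<otimes> x) (\<lambda>a b. \<epsilon> b * \<phi> (e \<otimes> a))"
      by (rule comult_proj_right) auto
    also have "\<dots> = \<phi> x" using counit_right_apply[OF _ \<phi>', of x] by simp
    finally show "\<phi> x = comult L x (\<lambda>a b. \<phi> (\<epsilon> b \<odot> a))" ..
  qed
  then show "tensor_lift L (\<lambda>a b. \<epsilon> a \<odot> b) (comult L x) = x"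
    "tensor_lift L (\<lambda>a b. \<epsilon> b \<odot> a) (comult L x) = x"
    using x by (auto intro!: tensor_lift_eq[OF L.separation] simp del: corner_simps(1))
qed

lemma comult_corner_eps_s:
  assumes x: "x \<in> carrier L"
  shows "tensor_map L L (eps_s L) (\<lambda>b. b) (comult L x) =
    pure_tensor L L e x \<otimes>\<^bsub>tensor_product L L\<^esub> comult L e"
proof (rule tensor_eqI)
  have [simp]: "x \<in> carrier K" "e \<otimes> x = x" using x by auto
  fix B assume B: "B \<in> bilinear_forms L L"
  note B' = bilinear_form_compress[OF B]
  note [simp] = bilinear_simps[OF B']
  have b1: "(\<lambda>a b. B (eps_s L a) b) \<in> bilinear_forms L L"
    by (rule bilinear_form_comp[OF B linear_map_eps_s_corner linear_map_id])
  have b2: "(\<lambda>a b. B (e \<otimes> a) (x \<otimes> b)) \<in> bilinear_forms L L"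
    using L.linear_map_mult_left[of e] L.linear_map_mult_left[OF x]
    by (intro bilinear_form_comp[OF B]) simp_all
  have e1: "eps_s L (e \<otimes> a) = e \<otimes> \<epsilon>\<^sub>s (e \<otimes> a)" if "a \<in> carrier K" for a
    using that by (simp add: eps_s_corner central)
  have "tensor_map L L (eps_s L) (\<lambda>b. b) (comult L x) B = comult L x (\<lambda>a b. B (eps_s L a) b)"
    using B by (simp del: bilinear_form_iff)
  also have "\<dots> = \<Delta> x (\<lambda>a b. B (eps_s L (e \<otimes> a)) (e \<otimes> b))"
    by (rule comult_corner_apply[OF b1])
  also have "\<dots> = \<Delta> x (\<lambda>a b. B (e \<otimes> \<epsilon>\<^sub>s (e \<otimes> a)) (e \<otimes> b))"
    using bilinear_form_compress[OF b1] by (intro comult_cong) (auto simp: e1)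
  also have "\<dots> = \<Delta> (e \<otimes> x) (\<lambda>a b. B (e \<otimes> \<epsilon>\<^sub>s a) (e \<otimes> b))"
    by (rule comult_proj_left) auto
  also have "\<dots> = \<Delta> x (\<lambda>a b. B (e \<otimes> \<epsilon>\<^sub>s a) (e \<otimes> b))" by simp
  also have "\<dots> = \<Delta> \<one> (\<lambda>a b. B (e \<otimes> a) (e \<otimes> (x \<otimes> b)))"
    by (rule comult_eps_s_apply[OF _ B']) simp
  \<comment> \<open>A second copy of \<open>e\<close> costs nothing; sliding it out turns
    \<open>\<Delta> \<one>\<close> into \<open>\<Delta> e\<close>, the coproduct of the unit of the
    corner.\<close>
  also have "\<dots> = \<Delta> \<one> (\<lambda>a b. B (e \<otimes> (e \<otimes> a)) (e \<otimes> (x \<otimes> b)))"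
    by (intro comult_cong) auto
  also have "\<dots> = \<Delta> (e \<otimes> \<one>) (\<lambda>a b. B (e \<otimes> a) (e \<otimes> (x \<otimes> b)))"
    by (rule comult_proj_left) auto
  also have "\<dots> = \<Delta> e (\<lambda>a b. B (e \<otimes> (e \<otimes> a)) (x \<otimes> (e \<otimes> b)))"
    using bilinear_form_compress[OF b2]
    by (simp, intro comult_cong) (simp_all add: proj_left_commute[of x])
  also have "\<dots> = comult L e (\<lambda>a b. B (e \<otimes> a) (x \<otimes> b))"
    by (rule comult_corner_apply[OF b2, symmetric])
  also have "\<dots> = (pure_tensor L L e x \<otimes>\<^bsub>tensor_product L L\<^esub> comult L e) B"
    using L.pure_tensor_mult_apply[OF B comult_corner_closed] by simp
  finally show "tensor_map L L (eps_s L) (\<lambda>b. b) (comult L x) B =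
    (pure_tensor L L e x \<otimes>\<^bsub>tensor_product L L\<^esub> comult L e) B" .
qed (simp_all add: tensor_outside_simps del: bilinear_form_iff)

lemma corner_antipode_eps_s:
  assumes x: "x \<in> carrier L"
  shows "tensor_lift L (\<lambda>a b. a \<otimes> b) (tensor_map L L S (\<lambda>b. b) (comult L x)) = eps_s L x"
proof (rule tensor_lift_eq[OF L.separation])
  have [simp]: "x \<in> carrier K" using x by auto
  show "eps_s L x \<in> carrier L" by (rule linear_map_closed[OF linear_map_eps_s_corner x])
  fix \<phi> assume \<phi>: "linear_form L \<phi>"
  note [simp] = form_simps[OF linear_form_compress[OF \<phi>]]
  have b: "(\<lambda>a b. \<phi> (a \<otimes> b)) \<in> bilinear_forms L L"
    using linear_form_comp[OF \<phi> L.linear_map_mult(1)[OF linear_map_id]]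
      linear_form_comp[OF \<phi> L.linear_map_mult(2)[OF linear_map_id]]
    by (intro bilinear_formsI) simp_all
  have b': "(\<lambda>a b. \<phi> (S a \<otimes> b)) \<in> bilinear_forms L L"
    by (rule bilinear_form_comp[OF b linear_map_antipode_corner linear_map_id])
  have eq: "S (e \<otimes> a) \<otimes> (e \<otimes> b) = e \<otimes> (S a \<otimes> b)" if "a \<in> carrier K" "b \<in> carrier K" for a b
    using that by (simp add: antipode_mult m_assoc proj_left_commute[of "S a" b])
  have "tensor_map L L S (\<lambda>b. b) (comult L x) (\<lambda>a b. \<phi> (a \<otimes> b)) = comult L x (\<lambda>a b. \<phi> (S a \<otimes> b))"
    using b by (simp del: bilinear_form_iff)
  also have "\<dots> = \<Delta> x (\<lambda>a b. \<phi> (S (e \<otimes> a) \<otimes> (e \<otimes> b)))"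
    by (rule comult_corner_apply[OF b'])
  also have "\<dots> = \<Delta> x (\<lambda>a b. \<phi> (e \<otimes> (S a \<otimes> b)))"
    using bilinear_form_compress[OF b'] by (intro comult_cong) (auto simp: eq)
  also have "\<dots> = \<phi> (e \<otimes> \<epsilon>\<^sub>s x)"
    by (rule antipode_eps_s_apply) auto
  also have "\<dots> = \<phi> (eps_s L x)"
    using x by (simp add: eps_s_corner central)
  finally show "\<phi> (eps_s L x) = tensor_map L L S (\<lambda>b. b) (comult L x) (\<lambda>a b. \<phi> (a \<otimes> b))" ..
qed

lemma comult_corner_coassoc:
  assumes x: "x \<in> carrier L"
  shows "tensor_assoc L L L (tensor_map (tensor_product L L) L (comult L) (\<lambda>b. b) (comult L x)) =
    tensor_map L (tensor_product L L) (\<lambda>a. a) (comult L) (comult L x)"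
proof (rule tensor_eqI)
  let ?LL = "tensor_product L L"
  have [simp]: "x \<in> carrier K" "e \<otimes> x = x" using x by auto
  fix B assume B: "B \<in> bilinear_forms L ?LL"
  \<comment> \<open>The trilinear form behind \<open>B\<close>. Precomposed with compression it
    becomes the form \<open>T'\<close> on \<open>K\<close>, where coassociativity is known.\<close>
  define T where "T a b c = B a (pure_tensor L L b c)" for a b c
  have Ta: "(\<lambda>b c. T a b c) \<in> bilinear_forms L L" if "a \<in> carrier L" for a
    unfolding T_def by (rule L.pure_tensor_form_bilinear[OF bilinear_formsD2[OF B that]])
  have lin: "linear_form L (\<lambda>a. T a b c)" if "b \<in> carrier L" "c \<in> carrier L" for b c
    unfolding T_def using bilinear_formsD1[OF B] pure_tensor_closed[OF that] by simp
  have Tc: "(\<lambda>a b. T a b c) \<in> bilinear_forms L L" if "c \<in> carrier L" for c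
    using that lin bilinear_formsD1[OF Ta] by (intro bilinear_formsI)
  have Bs: "(\<lambda>s c. s (\<lambda>a b. T a b c)) \<in> bilinear_forms ?LL L"
  proof (rule bilinear_formsI)
    show "linear_form L (\<lambda>c. s (\<lambda>a b. T a b c))" if "s \<in> carrier ?LL" for s
      by (rule L.linear_form_tensor[where B = "\<lambda>c a b. T a b c"])
        (use that Tc bilinear_formsD2[OF Ta] in simp_all)
  qed (simp add: linear_form_def)
  define T' where "T' a b c = T (e \<otimes> a) (e \<otimes> b) (e \<otimes> c)" for a b c
  have eL: "e \<otimes> a \<in> carrier L" if "a \<in> carrier K" for a using that by simp
  have T': "linear_form K (\<lambda>a. T' a b c)" "linear_form K (\<lambda>a. T' b a c)"
    "linear_form K (\<lambda>a. T' b c a)" if "b \<in> carrier K" "c \<in> carrier K" for b c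
  proof -
    note bc = eL[OF that(1)] eL[OF that(2)]
    show "linear_form K (\<lambda>a. T' a b c)" unfolding T'_def
      by (rule linear_form_compress[OF lin[OF bc]])
    show "linear_form K (\<lambda>a. T' b a c)" unfolding T'_def
      by (rule linear_form_compress[OF bilinear_formsD1[OF Ta[OF bc(1)] bc(2)]])
    show "linear_form K (\<lambda>a. T' b c a)" unfolding T'_def
      by (rule linear_form_compress[OF bilinear_formsD2[OF Ta[OF bc(1)] bc(2)]])
  qed
  note [simp] = T'
  have b1: "(\<lambda>s c. comult L s (\<lambda>a b. T a b c)) \<in> bilinear_forms L L"
    by (rule bilinear_form_comp[OF Bs comult_corner_linear linear_map_id])
  have b2: "(\<lambda>a s. B a (comult L s)) \<in> bilinear_forms L L"
    by (rule bilinear_form_comp[OF B linear_map_id comult_corner_linear])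
  have eq1: "comult L (e \<otimes> s) (\<lambda>a b. T a b (e \<otimes> c)) = \<Delta> (e \<otimes> s) (\<lambda>a b. T' a b c)"
    if "s \<in> carrier K" "c \<in> carrier K" for s c
    unfolding T'_def by (rule comult_corner_apply[OF Tc[OF eL[OF that(2)]]])
  have eq2: "B (e \<otimes> a) (comult L (e \<otimes> s)) = \<Delta> (e \<otimes> s) (\<lambda>b c. T' a b c)"
    if "a \<in> carrier K" "s \<in> carrier K" for a s
  proof -
    \<comment> \<open>Here a form is evaluated at a tensor that is not elementary;
      \<open>tensor_form_pure\<close> expresses the value through \<open>T\<close>.\<close>
    have "B (e \<otimes> a) (comult L (e \<otimes> s)) = comult L (e \<otimes> s) (\<lambda>b c. T (e \<otimes> a) b c)"
      unfolding T_def using that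
      by (intro L.tensor_form_pure comult_corner_closed bilinear_formsD3[OF B eL]) auto
    then show ?thesis unfolding T'_def by (simp only: comult_corner_apply[OF Ta[OF eL[OF that(1)]]])
  qed
  have "tensor_assoc L L L (tensor_map ?LL L (comult L) (\<lambda>b. b) (comult L x)) B =
      comult L x (\<lambda>s c. comult L s (\<lambda>a b. T a b c))"
    using B Bs by (simp add: tensor_assoc_def T_def del: bilinear_form_iff)
  also have "\<dots> = \<Delta> x (\<lambda>s c. comult L (e \<otimes> s) (\<lambda>a b. T a b (e \<otimes> c)))"
    by (rule comult_corner_apply[OF b1])
  also have "\<dots> = \<Delta> x (\<lambda>s c. \<Delta> (e \<otimes> s) (\<lambda>a b. T' a b c))"
    by (rule comult_cong[OF eq1 _ bilinear_form_compress[OF b1]]) simp_all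
  \<comment> \<open>The projection leaves through the first leg, coassociativity of \<open>K\<close>
    applies, and it then re-enters through the second leg.\<close>
  also have "\<dots> = \<Delta> (e \<otimes> x) (\<lambda>s c. \<Delta> s (\<lambda>a b. T' a b c))"
    by (rule comult_proj_left) simp_all
  also have "\<dots> = \<Delta> (e \<otimes> x) (\<lambda>a s. \<Delta> s (\<lambda>b c. T' a b c))"
    by (rule coassoc_apply) simp_all
  also have "\<dots> = \<Delta> x (\<lambda>a s. \<Delta> (e \<otimes> s) (\<lambda>b c. T' a b c))"
    by (rule comult_proj_right[symmetric]) simp_all
  also have "\<dots> = \<Delta> x (\<lambda>a s. B (e \<otimes> a) (comult L (e \<otimes> s)))"
    by (rule comult_cong[OF eq2[symmetric] _ _ bilinear_form_compress[OF b2]]) simp_all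
  also have "\<dots> = comult L x (\<lambda>a s. B a (comult L s))"
    by (rule comult_corner_apply[OF b2, symmetric])
  also have "\<dots> = tensor_map L ?LL (\<lambda>a. a) (comult L) (comult L x) B"
    using B by simp
  finally show "tensor_assoc L L L (tensor_map ?LL L (comult L) (\<lambda>b. b) (comult L x)) B =
    tensor_map L ?LL (\<lambda>a. a) (comult L) (comult L x) B" .
qed (simp_all add: tensor_outside_simps tensor_assoc_def on_forms_def del: bilinear_form_iff)

lemma weak_kac_algebra_corner: "weak_kac_algebra L"
proof (intro weak_kac_algebra.intro weak_kac_algebra_axioms.intro)
  show "positive_form L (counit L)"
    using counit_positive linear_form_corner[OF linear_form_counit(1)]
    by (simp add: positive_form_def)
  show "eps_s L x \<otimes>\<^bsub>L\<^esub> y = tensor_lift L (\<lambda>a b. counit L b \<odot>\<^bsub>L\<^esub> a)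
      (pure_tensor L L \<one>\<^bsub>L\<^esub> x \<otimes>\<^bsub>tensor_product L L\<^esub> comult L y)"
    if "x \<in> carrier L" "y \<in> carrier L" for x y
    using that corner_slice[OF that] by (simp add: eps_s_corner m_assoc)
  show "antipode L (star L x) = star L (antipode L x)" if "x \<in> carrier L" for x
    using that antipode_star by simp
qed (use fd_cstar_algebra_corner comult_corner_linear comult_corner_mult comult_corner_star
    linear_map_antipode_corner comult_corner_antipode comult_corner_coassoc comult_corner_counit
    comult_corner_eps_s corner_antipode_eps_s antipode_mult in \<open>simp_all del: bilinear_form_iff\<close>)

text \<open>A form that does not distinguish \<open>a\<close> from \<open>e \<otimes> a\<close> sees
  only the part of the coproduct coming from \<open>e \<otimes> x\<close>. Two such facts for
  orthogonal projections make a term vanish.\<close>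

lemma comult_absorb_left:
  assumes x: "x \<in> carrier K" and B: "B \<in> bilinear_forms K K"
    and "\<And>a b. a \<in> carrier K \<Longrightarrow> b \<in> carrier K \<Longrightarrow> B (e \<otimes> a) b = B a b"
  shows "\<Delta> x B = \<Delta> (e \<otimes> x) B"
proof -
  have "\<Delta> x B = \<Delta> x (\<lambda>a b. B (e \<otimes> a) b)"
    by (rule comult_cong[OF _ x B bilinear_form_comp[OF B]]) (use assms(3) in auto)
  also have "\<dots> = \<Delta> (e \<otimes> x) B" by (rule comult_proj_left[OF x B])
  finally show ?thesis .
qed

lemma comult_absorb_right:
  assumes x: "x \<in> carrier K" and B: "B \<in> bilinear_forms K K"
    and "\<And>a b. a \<in> carrier K \<Longrightarrow> b \<in> carrier K \<Longrightarrow> B a (e \<otimes> b) = B a b"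
  shows "\<Delta> x B = \<Delta> (e \<otimes> x) B"
proof -
  have "\<Delta> x B = \<Delta> x (\<lambda>a b. B a (e \<otimes> b))"
    by (rule comult_cong[OF _ x B bilinear_form_comp[OF B]]) (use assms(3) in auto)
  also have "\<dots> = \<Delta> (e \<otimes> x) B" by (rule comult_proj_right[OF x B])
  finally show ?thesis .
qed

lemma hypercentral_complement: "hypercentral_projection K (\<one> \<oplus> (-1) \<odot> e)" (is "hypercentral_projection K ?f")
proof
  have "?f \<otimes> e = \<zero>"
    using add_neg_smult[of e] by (simp add: l_distr smult_mult_left)
  moreover have "?f \<otimes> ?f = ?f \<otimes> \<one> \<oplus> (-1) \<odot> (?f \<otimes> e)"
    by (subst r_distr) (simp_all add: smult_mult_right)
  ultimately show "projection K ?f"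
    by (simp add: projection_def star_add star_smult)
  show "x \<otimes> ?f = ?f \<otimes> x" if "x \<in> carrier K" for x
    using that by (simp add: l_distr r_distr smult_mult_left smult_mult_right central)
  show "\<epsilon>\<^sub>s ?f = ?f" "\<epsilon>\<^sub>t ?f = ?f"
    using linear_map_eps_s linear_map_eps_t by (simp_all add: linear_map_def source target)
qed

end

section \<open>Splitting along two complementary projections\<close>

lemma direct_sum_simps [simp]:
  "carrier (direct_sum K L) = carrier K \<times> carrier L"
  "(x, y) \<otimes>\<^bsub>direct_sum K L\<^esub> (x', y') = (x \<otimes>\<^bsub>K\<^esub> x', y \<otimes>\<^bsub>L\<^esub> y')"
  "(x, y) \<oplus>\<^bsub>direct_sum K L\<^esub> (x', y') = (x \<oplus>\<^bsub>K\<^esub> x', y \<oplus>\<^bsub>L\<^esub> y')"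
  "c \<odot>\<^bsub>direct_sum K L\<^esub> (x, y) = (c \<odot>\<^bsub>K\<^esub> x, c \<odot>\<^bsub>L\<^esub> y)"
  "\<one>\<^bsub>direct_sum K L\<^esub> = (\<one>\<^bsub>K\<^esub>, \<one>\<^bsub>L\<^esub>)"
  "star (direct_sum K L) (x, y) = (star K x, star L y)"
  "counit (direct_sum K L) (x, y) = counit K x + counit L y"
  "antipode (direct_sum K L) (x, y) = (antipode K x, antipode L y)"
  by (simp_all add: direct_sum_def Let_def star_alg.extend_def direct_sum_alg_def)

text \<open>The definition takes tensors over \<open>direct_sum_alg\<close>; adding the coalgebra
  fields leaves the carrier and the operations, and so the bilinear forms, unchanged.\<close>

lemma comult_direct_sum:
  "comult (direct_sum K L) (x, y) B =
     tensor_map (direct_sum K L) (direct_sum K L) (\<lambda>a. (a, \<zero>\<^bsub>L\<^esub>)) (\<lambda>a. (a, \<zero>\<^bsub>L\<^esub>)) (comult K x) B +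
     tensor_map (direct_sum K L) (direct_sum K L) (\<lambda>b. (\<zero>\<^bsub>K\<^esub>, b)) (\<lambda>b. (\<zero>\<^bsub>K\<^esub>, b)) (comult L y) B"
  by (simp add: direct_sum_def Let_def star_alg.extend_def direct_sum_alg_def
      tensor_map_def on_forms_def bilinear_forms_def linear_form_def)

locale complementary_projections =
  hypercentral_projection K e + F: hypercentral_projection K f
  for K :: "('a, 'm) weak_kac_scheme" (structure) and e f +
  assumes sum_one: "e \<oplus> f = \<one>"
begin

lemma complement_mult [simp]: "e \<otimes> f = \<zero>" "f \<otimes> e = \<zero>"
proof -
  have "e \<oplus> e \<otimes> f = e \<otimes> (e \<oplus> f)" by (subst r_distr) simp_all
  also have "\<dots> = e \<oplus> \<zero>" unfolding sum_one by simp
  finally show "e \<otimes> f = \<zero>" by simp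
  then show "f \<otimes> e = \<zero>" by (simp add: central)
qed

lemma complement_mult_left [simp]:
  "x \<in> carrier K \<Longrightarrow> e \<otimes> (f \<otimes> x) = \<zero>" "x \<in> carrier K \<Longrightarrow> f \<otimes> (e \<otimes> x) = \<zero>"
  by (simp_all add: m_assoc[symmetric])

lemma decompose: "x \<in> carrier K \<Longrightarrow> e \<otimes> x \<oplus> f \<otimes> x = x"
  by (simp add: l_distr[symmetric] sum_one)

abbreviation M where "M \<equiv> direct_sum L F.L"
abbreviation h where "h \<equiv> \<lambda>x. (e \<otimes> x, f \<otimes> x)"

lemma comult_direct_sum_corners:
  assumes x [simp]: "x \<in> carrier K"
  shows "comult M (h x) = tensor_map M M h h (\<Delta> x)"
proof (rule tensor_eqI)
  fix B assume B: "B \<in> bilinear_forms M M"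
  let ?i = "\<lambda>a. (e \<otimes> a, \<zero>)" and ?j = "\<lambda>a. (\<zero>, f \<otimes> a)"
  have i: "linear_map K M ?i" and j: "linear_map K M ?j" and h: "linear_map K M h"
    by (auto simp: linear_map_def r_distr smult_mult_right)
  have i': "linear_map L M (\<lambda>a. (a, \<zero>))" and j': "linear_map F.L M (\<lambda>a. (\<zero>, a))"
    by (auto simp: linear_map_def)
  have Bii: "(\<lambda>a b. B (?i a) (?i b)) \<in> bilinear_forms K K"
    and Bij: "(\<lambda>a b. B (?i a) (?j b)) \<in> bilinear_forms K K"
    and Bji: "(\<lambda>a b. B (?j a) (?i b)) \<in> bilinear_forms K K"
    and Bjj: "(\<lambda>a b. B (?j a) (?j b)) \<in> bilinear_forms K K"
    by (intro bilinear_form_comp[OF B] i j)+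
  have add: "B (h a) (h b) = (B (?i a) (?i b) + B (?i a) (?j b)) + (B (?j a) (?i b) + B (?j a) (?j b))"
    if ab: "a \<in> carrier K" "b \<in> carrier K" for a b
  proof -
    have hij: "h c = ?i c \<oplus>\<^bsub>M\<^esub> ?j c" if "c \<in> carrier K" for c
      using that by simp
    have cl: "?i c \<in> carrier M" "?j c \<in> carrier M" "h c \<in> carrier M" if "c \<in> carrier K" for c
      using that by auto
    have "B (h a) (h b) = B (?i a) (h b) + B (?j a) (h b)"
      using bilinear_formsD1[OF B cl(3)[OF ab(2)]] cl[OF ab(1)]
      unfolding hij[OF ab(1)] linear_form_def by blast
    moreover have "B u (h b) = B u (?i b) + B u (?j b)" if "u \<in> carrier M" for u
      using bilinear_formsD2[OF B that] cl[OF ab(2)]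
      unfolding hij[OF ab(2)] linear_form_def by blast
    ultimately show ?thesis using cl[OF ab(1)] by simp
  qed
  have z: "\<Delta> \<zero> G = 0" if "G \<in> bilinear_forms K K" for G
    by (rule linear_form_lin(3)[OF linear_form_comult[OF that linear_map_id]])
  \<comment> \<open>Moving \<open>e\<close> out of the first leg and \<open>f\<close> out of the
    second leaves the coproduct of \<open>f \<otimes> (e \<otimes> x)\<close>, which is
    zero.\<close>
  have ij: "\<Delta> x (\<lambda>a b. B (?i a) (?j b)) = 0"
    using comult_absorb_left[OF x Bij] F.comult_absorb_right[OF _ Bij, of "e \<otimes> x"] z[OF Bij] by simp
  have ji: "\<Delta> x (\<lambda>a b. B (?j a) (?i b)) = 0"
    using comult_absorb_right[OF x Bji] F.comult_absorb_left[OF _ Bji, of "e \<otimes> x"] z[OF Bji] by simp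
  have ii: "\<Delta> x (\<lambda>a b. B (?i a) (?i b)) = \<Delta> (e \<otimes> x) (\<lambda>a b. B (?i a) (?i b))"
    using comult_absorb_left[OF x Bii] by simp
  have jj: "\<Delta> x (\<lambda>a b. B (?j a) (?j b)) = \<Delta> (f \<otimes> x) (\<lambda>a b. B (?j a) (?j b))"
    using F.comult_absorb_left[OF x Bjj] by simp
  have "tensor_map M M h h (\<Delta> x) B = \<Delta> x (\<lambda>a b. B (h a) (h b))"
    using B by (simp del: bilinear_form_iff)
  also have "\<dots> = \<Delta> x (\<lambda>a b. (B (?i a) (?i b) + B (?i a) (?j b)) + (B (?j a) (?i b) + B (?j a) (?j b)))"
    by (rule comult_cong[OF add x bilinear_form_comp[OF B h h]
        bilinear_form_add[OF bilinear_form_add[OF Bii Bij] bilinear_form_add[OF Bji Bjj]]])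
  also have "\<dots> = (\<Delta> x (\<lambda>a b. B (?i a) (?i b)) + \<Delta> x (\<lambda>a b. B (?i a) (?j b))) +
      (\<Delta> x (\<lambda>a b. B (?j a) (?i b)) + \<Delta> x (\<lambda>a b. B (?j a) (?j b)))"
    by (simp only: tensor_add[OF comult_closed[OF x]] bilinear_form_add Bii Bij Bji Bjj)
  also have "\<dots> = \<Delta> (e \<otimes> x) (\<lambda>a b. B (?i a) (?i b)) + \<Delta> (f \<otimes> x) (\<lambda>a b. B (?j a) (?j b))"
    unfolding ij ji ii[symmetric] jj[symmetric] by simp
  also have "\<dots> = comult M (h x) B"
    using B comult_corner_apply[OF bilinear_form_comp[OF B i' i']]
      F.comult_corner_apply[OF bilinear_form_comp[OF B j' j']]
    by (simp add: comult_direct_sum del: bilinear_form_iff)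
  finally show "comult M (h x) B = tensor_map M M h h (\<Delta> x) B" ..
qed (simp_all add: comult_direct_sum tensor_outside_simps del: bilinear_form_iff)

lemma weak_kac_iso_corners: "weak_kac_iso K M h"
  unfolding weak_kac_iso_def
proof (intro conjI ballI allI)
  have "bij_betw h (carrier K) (carrier M)"
    by (rule bij_betw_byWitness[where f' = "\<lambda>(x, y). x \<oplus> y"])
      (auto simp: decompose r_distr, (metis complement_mult_left M.r_zero M.l_zero)+)
  then show "h \<in> ring_iso K M"
    by (auto simp: ring_iso_def compress_mult F.compress_mult r_distr intro!: ring_hom_memI)
  fix x assume x: "x \<in> carrier K"
  show "h (c \<odot> x) = c \<odot>\<^bsub>M\<^esub> h x" for c using x by (simp add: smult_mult_right)
  show "h (star K x) = star M (h x)" using x by (simp add: star_mult central F.central)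
  show "comult M (h x) = tensor_map M M h h (\<Delta> x)" by (rule comult_direct_sum_corners[OF x])
  have "counit M (h x) = \<epsilon> (e \<otimes> x \<oplus> f \<otimes> x)"
    using x by (subst linear_form_lin(1)[OF linear_form_counit(1)]) auto
  then show "counit M (h x) = \<epsilon> x" using x by (simp only: decompose)
  show "h (S x) = antipode M (h x)" using x by (simp add: antipode_mult central F.central)
qed

end

lemma hypercentral_projection_decomposable:
  fixes K :: "'a weak_kac"
  assumes "hypercentral_projection K e" "e \<noteq> \<zero>\<^bsub>K\<^esub>" "e \<noteq> \<one>\<^bsub>K\<^esub>"
  shows "decomposable K"
proof -
  interpret hypercentral_projection K e by fact
  let ?f = "\<one>\<^bsub>K\<^esub> \<oplus>\<^bsub>K\<^esub> (-1) \<odot>\<^bsub>K\<^esub> e"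
  have f: "hypercentral_projection K ?f" by (rule hypercentral_complement)
  have sum: "e \<oplus>\<^bsub>K\<^esub> ?f = \<one>\<^bsub>K\<^esub>"
    using add_neg_smult[of e] M.a_lcomm[of e "\<one>\<^bsub>K\<^esub>" "(-1) \<odot>\<^bsub>K\<^esub> e"] by simp
  interpret complementary_projections K e ?f
    using f sum assms(1) by (intro complementary_projections.intro complementary_projections_axioms.intro)
  have "?f \<noteq> \<zero>\<^bsub>K\<^esub>" using sum assms(3) by auto
  moreover have "e \<in> carrier L" "?f \<in> carrier F.L"
    unfolding corner_simps mem_Collect_eq
    by (rule conjI[OF proj_closed proj_idem], rule conjI[OF F.proj_closed F.proj_idem])
  ultimately have "carrier L \<noteq> {\<zero>\<^bsub>L\<^esub>}" "carrier F.L \<noteq> {\<zero>\<^bsub>F.L\<^esub>}"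
    using assms(2) unfolding corner_simps(4) by blast+
  then show ?thesis unfolding decomposable_def
    by (intro exI conjI)
      (rule weak_kac_algebra_corner F.weak_kac_algebra_corner weak_kac_iso_corners | assumption)+
qed

section \<open>The Haar projection\<close>

context weak_kac_algebra
begin

text \<open>Both \<open>p\<close> and \<open>S p\<close> equal \<open>p \<otimes> S p\<close>. The
  integral property turns its second factor into
  \<open>\<epsilon>\<^sub>s (S p) = S (\<epsilon>\<^sub>t p) = \<one>\<close>, which gives
  \<open>p\<close>; applying \<open>S\<close>, which fixes \<open>p \<otimes> S p\<close>, gives
  \<open>S p\<close>.\<close>

lemma antipode_haar_projection:
  assumes "haar_projection K p" shows "S p = p"
proof -
  have p [simp]: "p \<in> carrier K" and right: "\<And>x. x \<in> carrier K \<Longrightarrow> p \<otimes> x = p \<otimes> \<epsilon>\<^sub>s x"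
    and "\<epsilon>\<^sub>s p = \<one>" "\<epsilon>\<^sub>t p = \<one>"
    using assms by (auto simp: haar_projection_def projection_def)
  have "S p = \<epsilon>\<^sub>t p \<otimes> S p" using \<open>\<epsilon>\<^sub>t p = \<one>\<close> by simp
  also have "\<dots> = \<epsilon>\<^sub>t (S (S p)) \<otimes> S p" by simp
  also have "\<dots> = S (p \<otimes> \<epsilon>\<^sub>s (S p))"
    by (simp add: antipode_mult antipode_eps_s_eq del: antipode_antipode')
  also have "\<dots> = S (p \<otimes> S p)" by (simp add: right[symmetric])
  also have "\<dots> = p \<otimes> S p" by (simp add: antipode_mult)
  also have "\<dots> = p \<otimes> S (\<epsilon>\<^sub>t p)" using right[of "S p"] by (simp add: antipode_eps_t_eq)
  also have "\<dots> = p" using \<open>\<epsilon>\<^sub>t p = \<one>\<close> by simp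
  finally show ?thesis .
qed

lemma comult_integral_left:
  assumes p: "p \<in> carrier K" "\<And>x. x \<in> carrier K \<Longrightarrow> x \<otimes> p = \<epsilon>\<^sub>t x \<otimes> p"
    and x: "x \<in> carrier K" and B: "B \<in> bilinear_forms K K"
  shows "\<Delta> p (\<lambda>a b. B a (x \<otimes> b)) = \<Delta> p (\<lambda>a b. B (S x \<otimes> a) b)"
proof -
  note [simp] = bilinear_simps[OF B] p(1) x
  have "\<Delta> p (\<lambda>a b. B a (x \<otimes> b)) = \<Delta> (\<one> \<otimes> p) (\<lambda>a b. B a (x \<otimes> b))" by simp
  also have "\<dots> = \<Delta> \<one> (\<lambda>a b. \<Delta> p (\<lambda>c d. B (a \<otimes> c) (x \<otimes> (b \<otimes> d))))"
    by (rule comult_mult_apply) auto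
  also have "\<dots> = \<Delta> \<one> (\<lambda>a b. \<Delta> p (\<lambda>c d. B (a \<otimes> c) (x \<otimes> b \<otimes> d)))"
    by (intro comult_cong) (auto simp: m_assoc)
  \<comment> \<open>The axiom \<open>eps_s_comult\<close>, read from right to left, trades the
    factor \<open>x\<close> beside \<open>\<Delta> \<one>\<close> for its own coproduct.\<close>
  also have "\<dots> = \<Delta> x (\<lambda>a b. \<Delta> p (\<lambda>c d. B (\<epsilon>\<^sub>s a \<otimes> c) (b \<otimes> d)))"
    by (rule comult_eps_s_apply[symmetric]) auto
  also have "\<dots> = \<Delta> x (\<lambda>s b. \<Delta> s (\<lambda>a a'. \<Delta> p (\<lambda>c d. B (S a \<otimes> a' \<otimes> c) (b \<otimes> d))))"
  proof (rule comult_cong)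
    fix a b assume [simp]: "a \<in> carrier K" "b \<in> carrier K"
    show "\<Delta> p (\<lambda>c d. B (\<epsilon>\<^sub>s a \<otimes> c) (b \<otimes> d)) =
        \<Delta> a (\<lambda>a a'. \<Delta> p (\<lambda>c d. B (S a \<otimes> a' \<otimes> c) (b \<otimes> d)))"
      by (rule antipode_eps_s_apply[of a "\<lambda>y. \<Delta> p (\<lambda>c d. B (y \<otimes> c) (b \<otimes> d))", symmetric]) auto
  qed auto
  also have "\<dots> = \<Delta> x (\<lambda>a s. \<Delta> s (\<lambda>a' b. \<Delta> p (\<lambda>c d. B (S a \<otimes> a' \<otimes> c) (b \<otimes> d))))"
    by (rule coassoc_apply) auto
  also have "\<dots> = \<Delta> x (\<lambda>a s. \<Delta> p (\<lambda>c d. B (S a \<otimes> \<epsilon>\<^sub>t s \<otimes> c) d))"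
  proof (rule comult_cong)
    fix a s assume [simp]: "a \<in> carrier K" "s \<in> carrier K"
    have "\<Delta> s (\<lambda>a' b. \<Delta> p (\<lambda>c d. B (S a \<otimes> a' \<otimes> c) (b \<otimes> d))) =
        \<Delta> s (\<lambda>a' b. \<Delta> p (\<lambda>c d. B (S a \<otimes> (a' \<otimes> c)) (b \<otimes> d)))"
      by (intro comult_cong) (auto simp: m_assoc)
    also have "\<dots> = \<Delta> (s \<otimes> p) (\<lambda>c d. B (S a \<otimes> c) d)"
      by (rule comult_mult_apply[symmetric]) auto
    \<comment> \<open>The integral property enters here, once \<open>a'\<close> and \<open>b\<close>
      are recombined into \<open>s\<close>.\<close>
    also have "\<dots> = \<Delta> (\<epsilon>\<^sub>t s \<otimes> p) (\<lambda>c d. B (S a \<otimes> c) d)" by (simp add: p(2)[of s])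
    also have "\<dots> = \<Delta> p (\<lambda>c d. B (S a \<otimes> (\<epsilon>\<^sub>t s \<otimes> c)) d)"
      by (rule comult_target_mult(1)) (auto simp: eps_t_eps_t)
    also have "\<dots> = \<Delta> p (\<lambda>c d. B (S a \<otimes> \<epsilon>\<^sub>t s \<otimes> c) d)"
      by (intro comult_cong) (auto simp: m_assoc)
    finally show "\<Delta> s (\<lambda>a' b. \<Delta> p (\<lambda>c d. B (S a \<otimes> a' \<otimes> c) (b \<otimes> d))) =
      \<Delta> p (\<lambda>c d. B (S a \<otimes> \<epsilon>\<^sub>t s \<otimes> c) d)" .
  qed auto
  also have "\<dots> = \<Delta> p (\<lambda>a b. B (S x \<otimes> a) b)"
    by (rule antipode_mult_eps_t[of x "\<lambda>y. \<Delta> p (\<lambda>c d. B (y \<otimes> c) d)"]) auto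
  finally show ?thesis .
qed

text \<open>The mirror image of \<open>comult_integral_left\<close>: since \<open>S\<close> fixes
  \<open>p\<close>, the coproduct of \<open>p\<close> is invariant under the flip combined with
  \<open>S\<close> on both legs.\<close>

lemma comult_integral_right:
  assumes p: "p \<in> carrier K" "\<And>x. x \<in> carrier K \<Longrightarrow> x \<otimes> p = \<epsilon>\<^sub>t x \<otimes> p" "S p = p"
    and x: "x \<in> carrier K" and B: "B \<in> bilinear_forms K K"
  shows "\<Delta> p (\<lambda>a b. B (a \<otimes> x) b) = \<Delta> p (\<lambda>a b. B a (b \<otimes> S x))"
proof -
  note [simp] = bilinear_simps[OF B] p(1) x
  have S: "\<Delta> p G = \<Delta> p (\<lambda>a b. G (S b) (S a))" if "G \<in> bilinear_forms K K" for G
    using comult_antipode_apply[OF p(1) that] by (simp add: p(3))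
  have "\<Delta> p (\<lambda>a b. B (a \<otimes> x) b) = \<Delta> p (\<lambda>a b. B (S b \<otimes> x) (S a))"
    by (rule S) auto
  also have "\<dots> = \<Delta> p (\<lambda>a b. B (S (S x \<otimes> b)) (S a))"
    by (intro comult_cong) (auto simp: antipode_mult)
  also have "\<dots> = \<Delta> p (\<lambda>a b. B (S b) (S (S (S x) \<otimes> a)))"
    by (rule comult_integral_left[OF p(1,2), of "S x" "\<lambda>a b. B (S b) (S a)"]) auto
  also have "\<dots> = \<Delta> p (\<lambda>a b. B (S b) (S a \<otimes> S x))"
    by (intro comult_cong) (auto simp: antipode_mult)
  also have "\<dots> = \<Delta> p (\<lambda>a b. B a (b \<otimes> S x))"
    by (rule S[symmetric]) auto
  finally show ?thesis .
qed

end

section \<open>Slices of the coproduct of the Haar projection by the Haar trace\<close>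

locale haar = weak_kac_algebra +
  fixes p and \<tau>
  assumes haar_projection: "haar_projection K p" and haar_trace: "haar_trace K \<tau>"
begin

lemma haar_closed [simp]: "p \<in> carrier K"
  and haar_star [simp]: "star K p = p"
  and haar_idem: "p \<otimes> p = p"
  and haar_left: "x \<in> carrier K \<Longrightarrow> x \<otimes> p = \<epsilon>\<^sub>t x \<otimes> p"
  and eps_s_haar: "\<epsilon>\<^sub>s p = \<one>"
  and eps_t_haar: "\<epsilon>\<^sub>t p = \<one>"
  using haar_projection unfolding haar_projection_def projection_def by blast+

lemma antipode_haar [simp]: "S p = p"
  by (rule antipode_haar_projection[OF haar_projection])

lemma trace_faithful: "faithful_trace K \<tau>"
  using haar_trace by (simp add: haar_trace_def)

lemma trace_form: "linear_form K \<tau>"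
  using trace_faithful by (simp add: faithful_trace_def positive_form_def)

lemmas trace_simps [simp] = form_simps[OF trace_form]

lemma trace_commute: "x \<in> carrier K \<Longrightarrow> y \<in> carrier K \<Longrightarrow> \<tau> (x \<otimes> y) = \<tau> (y \<otimes> x)"
  using trace_faithful by (simp add: faithful_trace_def)

lemma trace_positive: "x \<in> carrier K \<Longrightarrow> \<tau> (star K x \<otimes> x) \<in> \<real>\<^sub>\<ge>\<^sub>0"
  and trace_definite: "x \<in> carrier K \<Longrightarrow> \<tau> (star K x \<otimes> x) = 0 \<Longrightarrow> x = \<zero>"
  using trace_faithful by (auto simp: faithful_trace_def positive_form_def)

lemmas integral_left = comult_integral_left[OF haar_closed haar_left]
lemmas integral_right = comult_integral_right[OF haar_closed haar_left antipode_haar]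

lemma comult_haar_flip: "B \<in> bilinear_forms K K \<Longrightarrow> \<Delta> p B = \<Delta> p (\<lambda>a b. B (S b) (S a))"
  using comult_antipode_apply[OF haar_closed, of B] by (simp del: bilinear_form_iff)

lemma E_s_closed [simp]: "x \<in> carrier K \<Longrightarrow> E_s K \<tau> x \<in> carrier K"
  and E_s_apply: "x \<in> carrier K \<Longrightarrow> linear_form K \<phi> \<Longrightarrow>
    \<phi> (E_s K \<tau> x) = \<Delta> x (\<lambda>a b. \<tau> a * \<phi> b)"
  unfolding E_s_def
  using slice_left_closed[OF comult_closed trace_form linear_map_id]
    slice_left_apply[OF comult_closed trace_form linear_map_id] by auto

lemma E_t_closed [simp]: "x \<in> carrier K \<Longrightarrow> E_t K \<tau> x \<in> carrier K"
  and E_t_apply: "x \<in> carrier K \<Longrightarrow> linear_form K \<phi> \<Longrightarrow>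
    \<phi> (E_t K \<tau> x) = \<Delta> x (\<lambda>a b. \<tau> b * \<phi> a)"
  unfolding E_t_def
  using slice_right_closed[OF comult_closed trace_form linear_map_id]
    slice_right_apply[OF comult_closed trace_form linear_map_id] by auto

lemma eps_s_E_s:
  assumes x: "x \<in> carrier K" shows "\<epsilon>\<^sub>s (E_s K \<tau> x) = E_s K \<tau> x"
proof (rule separation)
  fix \<phi> assume \<phi>: "linear_form K \<phi>"
  note [simp] = form_simps[OF \<phi>]
  have "\<phi> (E_s K \<tau> x) = \<phi> (tensor_lift K (\<lambda>a b. \<tau> a \<odot> \<epsilon>\<^sub>s b) (\<Delta> x))"
    using haar_trace x by (simp add: haar_trace_def E_s_def)
  also have "\<dots> = \<Delta> x (\<lambda>a b. \<tau> a * \<phi> (\<epsilon>\<^sub>s b))"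
    by (rule slice_left_apply) (use x in auto)
  also have "\<dots> = \<phi> (\<epsilon>\<^sub>s (E_s K \<tau> x))"
    by (rule E_s_apply[symmetric]) (use x in auto)
  finally show "\<phi> (\<epsilon>\<^sub>s (E_s K \<tau> x)) = \<phi> (E_s K \<tau> x)" ..
qed (use x in auto)

lemma eps_t_E_t:
  assumes x: "x \<in> carrier K" shows "\<epsilon>\<^sub>t (E_t K \<tau> x) = E_t K \<tau> x"
proof (rule separation)
  fix \<phi> assume \<phi>: "linear_form K \<phi>"
  note [simp] = form_simps[OF \<phi>]
  have "\<phi> (E_t K \<tau> x) = \<phi> (tensor_lift K (\<lambda>a b. \<tau> b \<odot> \<epsilon>\<^sub>t a) (\<Delta> x))"
    using haar_trace x by (simp add: haar_trace_def E_t_def)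
  also have "\<dots> = \<Delta> x (\<lambda>a b. \<tau> b * \<phi> (\<epsilon>\<^sub>t a))"
    by (rule slice_right_apply) (use x in auto)
  also have "\<dots> = \<phi> (\<epsilon>\<^sub>t (E_t K \<tau> x))"
    by (rule E_t_apply[symmetric]) (use x in auto)
  finally show "\<phi> (\<epsilon>\<^sub>t (E_t K \<tau> x)) = \<phi> (E_t K \<tau> x)" ..
qed (use x in auto)

text \<open>On elements fixed by \<open>\<epsilon>\<^sub>s\<close> the trace agrees with the counit,
  and the counit cancels the remaining leg of the coproduct.\<close>

lemma trace_E_s:
  assumes x: "x \<in> carrier K" shows "\<tau> (E_s K \<tau> x) = \<tau> x"
proof -
  have "\<tau> (E_s K \<tau> x) = \<epsilon> (E_s K \<tau> x)"
    using haar_trace x eps_s_E_s[OF x] unfolding haar_trace_def by (metis E_s_closed)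
  also have "\<dots> = \<Delta> x (\<lambda>a b. \<epsilon> b * \<tau> a)"
    using x by (subst E_s_apply) (auto simp: mult.commute)
  also have "\<dots> = \<tau> x"
    by (rule counit_right_apply) (use x trace_form in auto)
  finally show ?thesis .
qed

lemma E_s_haar_central:
  assumes x: "x \<in> carrier K" shows "x \<otimes> E_s K \<tau> p = E_s K \<tau> p \<otimes> x"
proof (rule separation)
  fix \<phi> assume \<phi>: "linear_form K \<phi>"
  note [simp] = form_simps[OF \<phi>] x
  have "\<phi> (x \<otimes> E_s K \<tau> p) = \<Delta> p (\<lambda>a b. \<tau> a * \<phi> (x \<otimes> b))"
    by (rule E_s_apply) auto
  also have "\<dots> = \<Delta> p (\<lambda>a b. \<tau> (S x \<otimes> a) * \<phi> b)"
    by (rule integral_left[of x "\<lambda>a b. \<tau> a * \<phi> b"]) auto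
  also have "\<dots> = \<Delta> p (\<lambda>a b. \<tau> (a \<otimes> S x) * \<phi> b)"
    by (intro comult_cong) (auto simp: trace_commute)
  also have "\<dots> = \<Delta> p (\<lambda>a b. \<tau> a * \<phi> (b \<otimes> S (S x)))"
    by (rule integral_right[of "S x" "\<lambda>a b. \<tau> a * \<phi> b"]) auto
  also have "\<dots> = \<phi> (E_s K \<tau> p \<otimes> x)"
    by (subst E_s_apply[of p "\<lambda>y. \<phi> (y \<otimes> x)"]) auto
  finally show "\<phi> (x \<otimes> E_s K \<tau> p) = \<phi> (E_s K \<tau> p \<otimes> x)" .
qed (use x in auto)

lemma E_t_haar_central:
  assumes x: "x \<in> carrier K" shows "x \<otimes> E_t K \<tau> p = E_t K \<tau> p \<otimes> x"
proof (rule separation)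
  fix \<phi> assume \<phi>: "linear_form K \<phi>"
  note [simp] = form_simps[OF \<phi>] x
  have "\<phi> (E_t K \<tau> p \<otimes> x) = \<Delta> p (\<lambda>a b. \<tau> b * \<phi> (a \<otimes> x))"
    by (rule E_t_apply[of p "\<lambda>y. \<phi> (y \<otimes> x)"]) auto
  also have "\<dots> = \<Delta> p (\<lambda>a b. \<tau> (b \<otimes> S x) * \<phi> a)"
    by (rule integral_right[of x "\<lambda>a b. \<tau> b * \<phi> a"]) auto
  also have "\<dots> = \<Delta> p (\<lambda>a b. \<tau> (S x \<otimes> b) * \<phi> a)"
    by (intro comult_cong) (auto simp: trace_commute)
  also have "\<dots> = \<Delta> p (\<lambda>a b. \<tau> b * \<phi> (S (S x) \<otimes> a))"
    by (rule integral_left[of "S x" "\<lambda>a b. \<tau> b * \<phi> a"]) auto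
  also have "\<dots> = \<phi> (x \<otimes> E_t K \<tau> p)"
    by (subst E_t_apply[of p "\<lambda>y. \<phi> (x \<otimes> y)"]) auto
  finally show "\<phi> (x \<otimes> E_t K \<tau> p) = \<phi> (E_t K \<tau> p \<otimes> x)" ..
qed (use x in auto)

text \<open>No Casimir element is built: the double sum of \<open>\<tau> (S (c \<otimes> b))\<close>
  times \<open>a \<otimes> d\<close>, with (a, b) and (c, d) from two copies of
  \<open>\<Delta> p\<close>, takes its place. Moving \<open>c\<close> away gives \<open>z\<close>
  times \<open>\<epsilon>\<^sub>s p\<close>, moving \<open>b\<close> away gives \<open>z'\<close>
  times \<open>\<epsilon>\<^sub>t p\<close>.\<close>

lemma E_s_haar_eq_E_t_haar: "E_s K \<tau> p = E_t K \<tau> p"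
proof -
  \<comment> \<open>Applying \<open>S\<close> turns slices by the trace into slices by the trace
    composed with \<open>S\<close> at the opposite leg, the shape that the double sum
    produces.\<close>
  define z z' where "z = S (E_s K \<tau> p)" and "z' = S (E_t K \<tau> p)"
  have [simp]: "z \<in> carrier K" "z' \<in> carrier K" by (auto simp: z_def z'_def)
  have central: "x \<otimes> z = z \<otimes> x" "x \<otimes> z' = z' \<otimes> x" if "x \<in> carrier K" for x
    using that E_s_haar_central[of "S x"] E_t_haar_central[of "S x"]
    unfolding z_def z'_def by (metis E_s_closed E_t_closed antipode_antipode antipode_closed
      antipode_mult haar_closed)+
  have z: "\<phi> z = \<Delta> p (\<lambda>a b. \<tau> (S b) * \<phi> a)" if \<phi>: "linear_form K \<phi>" for \<phi>
  proof -
    note [simp] = form_simps[OF \<phi>]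
    have "\<phi> z = \<Delta> p (\<lambda>a b. \<tau> a * \<phi> (S b))"
      unfolding z_def by (rule E_s_apply) auto
    also have "\<dots> = \<Delta> p (\<lambda>a b. \<tau> (S b) * \<phi> (S (S a)))"
      by (rule comult_haar_flip) auto
    also have "\<dots> = \<Delta> p (\<lambda>a b. \<tau> (S b) * \<phi> a)"
      by (intro comult_cong) auto
    finally show ?thesis .
  qed
  have z': "\<phi> z' = \<Delta> p (\<lambda>a b. \<tau> (S a) * \<phi> b)" if \<phi>: "linear_form K \<phi>" for \<phi>
  proof -
    note [simp] = form_simps[OF \<phi>]
    have "\<phi> z' = \<Delta> p (\<lambda>a b. \<tau> b * \<phi> (S a))"
      unfolding z'_def by (rule E_t_apply) auto
    also have "\<dots> = \<Delta> p (\<lambda>a b. \<tau> (S a) * \<phi> (S (S b)))"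
      by (rule comult_haar_flip) auto
    also have "\<dots> = \<Delta> p (\<lambda>a b. \<tau> (S a) * \<phi> b)"
      by (intro comult_cong) auto
    finally show ?thesis .
  qed
  have "z = z'"
  proof (rule separation)
    fix \<phi> assume \<phi>: "linear_form K \<phi>"
    note [simp] = form_simps[OF \<phi>]
    have "\<phi> z = \<phi> (\<epsilon>\<^sub>s p \<otimes> z)" by (simp add: eps_s_haar)
    also have "\<dots> = \<Delta> p (\<lambda>c d. \<phi> (S c \<otimes> d \<otimes> z))"
      by (rule antipode_eps_s_apply[of p "\<lambda>y. \<phi> (y \<otimes> z)", symmetric]) auto
    also have "\<dots> = \<Delta> p (\<lambda>c d. \<Delta> p (\<lambda>a b. \<tau> (S (c \<otimes> b)) * \<phi> (a \<otimes> d)))"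
    proof (rule comult_cong)
      fix c d assume [simp]: "c \<in> carrier K" "d \<in> carrier K"
      have "\<phi> (S c \<otimes> d \<otimes> z) = \<phi> (S c \<otimes> (z \<otimes> d))"
        by (simp add: m_assoc central(1)[of d])
      also have "\<dots> = \<Delta> p (\<lambda>a b. \<tau> (S b) * \<phi> (S c \<otimes> (a \<otimes> d)))"
        by (rule z) auto
      also have "\<dots> = \<Delta> p (\<lambda>a b. \<tau> (S b) * \<phi> (S c \<otimes> a \<otimes> d))"
        by (intro comult_cong) (auto simp: m_assoc)
      \<comment> \<open>The leg \<open>c\<close> of one copy of \<open>p\<close> is transferred
        across the other copy.\<close>
      also have "\<dots> = \<Delta> p (\<lambda>a b. \<tau> (S (c \<otimes> b)) * \<phi> (a \<otimes> d))"
        by (rule integral_left[of c "\<lambda>a b. \<tau> (S b) * \<phi> (a \<otimes> d)", symmetric]) auto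
      finally show "\<phi> (S c \<otimes> d \<otimes> z) = \<Delta> p (\<lambda>a b. \<tau> (S (c \<otimes> b)) * \<phi> (a \<otimes> d))" .
    qed auto
    also have "\<dots> = \<Delta> p (\<lambda>a b. \<Delta> p (\<lambda>c d. \<tau> (S (c \<otimes> b)) * \<phi> (a \<otimes> d)))"
      by (rule comult_swap) auto
    also have "\<dots> = \<Delta> p (\<lambda>a b. \<phi> (z' \<otimes> (a \<otimes> S b)))"
    proof (rule comult_cong)
      fix a b assume [simp]: "a \<in> carrier K" "b \<in> carrier K"
      \<comment> \<open>With the order of the sums exchanged, \<open>b\<close> is transferred across
        the copy with legs \<open>c\<close> and \<open>d\<close>.\<close>
      have "\<Delta> p (\<lambda>c d. \<tau> (S (c \<otimes> b)) * \<phi> (a \<otimes> d)) = \<Delta> p (\<lambda>c d. \<tau> (S c) * \<phi> (a \<otimes> (d \<otimes> S b)))"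
        by (rule integral_right[of b "\<lambda>c d. \<tau> (S c) * \<phi> (a \<otimes> d)"]) auto
      also have "\<dots> = \<phi> (a \<otimes> (z' \<otimes> S b))"
        by (rule z'[symmetric]) auto
      also have "\<dots> = \<phi> (z' \<otimes> (a \<otimes> S b))"
        by (simp add: m_assoc[symmetric] central)
      finally show "\<Delta> p (\<lambda>c d. \<tau> (S (c \<otimes> b)) * \<phi> (a \<otimes> d)) = \<phi> (z' \<otimes> (a \<otimes> S b))" .
    qed auto
    also have "\<dots> = \<phi> (z' \<otimes> \<epsilon>\<^sub>t p)"
      by (rule antipode_eps_t_apply) auto
    finally show "\<phi> z = \<phi> z'" by (simp add: eps_t_haar)
  qed auto
  then show ?thesis unfolding z_def z'_def
    by (metis E_s_closed E_t_closed antipode_antipode haar_closed)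
qed

lemma trace_star:
  assumes x: "x \<in> carrier K" shows "\<tau> (star K x) = cnj (\<tau> x)"
  by (rule positive_form_star[OF _ x]) (use trace_faithful in \<open>simp add: faithful_trace_def\<close>)

text \<open>\<open>p\<close> is self-adjoint, the trace is hermitian and the coproduct preserves the
  star.\<close>

lemma star_E_s_haar: "star K (E_s K \<tau> p) = E_s K \<tau> p"
proof (rule separation)
  fix \<phi> assume \<phi>: "linear_form K \<phi>"
  note [simp] = form_simps[OF \<phi>] form_simps[OF linear_form_star[OF \<phi>]]
  let ?B = "\<lambda>a b. \<tau> a * \<phi> b"
  have "\<phi> (star K (E_s K \<tau> p)) = cnj (\<Delta> p (\<lambda>a b. \<tau> a * cnj (\<phi> (star K b))))"
    using E_s_apply[OF haar_closed linear_form_star[OF \<phi>]] by (metis complex_cnj_cnj)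
  also have "\<Delta> p (\<lambda>a b. \<tau> a * cnj (\<phi> (star K b))) =
      \<Delta> p (\<lambda>a b. cnj (?B (star K a) (star K b)))"
  proof (rule comult_cong)
    show "(\<lambda>a b. cnj (?B (star K a) (star K b))) \<in> bilinear_forms K K"
      by (rule bilinear_form_star) simp
  qed (auto simp: trace_star)
  also have "cnj \<dots> = \<Delta> (star K p) ?B"
    by (rule comult_star_apply[symmetric]) auto
  also have "\<dots> = \<phi> (E_s K \<tau> p)" by (simp add: E_s_apply)
  finally show "\<phi> (star K (E_s K \<tau> p)) = \<phi> (E_s K \<tau> p)" .
qed auto

lemma markov_condition_if_scalar:
  assumes "E_s K \<tau> p = c \<odot> \<one>"
  shows "\<exists>r>0. markov_condition K p \<tau> r"
proof (cases "\<one> = \<zero>")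
  \<comment> \<open>Indecomposability does not exclude the zero algebra; there all elements coincide
    and any positive number will do.\<close>
  case True
  then have "x = \<zero>" if "x \<in> carrier K" for x using l_one[OF that] that by simp
  then have "x = y" if "x \<in> carrier K" "y \<in> carrier K" for x y using that by metis
  then show ?thesis by (intro exI[of _ 1]) (simp add: markov_condition_def)
next
  case False
  have pos: "0 < Re (\<tau> (star K x \<otimes> x)) \<and> Im (\<tau> (star K x \<otimes> x)) = 0"
    if "x \<in> carrier K" "x \<noteq> \<zero>" for x
    using trace_positive[OF that(1)] trace_definite[OF that(1)] that(2)
    by (auto simp: complex_nonneg_Reals_iff complex_eq_iff less_le)
  \<comment> \<open>\<open>\<epsilon>\<^sub>s\<close> is linear and sends \<open>p\<close> to
    \<open>\<one>\<close>, which is nonzero in this case.\<close>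
  have "p \<noteq> \<zero>"
    using eps_s_haar False linear_map_zero[OF linear_map_eps_s] by auto
  with pos[of p] have p: "0 < Re (\<tau> p)" "Im (\<tau> p) = 0" by (auto simp: haar_idem)
  from pos[of \<one>] False have one: "0 < Re (\<tau> \<one>)" "Im (\<tau> \<one>) = 0" by auto
  have "\<tau> p = c * \<tau> \<one>"
    using trace_E_s[of p] assms linear_form_lin(2)[OF trace_form, of \<one> c] by simp
  \<comment> \<open>A quotient of two positive numbers; so the a priori complex scalar is real as
    well as positive.\<close>
  then have c: "c = complex_of_real (Re (\<tau> p) / Re (\<tau> \<one>))"
    using one p by (simp add: complex_eq_iff)
  have "0 < Re (\<tau> p) / Re (\<tau> \<one>)" using p one by simp
  moreover have "markov_condition K p \<tau> (Re (\<tau> p) / Re (\<tau> \<one>))"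
    unfolding markov_condition_def c[symmetric] using assms E_s_haar_eq_E_t_haar by simp
  ultimately show ?thesis by blast
qed

lemma exists_hypercentral_projection:
  assumes nonscalar: "\<And>c. E_s K \<tau> p \<noteq> c \<odot> \<one>"
  obtains e where "hypercentral_projection K e" "e \<noteq> \<zero>" "e \<noteq> \<one>"
proof -
  define w where "w = E_s K \<tau> p"
  define H where "H = {v \<in> carrier K. (\<forall>x\<in>carrier K. x \<otimes> v = v \<otimes> x) \<and> \<epsilon>\<^sub>s v = v \<and> \<epsilon>\<^sub>t v = v}"
  have w [simp]: "w \<in> carrier K" by (simp add: w_def)
  have wH: "w \<in> H"
    \<comment> \<open>Being equal to \<open>E_t K \<tau> p\<close>, this source element is a target
      element too.\<close>
    using E_s_haar_central eps_s_E_s[of p] eps_t_E_t[of p] E_s_haar_eq_E_t_haar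
    by (simp add: H_def w_def)
  have step: "a \<odot> \<one> \<oplus> w \<otimes> y \<in> H" if y: "y \<in> H" for a y
  proof -
    have [simp]: "y \<in> carrier K" using y by (simp add: H_def)
    have "x \<otimes> (w \<otimes> y) = w \<otimes> y \<otimes> x" if x: "x \<in> carrier K" for x
    proof -
      have wx: "x \<otimes> w = w \<otimes> x" and yx: "x \<otimes> y = y \<otimes> x"
        using x wH y unfolding H_def by blast+
      have "x \<otimes> (w \<otimes> y) = w \<otimes> x \<otimes> y" using x by (simp add: m_assoc[symmetric] wx)
      also have "\<dots> = w \<otimes> y \<otimes> x" using x by (simp add: m_assoc yx)
      finally show ?thesis .
    qed
    moreover have "\<epsilon>\<^sub>s (w \<otimes> y) = w \<otimes> y" "\<epsilon>\<^sub>t (w \<otimes> y) = w \<otimes> y"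
      using wH y unfolding H_def by (intro eps_s_mult_fixed eps_t_mult_fixed; blast)+
    ultimately show ?thesis
      using linear_map_eps_s linear_map_eps_t unfolding H_def
      by (simp add: linear_map_def l_distr r_distr smult_mult_left smult_mult_right)
  qed
  have zero: "\<zero> \<in> H"
    unfolding H_def by (simp add: linear_map_zero linear_map_eps_s linear_map_eps_t)
  obtain P where P: "projection K (poly_calc w P)" "poly_calc w P \<noteq> \<zero>" "poly_calc w P \<noteq> \<one>"
    by (rule spectral_projection[OF w star_E_s_haar[folded w_def] nonscalar[folded w_def]]) (rule that)
  \<comment> \<open>A spectral projection that is a polynomial in \<open>w\<close> inherits
    centrality and both Cartan conditions by Horner induction.\<close>
  have "poly_calc w P \<in> H" by (rule poly_calc_induct[OF w zero step])
  then have "hypercentral_projection K (poly_calc w P)"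
    using P(1) by unfold_locales (auto simp: H_def)
  with P show thesis using that by blast
qed

end

theorem proposition3p4:
  fixes K :: "'a weak_kac" and p :: 'a and \<tau> :: "'a \<Rightarrow> complex"
  assumes "weak_kac_algebra K"
    and "\<not> decomposable K"
    and "haar_projection K p"
    and "haar_trace K \<tau>"
  shows "\<exists>r::real. r > 0 \<and> markov_condition K p \<tau> r"
proof -
  interpret haar K p \<tau>
    using assms by (intro haar.intro haar_axioms.intro)
  show ?thesis
  proof (cases "\<exists>c. E_s K \<tau> p = c \<odot>\<^bsub>K\<^esub> \<one>\<^bsub>K\<^esub>")
    case True
    then show ?thesis using markov_condition_if_scalar by blast
  next
    case False
    then have "E_s K \<tau> p \<noteq> c \<odot>\<^bsub>K\<^esub> \<one>\<^bsub>K\<^esub>" for c by simp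
    then obtain e where e: "hypercentral_projection K e" "e \<noteq> \<zero>\<^bsub>K\<^esub>" "e \<noteq> \<one>\<^bsub>K\<^esub>"
      by (rule exists_hypercentral_projection)
    with assms(2) show ?thesis using hypercentral_projection_decomposable[OF e] by simp
  qed
qed

end
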